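(* Let $\zeta=(P,B,\Delta_P)$ be a quantum principal $\mathcal G$-bundle with a differential calculus, let $\omega$ be any quantum principal connection on $\zeta$, and let $\delta^V$ be a finite-dimensional $\mathcal G$-corepresentation. Let $\widehat\nabla^\omega_V$ be the induced quantum linear connection on the associated right quantum vector bundle $E^V_{\mathrm R}=\mathrm{Mor}(\delta^V,\Delta_P)$ and let $d^{\widehat\nabla^\omega_V}:E^V_{\mathrm R}\otimes_B\Omega^\bullet(B)\to E^V_{\mathrm R}\otimes_B\Omega^\bullet(B)$ be its exterior covariant derivative. Then $$d^{\widehat{\nabla}^{\omega}_{V}}= \widehat{\Upsilon}_{V}\circ \widehat{D}^{\omega}\circ \widehat{\Upsilon}^{-1}_{V},$$ where $\widehat D^\omega$ acts on $\mathrm{Mor}(\delta^V,\Delta_{\mathrm{Hor}})$ by $\tau\mapsto \widehat D^\omega\circ\tau$.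
   Context: All algebras are associative unital $\ast$-algebras over $\mathbb C$. $\mathcal G$ is a compact matrix quantum group (Woronowicz) with dense $\ast$-Hopf algebra $(H,\Delta,\epsilon,S,\ast)$; Sweedler notation is used. A corepresentation is a linear map $\delta^V:V\to V\otimes H$ with $(\mathrm{id}\otimes\epsilon)\delta^V=\mathrm{id}$, $(\mathrm{id}\otimes\Delta)\delta^V=(\delta^V\otimes\mathrm{id})\delta^V$; $\mathrm{Mor}(\delta^V,\delta^W)$ is the set of linear $T:V\to W$ with $(T\otimes \mathrm{id})\delta^V=\delta^W T$. Every finite-dimensional corepresentation is taken unitary for a chosen inner product. A quantum principal $\mathcal G$-bundle (qpb) $\zeta=(P,B,\Delta_P)$: a $\ast$-algebra $P$, a $\ast$-subalgebra $B$, and a $\ast$-algebra morphism $\Delta_P:P\to P\otimes H$ that is a corepresentation, such that $\Delta_P(x)=x\otimes 1$ iff $x\in B$, and $x\otimes y\mapsto (x\otimes 1)\Delta_P(y)$ maps $P\otimes P$ onto $P\otimes H$. Standing assumption: $B$ can be completed to a $C^\ast$-algebra, and (as follows in this setting) for every irreducible finite-dimensional $\delta^V$ with orthonormal basis $\{e_i\}_{i=1}^{n_V}$ there are $T^{\mathrm L}_1,\dots,T^{\mathrm L}_{d_V}\in\mathrm{Mor}(\delta^V,\Delta_P)$ with $\sum_k T^{\mathrm L}_k(e_i)^\ast T^{\mathrm L}_k(e_j)=\delta_{ij}1$. Graded differential $\ast$-algebras have $d(w^\ast)=(dw)^\ast$, $(wv)^\ast=(-1)^{kl}v^\ast w^\ast$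 for degrees $k,l$, and tensor products are graded. Let $(\Gamma,d)$ be a bicovariant first-order differential $\ast$-calculus over $H$, $\mathfrak{qg}^\#\subset\Gamma$ its space of left-invariant elements, $\pi:H\to\mathfrak{qg}^\#$, $\pi(g)=S(g^{(1)})dg^{(2)}$ (surjective), and $\mathrm{ad}:\mathfrak{qg}^\#\to\mathfrak{qg}^\#\otimes H$ the corepresentation with $\mathrm{ad}(\pi(g))=\pi(g^{(2)})\otimes S(g^{(1)})g^{(3)}$. $\Gamma^\wedge$ is the universal differential envelope: the quotient of $\bigoplus_k\Gamma^{\otimes_H k}$ by the two-sided ideal generated by $\sum_i dg_i\otimes_H dh_i$ whenever $\sum_i g_i\,dh_i=0$; $\Delta$ extends to a graded differential $\ast$-morphism $\Gamma^\wedge\to\Gamma^\wedge\otimes\Gamma^\wedge$. A differential calculus on $\zeta$: such a $(\Gamma,d)$ together with a graded differential $\ast$-algebra $\Omega^\bullet(P)$ generated by $\Omega^0(P)=P$ such that $\Delta_P$ extends to a graded differential $\ast$-algebra morphism $\Delta_{\Omega^\bullet(P)}:\Omega^\bullet(P)\to\Omega^\bullet(P)\otimes\Gamma^\wedge$. Horizontal forms: $\mathrm{Hor}^\bullet P=\{\varphi:\Delta_{\Omega^\bullet(P)}(\varphi)\in\Omega^\bullet(P)\otimes H\}$, with corepresentation $\Delta_{\mathrm{Hor}}=\Delta_{\Omega^\bullet(P)}|_{\mathrm{Hor}^\bullet P}$, written $\varphi\mapsto\varphi^{(0)}\otimes\varphi^{(1)}$. Base forms: $\Omega^\bullet(B)=\{\mu\in\Omega^\bullet(P):\Delta_{\Omega^\bullet(P)}(\mu)=\mu\otimes1\}$.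 A quantum principal connection (qpc) is a linear map $\omega:\mathfrak{qg}^\#\to\Omega^1(P)$ with $\Delta_{\Omega^\bullet(P)}(\omega(\theta))=(\omega\otimes\mathrm{id}_H)\mathrm{ad}(\theta)+1\otimes\theta$. Its covariant derivative $D^\omega:\mathrm{Hor}^\bullet P\to\mathrm{Hor}^{\bullet+1}P$ is $D^\omega(\varphi)=d\varphi-(-1)^k\varphi^{(0)}\omega(\pi(\varphi^{(1)}))$ for $\varphi\in \mathrm{Hor}^kP$, and its dual covariant derivative is $\widehat D^\omega=\ast\circ D^\omega\circ\ast$; both lie in $\mathrm{Mor}(\Delta_{\mathrm{Hor}},\Delta_{\mathrm{Hor}})$. $E^V_{\mathrm R}=\mathrm{Mor}(\delta^V,\Delta_P)$ as a right $B$-module, $(Tb)(v)=T(v)b$. $\widehat\Upsilon_V:\mathrm{Mor}(\delta^V,\Delta_{\mathrm{Hor}})\to E^V_{\mathrm R}\otimes_B\Omega^\bullet(B)$ is the inverse of the bijection $\widehat\Upsilon_V^{-1}(T\otimes_B\mu)=T\mu$. The induced quantum linear connection is $\widehat\nabla^\omega_V(T)=\widehat\Upsilon_V(\widehat D^\omega\circ T)$, $\widehat\nabla^\omega_V:E^V_{\mathrm R}\to E^V_{\mathrm R}\otimes_B\Omega^1(B)$ (it satisfies the right Leibniz rule), and $d^{\widehat\nabla^\omega_V}(T\otimes_B\mu)=\widehat\nabla^\omega_V(T)\,\mu+T\otimes_Bd\mu$. *)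

theory Defs
  imports Complex_Main "HOL-Library.Poly_Mapping" "HOL-Library.Function_Algebras"
begin

section \<open>Complex vector spaces and star algebras\<close>

class complex_vector = ab_group_add +
  fixes scaleC :: "complex \<Rightarrow> 'a \<Rightarrow> 'a"  (infixr \<open>*\<^sub>C\<close> 75)
  assumes scaleC_add_right: "c *\<^sub>C (x + y) = c *\<^sub>C x + c *\<^sub>C y"
    and scaleC_add_left: "(b + c) *\<^sub>C x = b *\<^sub>C x + c *\<^sub>C x"
    and scaleC_scaleC: "b *\<^sub>C (c *\<^sub>C x) = (b * c) *\<^sub>C x"
    and scaleC_one: "1 *\<^sub>C x = x"

interpretation complex_vector:
  vector_space "scaleC :: complex \<Rightarrow> 'a \<Rightarrow> 'a::complex_vector"
  by unfold_locales (rule scaleC_add_right scaleC_add_left scaleC_scaleC scaleC_one)+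

abbreviation cspan :: "'a::complex_vector set \<Rightarrow> 'a set"
  where "cspan \<equiv> module.span scaleC"

abbreviation csubspace :: "'a::complex_vector set \<Rightarrow> bool"
  where "csubspace \<equiv> module.subspace scaleC"

abbreviation clinear :: "('a::complex_vector \<Rightarrow> 'b::complex_vector) \<Rightarrow> bool"
  where "clinear \<equiv> Vector_Spaces.linear scaleC scaleC"

definition cbilinear :: "('a::complex_vector \<Rightarrow> 'b::complex_vector \<Rightarrow> 'c::complex_vector) \<Rightarrow> bool"
  where "cbilinear f \<longleftrightarrow> (\<forall>x. clinear (f x)) \<and> (\<forall>y. clinear (\<lambda>x. f x y))"

definition finite_dim :: "'a::complex_vector set \<Rightarrow> bool"
  where "finite_dim V \<longleftrightarrow> (\<exists>F. finite F \<and> cspan F = V)"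

instantiation complex :: complex_vector
begin
definition scaleC_complex :: "complex \<Rightarrow> complex \<Rightarrow> complex"
  where "scaleC_complex = (*)"
instance
  by standard (simp_all add: scaleC_complex_def algebra_simps)
end

instantiation "fun" :: (type, complex_vector) complex_vector
begin
definition scaleC_fun :: "complex \<Rightarrow> ('a \<Rightarrow> 'b) \<Rightarrow> 'a \<Rightarrow> 'b"
  where "scaleC_fun c f = (\<lambda>x. c *\<^sub>C f x)"
instance
  by standard (simp_all add: scaleC_fun_def fun_eq_iff scaleC_add_right scaleC_add_left
      scaleC_scaleC scaleC_one)
end

instantiation poly_mapping :: (type, complex_vector) complex_vector
begin
definition scaleC_poly_mapping :: "complex \<Rightarrow> ('a \<Rightarrow>\<^sub>0 'b) \<Rightarrow> 'a \<Rightarrow>\<^sub>0 'b"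
  where "scaleC_poly_mapping c p = Poly_Mapping.map (scaleC c) p"
instance
proof
  have lk: "Poly_Mapping.lookup (c *\<^sub>C p) k = c *\<^sub>C Poly_Mapping.lookup p k" for c and p :: "'a \<Rightarrow>\<^sub>0 'b" and k
    by (cases "Poly_Mapping.lookup p k = 0")
      (simp_all add: scaleC_poly_mapping_def Poly_Mapping.map.rep_eq when_def)
  show "c *\<^sub>C (x + y) = c *\<^sub>C x + c *\<^sub>C y" "(b + c) *\<^sub>C x = b *\<^sub>C x + c *\<^sub>C x"
    "b *\<^sub>C (c *\<^sub>C x) = (b * c) *\<^sub>C x" "1 *\<^sub>C x = x"
    for b c and x y :: "'a \<Rightarrow>\<^sub>0 'b"
    by (rule poly_mapping_eqI,
        simp add: lk lookup_add scaleC_add_right scaleC_add_left scaleC_scaleC scaleC_one)+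
qed
end

class star_vector = complex_vector +
  fixes star :: "'a \<Rightarrow> 'a"
  assumes star_add: "star (x + y) = star x + star y"
    and star_scaleC: "star (c *\<^sub>C x) = cnj c *\<^sub>C star x"
    and star_star: "star (star x) = x"

text \<open>The classes below extend \<^class>\<open>ring\<close> and \<^class>\<open>monoid_mult\<close> instead of \<^class>\<open>ring_1\<close>, so
  that the zero algebra is not excluded.\<close>

class star_algebra = star_vector + ring + monoid_mult +
  assumes mult_scaleC_left: "(c *\<^sub>C x) * y = c *\<^sub>C (x * y)"
    and mult_scaleC_right: "x * (c *\<^sub>C y) = c *\<^sub>C (x * y)"
    and star_mult: "star (x * y) = star y * star x"

text \<open>Graded differential star algebras. The grading is given by the projections \<open>hcomp k\<close> onto the
  homogeneous components.\<close>

class graded_diff_star_algebra = star_vector + ring + monoid_mult +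
  fixes hcomp :: "nat \<Rightarrow> 'a \<Rightarrow> 'a"
    and diff :: "'a \<Rightarrow> 'a"
  assumes gmult_scaleC_left: "(c *\<^sub>C x) * y = c *\<^sub>C (x * y)"
    and gmult_scaleC_right: "x * (c *\<^sub>C y) = c *\<^sub>C (x * y)"
    and hcomp_add: "hcomp k (x + y) = hcomp k x + hcomp k y"
    and hcomp_scaleC: "hcomp k (c *\<^sub>C x) = c *\<^sub>C hcomp k x"
    and hcomp_hcomp: "hcomp j (hcomp k x) = (if j = k then hcomp k x else 0)"
    and finite_hcomp: "finite {k. hcomp k x \<noteq> 0}"
    and sum_hcomp: "(\<Sum>k | hcomp k x \<noteq> 0. hcomp k x) = x"
    and hcomp_one: "hcomp 0 1 = 1"
    and hcomp_mult: "hcomp (k + l) (hcomp k x * hcomp l y) = hcomp k x * hcomp l y"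
    and hcomp_star: "hcomp k (star x) = star (hcomp k x)"
    and star_gmult: "star (hcomp k x * hcomp l y) = (- 1) ^ (k * l) *\<^sub>C (star (hcomp l y) * star (hcomp k x))"
    and diff_add: "diff (x + y) = diff x + diff y"
    and diff_scaleC: "diff (c *\<^sub>C x) = c *\<^sub>C diff x"
    and hcomp_diff: "hcomp (Suc k) (diff x) = diff (hcomp k x)"
    and hcomp_0_diff: "hcomp 0 (diff x) = 0"
    and diff_diff: "diff (diff x) = 0"
    and diff_mult: "diff (hcomp k x * y) = diff (hcomp k x) * y + (- 1) ^ k *\<^sub>C (hcomp k x * diff y)"
    and diff_star: "diff (star x) = star (diff x)"

definition homogeneous :: "nat \<Rightarrow> 'a::graded_diff_star_algebra set"
  where "homogeneous k = {x. hcomp k x = x}"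

definition degrees :: "'a::graded_diff_star_algebra \<Rightarrow> nat set"
  where "degrees x = {k. hcomp k x \<noteq> 0}"

inductive_set star_generated :: "'a::star_algebra set \<Rightarrow> 'a set" for X
  where base: "x \<in> X \<Longrightarrow> x \<in> star_generated X"
  | one: "1 \<in> star_generated X"
  | add: "x \<in> star_generated X \<Longrightarrow> y \<in> star_generated X \<Longrightarrow> x + y \<in> star_generated X"
  | scale: "x \<in> star_generated X \<Longrightarrow> c *\<^sub>C x \<in> star_generated X"
  | mult: "x \<in> star_generated X \<Longrightarrow> y \<in> star_generated X \<Longrightarrow> x * y \<in> star_generated X"
  | star: "x \<in> star_generated X \<Longrightarrow> star x \<in> star_generated X"

inductive_set diff_generated :: "'a::graded_diff_star_algebra set \<Rightarrow> 'a set" for X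
  where base: "x \<in> X \<Longrightarrow> x \<in> diff_generated X"
  | one: "1 \<in> diff_generated X"
  | add: "x \<in> diff_generated X \<Longrightarrow> y \<in> diff_generated X \<Longrightarrow> x + y \<in> diff_generated X"
  | scale: "x \<in> diff_generated X \<Longrightarrow> c *\<^sub>C x \<in> diff_generated X"
  | mult: "x \<in> diff_generated X \<Longrightarrow> y \<in> diff_generated X \<Longrightarrow> x * y \<in> diff_generated X"
  | star: "x \<in> diff_generated X \<Longrightarrow> star x \<in> diff_generated X"
  | diff: "x \<in> diff_generated X \<Longrightarrow> diff x \<in> diff_generated X"

definition star_subalgebra :: "'a::star_algebra set \<Rightarrow> bool"
  where "star_subalgebra B \<longleftrightarrow> csubspace B \<and> 1 \<in> B \<and>
    (\<forall>x\<in>B. \<forall>y\<in>B. x * y \<in> B) \<and> (\<forall>x\<in>B. star x \<in> B)"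

definition cstar_norm_on :: "'a::star_algebra set \<Rightarrow> ('a \<Rightarrow> real) \<Rightarrow> bool"
  where "cstar_norm_on B \<nu> \<longleftrightarrow>
    (\<forall>x\<in>B. 0 \<le> \<nu> x \<and> (\<nu> x = 0 \<longleftrightarrow> x = 0)) \<and>
    (\<forall>x\<in>B. \<forall>y\<in>B. \<nu> (x + y) \<le> \<nu> x + \<nu> y) \<and>
    (\<forall>x\<in>B. \<forall>c. \<nu> (c *\<^sub>C x) = cmod c * \<nu> x) \<and>
    (\<forall>x\<in>B. \<forall>y\<in>B. \<nu> (x * y) \<le> \<nu> x * \<nu> y) \<and>
    (\<forall>x\<in>B. \<nu> (star x * x) = (\<nu> x)\<^sup>2)"


section \<open>Tensor products over the complex numbers\<close>

definition tensor_null :: "('a::complex_vector \<times> 'b::complex_vector \<Rightarrow>\<^sub>0 complex) set"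
  where "tensor_null = cspan (
    {Poly_Mapping.single (a + a', b) 1 - Poly_Mapping.single (a, b) 1 - Poly_Mapping.single (a', b) 1
      | a a' b. True} \<union>
    {Poly_Mapping.single (a, b + b') 1 - Poly_Mapping.single (a, b) 1 - Poly_Mapping.single (a, b') 1
      | a b b'. True} \<union>
    {Poly_Mapping.single (c *\<^sub>C a, b) 1 - c *\<^sub>C Poly_Mapping.single (a, b) 1 | a b c. True} \<union>
    {Poly_Mapping.single (a, c *\<^sub>C b) 1 - c *\<^sub>C Poly_Mapping.single (a, b) 1 | a b c. True})"

definition tensor_rel :: "('a::complex_vector \<times> 'b::complex_vector \<Rightarrow>\<^sub>0 complex) \<Rightarrow>
    ('a \<times> 'b \<Rightarrow>\<^sub>0 complex) \<Rightarrow> bool"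
  where "tensor_rel p q \<longleftrightarrow> p - q \<in> tensor_null"

lemma csubspace_tensor_null: "csubspace tensor_null"
  unfolding tensor_null_def by (rule complex_vector.subspace_span)

lemmas tensor_null_add = complex_vector.subspace_add[OF csubspace_tensor_null]
  and tensor_null_diff = complex_vector.subspace_diff[OF csubspace_tensor_null]
  and tensor_null_neg = complex_vector.subspace_neg[OF csubspace_tensor_null]
  and tensor_null_scale = complex_vector.subspace_scale[OF csubspace_tensor_null]
  and tensor_null_0 = complex_vector.subspace_0[OF csubspace_tensor_null]

quotient_type (overloaded) ('a, 'b) tensor =
  "'a::complex_vector \<times> 'b::complex_vector \<Rightarrow>\<^sub>0 complex" / tensor_rel
proof (rule equivpI)
  show "reflp tensor_rel"
    by (simp add: reflp_def tensor_rel_def tensor_null_0)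
  show "symp tensor_rel"
    unfolding symp_def tensor_rel_def by (metis minus_diff_eq tensor_null_neg)
  show "transp (tensor_rel :: ('c::complex_vector \<times> 'd::complex_vector \<Rightarrow>\<^sub>0 complex) \<Rightarrow> _)"
    unfolding transp_def tensor_rel_def
  proof (intro allI impI)
    fix x y z :: "'c::complex_vector \<times> 'd::complex_vector \<Rightarrow>\<^sub>0 complex"
    assume "x - y \<in> tensor_null" "y - z \<in> tensor_null"
    then have "(x - y) + (y - z) \<in> tensor_null" by (rule tensor_null_add)
    then show "x - z \<in> tensor_null" by simp
  qed
qed

instantiation tensor :: (complex_vector, complex_vector) complex_vector
begin
lift_definition zero_tensor :: "('a, 'b) tensor" is 0 .
lift_definition plus_tensor :: "('a, 'b) tensor \<Rightarrow> ('a, 'b) tensor \<Rightarrow> ('a, 'b) tensor" is "(+)"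
  unfolding tensor_rel_def by (metis add_diff_add tensor_null_add)
lift_definition minus_tensor :: "('a, 'b) tensor \<Rightarrow> ('a, 'b) tensor \<Rightarrow> ('a, 'b) tensor" is "(-)"
proof (unfold tensor_rel_def)
  fix a b c d :: "'a \<times> 'b \<Rightarrow>\<^sub>0 complex"
  assume "a - b \<in> tensor_null" "c - d \<in> tensor_null"
  then have "(a - b) - (c - d) \<in> tensor_null" by (rule tensor_null_diff)
  then show "a - c - (b - d) \<in> tensor_null" by (simp add: algebra_simps)
qed
lift_definition uminus_tensor :: "('a, 'b) tensor \<Rightarrow> ('a, 'b) tensor" is "uminus"
  unfolding tensor_rel_def by (metis minus_diff_minus tensor_null_neg)
lift_definition scaleC_tensor :: "complex \<Rightarrow> ('a, 'b) tensor \<Rightarrow> ('a, 'b) tensor" is "scaleC"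
  unfolding tensor_rel_def by (metis complex_vector.scale_right_diff_distrib tensor_null_scale)
instance
proof
  fix a b c :: "('a, 'b) tensor" and x y :: complex
  show "a + b + c = a + (b + c)" "a + b = b + a" "0 + a = a" "- a + a = 0" "a - b = a + - b"
    "x *\<^sub>C (a + b) = x *\<^sub>C a + x *\<^sub>C b" "(x + y) *\<^sub>C a = x *\<^sub>C a + y *\<^sub>C a"
    "x *\<^sub>C (y *\<^sub>C a) = (x * y) *\<^sub>C a" "1 *\<^sub>C a = a"
    by (transfer; simp add: tensor_rel_def tensor_null_0 algebra_simps scaleC_add_right
        scaleC_add_left scaleC_scaleC scaleC_one)+
qed
end

lift_definition tens :: "'a::complex_vector \<Rightarrow> 'b::complex_vector \<Rightarrow> ('a, 'b) tensor"  (infixr \<open>\<otimes>\<close> 72)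
  is "\<lambda>a b. Poly_Mapping.single (a, b) 1" .

definition free_lift :: "('x \<Rightarrow> 'c::complex_vector) \<Rightarrow> ('x \<Rightarrow>\<^sub>0 complex) \<Rightarrow> 'c"
  where "free_lift f p = (\<Sum>x\<in>Poly_Mapping.keys p. Poly_Mapping.lookup p x *\<^sub>C f x)"

lemma free_lift_superset:
  "finite A \<Longrightarrow> Poly_Mapping.keys p \<subseteq> A \<Longrightarrow>
    free_lift f p = (\<Sum>x\<in>A. Poly_Mapping.lookup p x *\<^sub>C f x)"
  unfolding free_lift_def
  by (rule sum.mono_neutral_left) (auto simp: in_keys_iff)

lemma lookup_scaleC:
  "Poly_Mapping.lookup (c *\<^sub>C p) x = c *\<^sub>C Poly_Mapping.lookup p x"
  by (cases "Poly_Mapping.lookup p x = 0")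
    (simp_all add: scaleC_poly_mapping_def Poly_Mapping.map.rep_eq when_def)

lemma free_lift_linear: "clinear (free_lift f)"
proof
  fix p q :: "'a \<Rightarrow>\<^sub>0 complex" and c
  let ?A = "Poly_Mapping.keys p \<union> Poly_Mapping.keys q"
  have "free_lift f (p + q) = (\<Sum>x\<in>?A. Poly_Mapping.lookup (p + q) x *\<^sub>C f x)"
    by (rule free_lift_superset) (auto simp: keys_add)
  also have "\<dots> = free_lift f p + free_lift f q"
    by (simp add: free_lift_superset[of ?A p] free_lift_superset[of ?A q] lookup_add
        scaleC_add_left sum.distrib)
  finally show "free_lift f (p + q) = free_lift f p + free_lift f q" .
  have "free_lift f (c *\<^sub>C p) = (\<Sum>x\<in>Poly_Mapping.keys p. Poly_Mapping.lookup (c *\<^sub>C p) x *\<^sub>C f x)"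
    by (rule free_lift_superset) (auto simp: in_keys_iff lookup_scaleC)
  also have "\<dots> = c *\<^sub>C free_lift f p"
    by (simp add: lookup_scaleC free_lift_def complex_vector.scale_sum_right scaleC_scaleC scaleC_complex_def)
  finally show "free_lift f (c *\<^sub>C p) = c *\<^sub>C free_lift f p" .
qed

lemma free_lift_single [simp]: "free_lift f (Poly_Mapping.single x c) = c *\<^sub>C f x"
  by (simp add: free_lift_def)

text \<open>Linear extension of a bilinear map to the tensor product; by \<open>tlift_linear\<close> and \<open>tlift_tens\<close>
  the result does not depend on the representative if \<open>f\<close> is bilinear. Here and below Sweedler
  notation \<open>x\<^sub>1 \<otimes> x\<^sub>2\<close> is rendered by applying \<open>tlift (\<lambda>x\<^sub>1 x\<^sub>2. \<dots>)\<close>.\<close>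

definition tlift :: "('a::complex_vector \<Rightarrow> 'b::complex_vector \<Rightarrow> 'c::complex_vector) \<Rightarrow> ('a, 'b) tensor \<Rightarrow> 'c"
  where "tlift f t = free_lift (\<lambda>(a, b). f a b) (rep_tensor t)"

lemma free_lift_tensor_null:
  assumes "cbilinear f" "p \<in> tensor_null"
  shows "free_lift (\<lambda>(a, b). f a b) p = 0"
proof -
  interpret L: Vector_Spaces.linear scaleC scaleC "free_lift (\<lambda>(a, b). f a b)"
    by (rule free_lift_linear)
  have r: "f a (b + b') = f a b + f a b'" "f a (c *\<^sub>C b) = c *\<^sub>C f a b" for a b b' c
  proof -
    interpret R: Vector_Spaces.linear scaleC scaleC "f a"
      using assms(1) by (simp add: cbilinear_def)
    show "f a (b + b') = f a b + f a b'" "f a (c *\<^sub>C b) = c *\<^sub>C f a b"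
      by (rule R.add R.scale)+
  qed
  have l: "f (a + a') b = f a b + f a' b" "f (c *\<^sub>C a) b = c *\<^sub>C f a b" for a a' b c
  proof -
    interpret R: Vector_Spaces.linear scaleC scaleC "\<lambda>x. f x b"
      using assms(1) by (simp add: cbilinear_def)
    show "f (a + a') b = f a b + f a' b" "f (c *\<^sub>C a) b = c *\<^sub>C f a b"
      by (rule R.add R.scale)+
  qed
  show ?thesis
    using assms(2) unfolding tensor_null_def
    by (rule L.eq_0_on_span[rotated])
      (auto simp: L.add L.diff L.scale r l scaleC_one)
qed

lemma tlift_abs: "cbilinear f \<Longrightarrow> tlift f (abs_tensor p) = free_lift (\<lambda>(a, b). f a b) p"
proof -
  assume f: "cbilinear f"
  interpret L: Vector_Spaces.linear scaleC scaleC "free_lift (\<lambda>(a, b). f a b)"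
    by (rule free_lift_linear)
  have "tensor_rel (rep_tensor (abs_tensor p)) p"
    using Quotient3_tensor by (rule rep_abs_rsp_left) (simp add: tensor_rel_def tensor_null_0)
  then have "free_lift (\<lambda>(a, b). f a b) (rep_tensor (abs_tensor p) - p) = 0"
    unfolding tensor_rel_def by (rule free_lift_tensor_null[OF f])
  then show ?thesis by (simp add: tlift_def L.diff)
qed

lemma tlift_tens: "cbilinear f \<Longrightarrow> tlift f (a \<otimes> b) = f a b"
  by (simp add: tens.abs_eq tlift_abs scaleC_one)

lemma tlift_linear: "cbilinear f \<Longrightarrow> clinear (tlift f)"
proof
  assume f: "cbilinear f"
  interpret L: Vector_Spaces.linear scaleC scaleC "free_lift (\<lambda>(a, b). f a b)"
    by (rule free_lift_linear)
  fix s t :: "('a, 'b) tensor" and c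
  obtain p q where "s = abs_tensor p" "t = abs_tensor q"
    by (metis Quotient3_abs_rep Quotient3_tensor)
  then show "tlift f (s + t) = tlift f s + tlift f t" "tlift f (c *\<^sub>C s) = c *\<^sub>C tlift f s"
    by (simp_all add: plus_tensor.abs_eq scaleC_tensor.abs_eq tlift_abs[OF f] L.add L.scale)
qed

definition tmap :: "('a::complex_vector \<Rightarrow> 'c::complex_vector) \<Rightarrow> ('b::complex_vector \<Rightarrow> 'd::complex_vector) \<Rightarrow>
    ('a, 'b) tensor \<Rightarrow> ('c, 'd) tensor"
  where "tmap f g = tlift (\<lambda>a b. f a \<otimes> g b)"

definition tassoc :: "(('a::complex_vector, 'b::complex_vector) tensor, 'c::complex_vector) tensor \<Rightarrow>
    ('a, ('b, 'c) tensor) tensor"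
  where "tassoc = tlift (\<lambda>t c. tlift (\<lambda>a b. a \<otimes> (b \<otimes> c)) t)"

text \<open>The image of \<open>V \<otimes> W\<close> in the tensor product of the ambient spaces.\<close>

definition tensor_sub :: "'a::complex_vector set \<Rightarrow> 'b::complex_vector set \<Rightarrow> ('a, 'b) tensor set"
  where "tensor_sub V W = cspan {a \<otimes> b | a b. a \<in> V \<and> b \<in> W}"

definition tmult :: "('a::star_algebra, 'b::star_algebra) tensor \<Rightarrow> ('a, 'b) tensor \<Rightarrow> ('a, 'b) tensor"
  where "tmult s t = tlift (\<lambda>a b. tlift (\<lambda>c d. (a * c) \<otimes> (b * d)) t) s"

definition tstar :: "('a::star_vector, 'b::star_vector) tensor \<Rightarrow> ('a, 'b) tensor"
  where "tstar t = (\<Sum>(a, b)\<in>Poly_Mapping.keys (rep_tensor t).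
    cnj (Poly_Mapping.lookup (rep_tensor t) (a, b)) *\<^sub>C (star a \<otimes> star b))"

text \<open>The graded tensor product: \<open>(a \<otimes> b)(c \<otimes> d) = (-1)\<^bsup>|b||c|\<^esup> ac \<otimes> bd\<close>,
  \<open>(a \<otimes> b)\<^sup>* = a\<^sup>* \<otimes> b\<^sup>*\<close> and \<open>d(a \<otimes> b) = da \<otimes> b + (-1)\<^bsup>|a|\<^esup> a \<otimes> db\<close>.\<close>

definition gtmult :: "('a::graded_diff_star_algebra, 'b::graded_diff_star_algebra) tensor \<Rightarrow>
    ('a, 'b) tensor \<Rightarrow> ('a, 'b) tensor"
  where "gtmult s t = tlift (\<lambda>a b. tlift (\<lambda>c d.
    \<Sum>k\<in>degrees b. \<Sum>l\<in>degrees c. (- 1) ^ (k * l) *\<^sub>C ((a * hcomp l c) \<otimes> (hcomp k b * d))) t) s"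

definition gtdiff :: "('a::graded_diff_star_algebra, 'b::graded_diff_star_algebra) tensor \<Rightarrow> ('a, 'b) tensor"
  where "gtdiff = tlift (\<lambda>a b. diff a \<otimes> b + (\<Sum>k\<in>degrees a. (- 1) ^ k *\<^sub>C (hcomp k a \<otimes> diff b)))"

definition gthcomp :: "nat \<Rightarrow> ('a::graded_diff_star_algebra, 'b::graded_diff_star_algebra) tensor \<Rightarrow> ('a, 'b) tensor"
  where "gthcomp n = tlift (\<lambda>a b. \<Sum>i\<le>n. hcomp i a \<otimes> hcomp (n - i) b)"

definition gdsa_tensor_morphism ::
    "('c::graded_diff_star_algebra \<Rightarrow> ('a::graded_diff_star_algebra, 'b::graded_diff_star_algebra) tensor) \<Rightarrow> bool"
  where "gdsa_tensor_morphism f \<longleftrightarrow> clinear f \<and> f 1 = 1 \<otimes> 1 \<and>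
    (\<forall>x y. f (x * y) = gtmult (f x) (f y)) \<and>
    (\<forall>x. f (star x) = tstar (f x)) \<and>
    (\<forall>x. f (diff x) = gtdiff (f x)) \<and>
    (\<forall>n x. f (hcomp n x) = gthcomp n (f x))"


section \<open>Hopf star algebras, corepresentations and compact matrix quantum groups\<close>

locale hopf_star_algebra =
  fixes \<Delta> :: "'h::star_algebra \<Rightarrow> ('h, 'h) tensor"
    and \<epsilon> :: "'h \<Rightarrow> complex"
    and S :: "'h \<Rightarrow> 'h"
  assumes comult_linear: "clinear \<Delta>"
    and comult_one: "\<Delta> 1 = 1 \<otimes> 1"
    and comult_mult: "\<Delta> (x * y) = tmult (\<Delta> x) (\<Delta> y)"
    and comult_star: "\<Delta> (star x) = tstar (\<Delta> x)"
    and coassociative: "tassoc (tmap \<Delta> id (\<Delta> x)) = tmap id \<Delta> (\<Delta> x)"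
    and counit_linear: "clinear \<epsilon>"
    and counit_one: "\<epsilon> 1 = 1"
    and counit_mult: "\<epsilon> (x * y) = \<epsilon> x * \<epsilon> y"
    and counit_star: "\<epsilon> (star x) = cnj (\<epsilon> x)"
    and counit_left: "tlift (\<lambda>a b. \<epsilon> a *\<^sub>C b) (\<Delta> x) = x"
    and counit_right: "tlift (\<lambda>a b. \<epsilon> b *\<^sub>C a) (\<Delta> x) = x"
    and antipode_linear: "clinear S"
    and antipode_left: "tlift (\<lambda>a b. S a * b) (\<Delta> x) = \<epsilon> x *\<^sub>C 1"
    and antipode_right: "tlift (\<lambda>a b. a * S b) (\<Delta> x) = \<epsilon> x *\<^sub>C 1"

text \<open>A linear map defined on a subspace \<open>V\<close> of a type is represented by a linear map on the whole
  type; only its values on \<open>V\<close> are constrained. Every linear map on \<open>V\<close> arises in this way.\<close>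

definition corepresentation :: "('h::star_algebra \<Rightarrow> ('h, 'h) tensor) \<Rightarrow> ('h \<Rightarrow> complex) \<Rightarrow>
    'v::complex_vector set \<Rightarrow> ('v \<Rightarrow> ('v, 'h) tensor) \<Rightarrow> bool"
  where "corepresentation \<Delta> \<epsilon> V \<delta> \<longleftrightarrow> csubspace V \<and> clinear \<delta> \<and> \<delta> ` V \<subseteq> tensor_sub V UNIV \<and>
    (\<forall>v\<in>V. tlift (\<lambda>w h. \<epsilon> h *\<^sub>C w) (\<delta> v) = v \<and> tassoc (tmap \<delta> id (\<delta> v)) = tmap id \<Delta> (\<delta> v))"

definition Mor :: "'v::complex_vector set \<Rightarrow> ('v \<Rightarrow> ('v, 'h::star_algebra) tensor) \<Rightarrow>
    'w::complex_vector set \<Rightarrow> ('w \<Rightarrow> ('w, 'h) tensor) \<Rightarrow> ('v \<Rightarrow> 'w) set"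
  where "Mor V \<delta> W \<delta>' = {T. clinear T \<and> (\<forall>v\<in>V. T v \<in> W \<and> tmap T id (\<delta> v) = \<delta>' (T v))}"

definition irreducible_corep :: "'v::complex_vector set \<Rightarrow> ('v \<Rightarrow> ('v, 'h::star_algebra) tensor) \<Rightarrow> bool"
  where "irreducible_corep V \<delta> \<longleftrightarrow> V \<noteq> {0} \<and>
    (\<forall>W. csubspace W \<and> W \<subseteq> V \<and> \<delta> ` W \<subseteq> tensor_sub W UNIV \<longrightarrow> W = {0} \<or> W = V)"

definition inner_product_on :: "'v::complex_vector set \<Rightarrow> ('v \<Rightarrow> 'v \<Rightarrow> complex) \<Rightarrow> bool"
  where "inner_product_on V ip \<longleftrightarrow>
    (\<forall>x\<in>V. \<forall>y\<in>V. \<forall>z\<in>V. ip (x + y) z = ip x z + ip y z) \<and>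
    (\<forall>c. \<forall>x\<in>V. \<forall>y\<in>V. ip (c *\<^sub>C x) y = c * ip x y) \<and>
    (\<forall>x\<in>V. \<forall>y\<in>V. ip y x = cnj (ip x y)) \<and>
    (\<forall>x\<in>V. x \<noteq> 0 \<longrightarrow> 0 < Re (ip x x))"

definition orthonormal_basis :: "'v::complex_vector set \<Rightarrow> ('v \<Rightarrow> 'v \<Rightarrow> complex) \<Rightarrow> nat \<Rightarrow> (nat \<Rightarrow> 'v) \<Rightarrow> bool"
  where "orthonormal_basis V ip n e \<longleftrightarrow> cspan (e ` {..<n}) = V \<and>
    (\<forall>i<n. \<forall>j<n. ip (e i) (e j) = (if i = j then 1 else 0))"

text \<open>Unitarity of the matrix of \<open>\<delta>\<close> does not depend on the choice of the orthonormal basis.\<close>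

definition unitary_corep :: "'v::complex_vector set \<Rightarrow> ('v \<Rightarrow> 'v \<Rightarrow> complex) \<Rightarrow>
    ('v \<Rightarrow> ('v, 'h::star_algebra) tensor) \<Rightarrow> bool"
  where "unitary_corep V ip \<delta> \<longleftrightarrow> (\<exists>n e u. orthonormal_basis V ip n e \<and>
    (\<forall>j<n. \<delta> (e j) = (\<Sum>i<n. e i \<otimes> u i j)) \<and>
    (\<forall>i<n. \<forall>j<n. (\<Sum>k<n. star (u k i) * u k j) = (if i = j then 1 else 0) \<and>
      (\<Sum>k<n. u i k * star (u j k)) = (if i = j then 1 else 0)))"

definition corep_matrix :: "('h::star_algebra \<Rightarrow> ('h, 'h) tensor) \<Rightarrow> ('h \<Rightarrow> complex) \<Rightarrow>
    nat \<Rightarrow> (nat \<Rightarrow> nat \<Rightarrow> 'h) \<Rightarrow> bool"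
  where "corep_matrix \<Delta> \<epsilon> n u \<longleftrightarrow> (\<forall>i<n. \<forall>j<n. \<Delta> (u i j) = (\<Sum>k<n. u i k \<otimes> u k j) \<and>
    \<epsilon> (u i j) = (if i = j then 1 else 0))"

text \<open>States of the C*-completion of \<open>(H, \<nu>)\<close>, restricted to \<open>H\<close>.\<close>

definition state :: "('h::star_algebra \<Rightarrow> real) \<Rightarrow> ('h \<Rightarrow> complex) \<Rightarrow> bool"
  where "state \<nu> \<phi> \<longleftrightarrow> clinear \<phi> \<and> \<phi> 1 = 1 \<and> (\<forall>x. cmod (\<phi> x) \<le> \<nu> x) \<and>
    (\<forall>x. Im (\<phi> (star x * x)) = 0 \<and> 0 \<le> Re (\<phi> (star x * x)))"

text \<open>\<open>t \<in> H \<otimes> H\<close> has norm at most \<open>r\<close> in the minimal (spatial) C*-tensor product of the completion of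
  \<open>(H, \<nu>)\<close> with itself: in the GNS representation of every product state \<open>\<phi> \<otimes> \<psi>\<close>, the operator of
  \<open>t\<close> satisfies \<open>\<parallel>t y\<parallel> \<le> r \<parallel>y\<parallel>\<close> on the dense subspace \<open>H \<otimes> H\<close>.\<close>

definition spatial_norm_le :: "('h::star_algebra \<Rightarrow> real) \<Rightarrow> ('h, 'h) tensor \<Rightarrow> real \<Rightarrow> bool"
  where "spatial_norm_le \<nu> t r \<longleftrightarrow> (\<forall>\<phi> \<psi> y. state \<nu> \<phi> \<and> state \<nu> \<psi> \<longrightarrow>
    Re (tlift (\<lambda>a b. \<phi> a * \<psi> b) (tmult (tstar (tmult t y)) (tmult t y)))
      \<le> r\<^sup>2 * Re (tlift (\<lambda>a b. \<phi> a * \<psi> b) (tmult (tstar y) y)))"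

text \<open>Woronowicz's definition, expressed on the dense Hopf star algebra \<open>H\<close>: the entries of a fundamental
  corepresentation matrix generate \<open>H\<close> as a star algebra, and \<open>H\<close> carries a C*-norm for which \<open>\<Delta>\<close> extends
  to a C*-morphism \<open>A \<rightarrow> A \<otimes> A\<close> (minimal tensor product) of the completion \<open>A\<close>, that is, \<open>\<Delta>\<close> is
  contractive. The last assumption is the standing convention that every finite-dimensional
  corepresentation is unitary for a suitable inner product (a theorem of Woronowicz); the
  type \<^typ>\<open>nat \<Rightarrow>\<^sub>0 complex\<close> contains a copy of each finite-dimensional vector space.\<close>

locale compact_matrix_quantum_group = hopf_star_algebra \<Delta> \<epsilon> S
  for \<Delta> :: "'h::star_algebra \<Rightarrow> ('h, 'h) tensor" and \<epsilon> S +
  assumes fundamental: "\<exists>n u. corep_matrix \<Delta> \<epsilon> n u \<and> star_generated {u i j | i j. i < n \<and> j < n} = UNIV"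
    and cstar_completion: "\<exists>\<nu>. cstar_norm_on UNIV \<nu> \<and> (\<forall>h. spatial_norm_le \<nu> (\<Delta> h) (\<nu> h))"
    and unitarizable: "\<And>(V :: (nat \<Rightarrow>\<^sub>0 complex) set) \<delta>.
      corepresentation \<Delta> \<epsilon> V \<delta> \<Longrightarrow> finite_dim V \<Longrightarrow> \<exists>ip. inner_product_on V ip \<and> unitary_corep V ip \<delta>"


section \<open>Quantum principal bundles\<close>

locale quantum_principal_bundle = compact_matrix_quantum_group \<Delta> \<epsilon> S
  for \<Delta> :: "'h::star_algebra \<Rightarrow> ('h, 'h) tensor" and \<epsilon> S +
  fixes B :: "'p::star_algebra set"
    and \<Delta>P :: "'p \<Rightarrow> ('p, 'h) tensor"
  assumes base_subalgebra: "star_subalgebra B"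
    and coact_corep: "corepresentation \<Delta> \<epsilon> UNIV \<Delta>P"
    and coact_one: "\<Delta>P 1 = 1 \<otimes> 1"
    and coact_mult: "\<Delta>P (x * y) = tmult (\<Delta>P x) (\<Delta>P y)"
    and coact_star: "\<Delta>P (star x) = tstar (\<Delta>P x)"
    and base_iff: "\<Delta>P x = x \<otimes> 1 \<longleftrightarrow> x \<in> B"
    and coact_surj: "surj (tlift (\<lambda>x y. tmult (x \<otimes> 1) (\<Delta>P y)))"
    and base_cstar: "\<exists>\<nu>. cstar_norm_on B \<nu>"
    and left_generators: "\<And>(V :: (nat \<Rightarrow>\<^sub>0 complex) set) \<delta> ip n e.
      corepresentation \<Delta> \<epsilon> V \<delta> \<Longrightarrow> irreducible_corep V \<delta> \<Longrightarrow>
      inner_product_on V ip \<Longrightarrow> unitary_corep V ip \<delta> \<Longrightarrow> orthonormal_basis V ip n e \<Longrightarrow>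
      \<exists>d T. (\<forall>k<d. T k \<in> Mor V \<delta> UNIV \<Delta>P) \<and>
        (\<forall>i<n. \<forall>j<n. (\<Sum>k<(d::nat). star (T k (e i)) * T k (e j)) = (if i = j then 1 else 0))"


section \<open>First-order calculus and its universal differential envelope\<close>

definition germ_map :: "('h::star_algebra \<Rightarrow> ('h, 'h) tensor) \<Rightarrow> ('h \<Rightarrow> 'h) \<Rightarrow>
    ('h \<Rightarrow> 'c::complex_vector \<Rightarrow> 'c) \<Rightarrow> ('h \<Rightarrow> 'c) \<Rightarrow> 'h \<Rightarrow> 'c"
  where "germ_map \<Delta> S lact d g = tlift (\<lambda>g1 g2. lact (S g1) (d g2)) (\<Delta> g)"

definition left_invariant :: "('c::complex_vector \<Rightarrow> ('h::star_algebra, 'c) tensor) \<Rightarrow> 'c set"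
  where "left_invariant \<Delta>L = {\<theta>. \<Delta>L \<theta> = 1 \<otimes> \<theta>}"

text \<open>\<open>\<Delta>L\<close> and \<open>\<Delta>R\<close> witness left and right covariance of the calculus \<open>(\<Gamma>, d)\<close>; they and \<open>ad\<close> (on left
  invariant elements) are determined by the remaining data. The triple \<open>g\<^sub>1 \<otimes> g\<^sub>2 \<otimes> g\<^sub>3\<close> is obtained as
  \<open>(id \<otimes> \<Delta>)\<Delta>(g)\<close>.\<close>

locale bicovariant_star_calculus = hopf_star_algebra \<Delta> \<epsilon> S
  for \<Delta> :: "'h::star_algebra \<Rightarrow> ('h, 'h) tensor" and \<epsilon> S +
  fixes lact :: "'h \<Rightarrow> 'c::star_vector \<Rightarrow> 'c"
    and ract :: "'c \<Rightarrow> 'h \<Rightarrow> 'c"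
    and d :: "'h \<Rightarrow> 'c"
    and \<Delta>L :: "'c \<Rightarrow> ('h, 'c) tensor"
    and \<Delta>R :: "'c \<Rightarrow> ('c, 'h) tensor"
    and ad :: "'c \<Rightarrow> ('c, 'h) tensor"
  assumes lact_bilinear: "cbilinear lact"
    and ract_bilinear: "cbilinear ract"
    and lact_mult: "lact (x * y) \<gamma> = lact x (lact y \<gamma>)"
    and lact_one: "lact 1 \<gamma> = \<gamma>"
    and ract_mult: "ract \<gamma> (x * y) = ract (ract \<gamma> x) y"
    and ract_one: "ract \<gamma> 1 = \<gamma>"
    and lact_ract: "lact x (ract \<gamma> y) = ract (lact x \<gamma>) y"
    and d_linear: "clinear d"
    and d_Leibniz: "d (x * y) = ract (d x) y + lact x (d y)"
    and d_generates: "cspan {lact x (d y) | x y. True} = UNIV"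
    and star_lact: "star (lact x \<gamma>) = ract (star \<gamma>) (star x)"
    and d_star: "d (star x) = star (d x)"
    and left_covariant: "clinear \<Delta>L"
      "\<Delta>L (lact x (d y)) = tlift (\<lambda>x1 x2. tlift (\<lambda>y1 y2. (x1 * y1) \<otimes> lact x2 (d y2)) (\<Delta> y)) (\<Delta> x)"
    and right_covariant: "clinear \<Delta>R"
      "\<Delta>R (lact x (d y)) = tlift (\<lambda>x1 x2. tlift (\<lambda>y1 y2. lact x1 (d y1) \<otimes> (x2 * y2)) (\<Delta> y)) (\<Delta> x)"
    and ad_corep: "corepresentation \<Delta> \<epsilon> (left_invariant \<Delta>L) ad"
    and ad_germ: "ad (germ_map \<Delta> S lact d g) =
      tlift (\<lambda>g1 t. tlift (\<lambda>g2 g3. germ_map \<Delta> S lact d g2 \<otimes> (S g1 * g3)) t) (tmap id \<Delta> (\<Delta> g))"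

text \<open>The space \<open>\<Oplus>\<^sub>k \<Gamma>\<^bsup>\<otimes>k\<^esup>\<close> of tensors over \<open>H\<close> is presented by generators \<open>(h, [\<gamma>\<^sub>1, \<dots>, \<gamma>\<^sub>k])\<close>,
  standing for \<open>h\<gamma>\<^sub>1 \<otimes>\<^sub>H \<dots> \<otimes>\<^sub>H \<gamma>\<^sub>k\<close> (and for \<open>h\<close> if \<open>k = 0\<close>). The first set collects the
  relations of this space: multilinearity and balancing over \<open>H\<close>.\<close>

definition bimodule_tensor_relators :: "('h::star_algebra \<Rightarrow> 'c::star_vector \<Rightarrow> 'c) \<Rightarrow> ('c \<Rightarrow> 'h \<Rightarrow> 'c) \<Rightarrow>
    ('h \<times> 'c list \<Rightarrow>\<^sub>0 complex) set"
  where "bimodule_tensor_relators lact ract =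
    {Poly_Mapping.single (h + h', gs) 1 - Poly_Mapping.single (h, gs) 1 - Poly_Mapping.single (h', gs) 1
      | h h' gs. True} \<union>
    {Poly_Mapping.single (c *\<^sub>C h, gs) 1 - c *\<^sub>C Poly_Mapping.single (h, gs) 1 | c h gs. True} \<union>
    {Poly_Mapping.single (h, gs @ (\<gamma> + \<gamma>') # gs') 1 - Poly_Mapping.single (h, gs @ \<gamma> # gs') 1
        - Poly_Mapping.single (h, gs @ \<gamma>' # gs') 1 | h gs \<gamma> \<gamma>' gs'. True} \<union>
    {Poly_Mapping.single (h, gs @ (c *\<^sub>C \<gamma>) # gs') 1 - c *\<^sub>C Poly_Mapping.single (h, gs @ \<gamma> # gs') 1
      | c h gs \<gamma> gs'. True} \<union>
    {Poly_Mapping.single (h * x, \<gamma> # gs) 1 - Poly_Mapping.single (h, lact x \<gamma> # gs) 1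
      | h x \<gamma> gs. True} \<union>
    {Poly_Mapping.single (h, gs @ ract \<gamma> x # \<gamma>' # gs') 1 - Poly_Mapping.single (h, gs @ \<gamma> # lact x \<gamma>' # gs') 1
      | h gs \<gamma> x \<gamma>' gs'. True}"

text \<open>Spanning set of the two-sided ideal generated by \<open>\<Sum>\<^sub>i dg\<^sub>i \<otimes>\<^sub>H dh\<^sub>i\<close> whenever \<open>\<Sum>\<^sub>i g\<^sub>i dh\<^sub>i = 0\<close>. The
  factor \<open>x\<close> is needed for right multiplication by elements of \<open>H\<close>.\<close>

definition envelope_relators :: "('h::star_algebra \<Rightarrow> 'c::star_vector \<Rightarrow> 'c) \<Rightarrow> ('c \<Rightarrow> 'h \<Rightarrow> 'c) \<Rightarrow>
    ('h \<Rightarrow> 'c) \<Rightarrow> ('h \<times> 'c list \<Rightarrow>\<^sub>0 complex) set"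
  where "envelope_relators lact ract d =
    {(\<Sum>(g, h)\<leftarrow>ps. Poly_Mapping.single (y, gs @ d g # ract (d h) x # gs') 1)
      | ps y gs x gs'. (\<Sum>(g, h)\<leftarrow>ps. lact g (d h)) = 0}"

definition word_eval :: "('h \<Rightarrow> 'g::graded_diff_star_algebra) \<Rightarrow> ('c \<Rightarrow> 'g) \<Rightarrow> ('h \<times> 'c list \<Rightarrow>\<^sub>0 complex) \<Rightarrow> 'g"
  where "word_eval iH i\<Gamma> = free_lift (\<lambda>(h, gs). iH h * prod_list (map i\<Gamma> gs))"

text \<open>\<open>'g\<close> is the universal differential envelope \<open>\<Gamma>\<^sup>\<and>\<close> of \<open>(\<Gamma>, d)\<close>, with structure maps \<open>iH : H \<rightarrow> \<Gamma>\<^sup>\<and>\<close> and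
  \<open>i\<Gamma> : \<Gamma> \<rightarrow> \<Gamma>\<^sup>\<and>\<close>: the canonical map \<open>word_eval\<close> from \<open>\<Oplus>\<^sub>k \<Gamma>\<^bsup>\<otimes>k\<^esup>\<close> is surjective with kernel the ideal
  above. \<open>\<Delta>W\<close> is the extension of \<open>\<Delta>\<close>.\<close>

locale universal_envelope = bicovariant_star_calculus \<Delta> \<epsilon> S lact ract d \<Delta>L \<Delta>R ad
  for \<Delta> :: "'h::star_algebra \<Rightarrow> ('h, 'h) tensor" and \<epsilon> S
    and lact :: "'h \<Rightarrow> 'c::star_vector \<Rightarrow> 'c" and ract d \<Delta>L \<Delta>R ad +
  fixes iH :: "'h \<Rightarrow> 'g::graded_diff_star_algebra"
    and i\<Gamma> :: "'c \<Rightarrow> 'g"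
    and \<Delta>W :: "'g \<Rightarrow> ('g, 'g) tensor"
  assumes iH_linear: "clinear iH"
    and iH_one: "iH 1 = 1"
    and iH_mult: "iH (x * y) = iH x * iH y"
    and iH_star: "iH (star x) = star (iH x)"
    and iH_degree: "iH x \<in> homogeneous 0"
    and i\<Gamma>_linear: "clinear i\<Gamma>"
    and i\<Gamma>_lact: "i\<Gamma> (lact x \<gamma>) = iH x * i\<Gamma> \<gamma>"
    and i\<Gamma>_ract: "i\<Gamma> (ract \<gamma> x) = i\<Gamma> \<gamma> * iH x"
    and i\<Gamma>_star: "i\<Gamma> (star \<gamma>) = star (i\<Gamma> \<gamma>)"
    and i\<Gamma>_degree: "i\<Gamma> \<gamma> \<in> homogeneous 1"
    and i\<Gamma>_d: "i\<Gamma> (d x) = diff (iH x)"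
    and word_eval_surj: "surj (word_eval iH i\<Gamma>)"
    and word_eval_kernel: "{p. word_eval iH i\<Gamma> p = 0} =
      cspan (bimodule_tensor_relators lact ract \<union> envelope_relators lact ract d)"
    and comult_envelope: "gdsa_tensor_morphism \<Delta>W"
    and comult_extends: "\<Delta>W (iH x) = tmap iH iH (\<Delta> x)"


section \<open>Differential calculus on a quantum principal bundle\<close>

text \<open>\<open>'w\<close> is \<open>\<Omega>\<^sup>\<bullet>(P)\<close>, and \<open>iP\<close> identifies \<open>P\<close> with \<open>\<Omega>\<^sup>0(P)\<close>.\<close>

locale qpb_calculus = quantum_principal_bundle \<Delta> \<epsilon> S B \<Delta>P +
  universal_envelope \<Delta> \<epsilon> S lact ract d \<Delta>L \<Delta>R ad iH i\<Gamma> \<Delta>W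
  for \<Delta> :: "'h::star_algebra \<Rightarrow> ('h, 'h) tensor" and \<epsilon> S
    and B :: "'p::star_algebra set" and \<Delta>P
    and lact :: "'h \<Rightarrow> 'c::star_vector \<Rightarrow> 'c" and ract d \<Delta>L \<Delta>R ad
    and iH :: "'h \<Rightarrow> 'g::graded_diff_star_algebra" and i\<Gamma> \<Delta>W +
  fixes iP :: "'p \<Rightarrow> 'w::graded_diff_star_algebra"
    and \<Delta>\<Omega> :: "'w \<Rightarrow> ('w, 'g) tensor"
  assumes iP_linear: "clinear iP"
    and iP_one: "iP 1 = 1"
    and iP_mult: "iP (x * y) = iP x * iP y"
    and iP_star: "iP (star x) = star (iP x)"
    and iP_inj: "inj iP"
    and iP_range: "range iP = homogeneous 0"
    and forms_generated: "diff_generated (range iP) = UNIV"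
    and coact_forms: "gdsa_tensor_morphism \<Delta>\<Omega>"
    and coact_extends: "\<Delta>\<Omega> (iP x) = tmap iP iH (\<Delta>P x)"

definition horizontal_forms :: "('h::star_algebra \<Rightarrow> 'g::graded_diff_star_algebra) \<Rightarrow>
    ('w::graded_diff_star_algebra \<Rightarrow> ('w, 'g) tensor) \<Rightarrow> 'w set"
  where "horizontal_forms iH \<Delta>\<Omega> = {\<phi>. \<Delta>\<Omega> \<phi> \<in> tensor_sub UNIV (range iH)}"

text \<open>\<open>\<Delta>\<^sub>H\<^sub>o\<^sub>r\<close>: the value of \<open>\<Delta>\<Omega>\<close>, regarded as an element of \<open>\<Omega>\<^sup>\<bullet>(P) \<otimes> H\<close>.\<close>

definition coact_hor :: "('h::star_algebra \<Rightarrow> 'g::graded_diff_star_algebra) \<Rightarrow>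
    ('w::graded_diff_star_algebra \<Rightarrow> ('w, 'g) tensor) \<Rightarrow> 'w \<Rightarrow> ('w, 'h) tensor"
  where "coact_hor iH \<Delta>\<Omega> \<phi> = (THE t. tmap id iH t = \<Delta>\<Omega> \<phi>)"

definition base_forms :: "('w::graded_diff_star_algebra \<Rightarrow> ('w, 'g::graded_diff_star_algebra) tensor) \<Rightarrow> 'w set"
  where "base_forms \<Delta>\<Omega> = {\<mu>. \<Delta>\<Omega> \<mu> = \<mu> \<otimes> 1}"

definition quantum_principal_connection ::
    "('c::star_vector \<Rightarrow> ('h::star_algebra, 'c) tensor) \<Rightarrow> ('c \<Rightarrow> ('c, 'h) tensor) \<Rightarrow>
     ('h \<Rightarrow> 'g::graded_diff_star_algebra) \<Rightarrow> ('c \<Rightarrow> 'g) \<Rightarrow>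
     ('w::graded_diff_star_algebra \<Rightarrow> ('w, 'g) tensor) \<Rightarrow> ('c \<Rightarrow> 'w) \<Rightarrow> bool"
  where "quantum_principal_connection \<Delta>L ad iH i\<Gamma> \<Delta>\<Omega> \<omega> \<longleftrightarrow> clinear \<omega> \<and>
    (\<forall>\<theta>\<in>left_invariant \<Delta>L. \<omega> \<theta> \<in> homogeneous 1 \<and> \<Delta>\<Omega> (\<omega> \<theta>) = tmap \<omega> iH (ad \<theta>) + 1 \<otimes> i\<Gamma> \<theta>)"

text \<open>In \<open>cov_deriv\<close> and \<open>dual_cov_deriv\<close>, \<open>\<pi>\<close> stands for \<open>germ_map \<Delta> S lact d\<close>.\<close>

definition cov_deriv :: "('h::star_algebra \<Rightarrow> 'g::graded_diff_star_algebra) \<Rightarrow>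
    ('w::graded_diff_star_algebra \<Rightarrow> ('w, 'g) tensor) \<Rightarrow> ('h \<Rightarrow> 'c) \<Rightarrow> ('c \<Rightarrow> 'w) \<Rightarrow> 'w \<Rightarrow> 'w"
  where "cov_deriv iH \<Delta>\<Omega> \<pi> \<omega> \<phi> = (\<Sum>k\<in>degrees \<phi>. diff (hcomp k \<phi>) -
    (- 1) ^ k *\<^sub>C tlift (\<lambda>\<phi>0 \<phi>1. \<phi>0 * \<omega> (\<pi> \<phi>1)) (coact_hor iH \<Delta>\<Omega> (hcomp k \<phi>)))"

definition dual_cov_deriv :: "('h::star_algebra \<Rightarrow> 'g::graded_diff_star_algebra) \<Rightarrow>
    ('w::graded_diff_star_algebra \<Rightarrow> ('w, 'g) tensor) \<Rightarrow> ('h \<Rightarrow> 'c) \<Rightarrow> ('c \<Rightarrow> 'w) \<Rightarrow> 'w \<Rightarrow> 'w"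
  where "dual_cov_deriv iH \<Delta>\<Omega> \<pi> \<omega> = star \<circ> cov_deriv iH \<Delta>\<Omega> \<pi> \<omega> \<circ> star"


section \<open>Associated right quantum vector bundle and induced linear connection\<close>

definition assoc_bundle :: "('v::complex_vector \<Rightarrow> ('v, 'h::star_algebra) tensor) \<Rightarrow>
    ('p::star_algebra \<Rightarrow> ('p, 'h) tensor) \<Rightarrow> ('v \<Rightarrow> 'p) set"
  where "assoc_bundle \<delta>V \<Delta>P = Mor UNIV \<delta>V UNIV \<Delta>P"

text \<open>\<open>E \<otimes>\<^sub>B \<Omega>\<^sup>\<bullet>(B)\<close> is the quotient of \<open>E \<otimes> \<Omega>\<^sup>\<bullet>(B)\<close> by the span of all
  \<open>Tb \<otimes> \<mu> - T \<otimes> b\<mu>\<close>; its elements are cosets.\<close>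

definition balanced_null :: "('p::star_algebra \<Rightarrow> 'w::graded_diff_star_algebra) \<Rightarrow> 'p set \<Rightarrow>
    ('v::complex_vector \<Rightarrow> 'p) set \<Rightarrow> 'w set \<Rightarrow> ('v \<Rightarrow> 'p, 'w) tensor set"
  where "balanced_null iP B E \<Omega>B =
    cspan {(\<lambda>v. T v * b) \<otimes> \<mu> - T \<otimes> (iP b * \<mu>) | T b \<mu>. T \<in> E \<and> b \<in> B \<and> \<mu> \<in> \<Omega>B}"

definition coset :: "'a::complex_vector set \<Rightarrow> 'a \<Rightarrow> 'a set"
  where "coset N x = (\<lambda>r. x + r) ` N"

definition balanced_tensor :: "('p::star_algebra \<Rightarrow> 'w::graded_diff_star_algebra) \<Rightarrow> 'p set \<Rightarrow>
    ('v::complex_vector \<Rightarrow> 'p) set \<Rightarrow> 'w set \<Rightarrow> ('v \<Rightarrow> 'p, 'w) tensor set set"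
  where "balanced_tensor iP B E \<Omega>B = coset (balanced_null iP B E \<Omega>B) ` tensor_sub E \<Omega>B"

definition representative :: "'a set \<Rightarrow> 'a"
  where "representative X = (SOME x. x \<in> X)"

text \<open>\<open>Upsilon_inv\<close> is the map \<open>T \<otimes>\<^sub>B \<mu> \<mapsto> T\<mu>\<close>, which vanishes on \<open>balanced_null\<close>, so
  that the representative is irrelevant. It is a bijection onto \<open>Mor(\<delta>\<^sup>V, \<Delta>\<^sub>H\<^sub>o\<^sub>r)\<close>, on which \<open>Upsilon\<close>
  is its inverse.\<close>

definition Upsilon_inv :: "('p::star_algebra \<Rightarrow> 'w::graded_diff_star_algebra) \<Rightarrow>
    ('v::complex_vector \<Rightarrow> 'p, 'w) tensor set \<Rightarrow> 'v \<Rightarrow> 'w"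
  where "Upsilon_inv iP X = tlift (\<lambda>T \<mu>. (\<lambda>v. iP (T v) * \<mu>)) (representative X)"

definition Upsilon :: "('p::star_algebra \<Rightarrow> 'w::graded_diff_star_algebra) \<Rightarrow> 'p set \<Rightarrow>
    ('v::complex_vector \<Rightarrow> 'p) set \<Rightarrow> 'w set \<Rightarrow> ('v \<Rightarrow> 'w) \<Rightarrow> ('v \<Rightarrow> 'p, 'w) tensor set"
  where "Upsilon iP B E \<Omega>B = inv_into (balanced_tensor iP B E \<Omega>B) (Upsilon_inv iP)"

text \<open>In the remaining definitions \<open>D\<close> stands for the dual covariant derivative.\<close>

definition induced_connection :: "('p::star_algebra \<Rightarrow> 'w::graded_diff_star_algebra) \<Rightarrow> 'p set \<Rightarrow>
    ('v::complex_vector \<Rightarrow> 'p) set \<Rightarrow> 'w set \<Rightarrow> ('w \<Rightarrow> 'w) \<Rightarrow> ('v \<Rightarrow> 'p) \<Rightarrow> ('v \<Rightarrow> 'p, 'w) tensor set"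
  where "induced_connection iP B E \<Omega>B D T = Upsilon iP B E \<Omega>B (D \<circ> (iP \<circ> T))"

text \<open>\<open>d\<^sup>\<nabla>(\<Sum>\<^sub>i T\<^sub>i \<otimes>\<^sub>B \<mu>\<^sub>i) = \<Sum>\<^sub>i (\<nabla>(T\<^sub>i) \<mu>\<^sub>i + T\<^sub>i \<otimes>\<^sub>B d\<mu>\<^sub>i)\<close>, evaluated on an
  arbitrary decomposition of the argument with \<open>T\<^sub>i \<in> E\<close> and \<open>\<mu>\<^sub>i \<in> \<Omega>\<^sup>\<bullet>(B)\<close>. The right action of \<open>\<mu>\<close>
  on \<open>E \<otimes>\<^sub>B \<Omega>\<^sup>\<bullet>(B)\<close> is \<open>tmap id (\<lambda>\<nu>. \<nu> * \<mu>)\<close> on representatives.\<close>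

definition decomposition :: "('p::star_algebra \<Rightarrow> 'w::graded_diff_star_algebra) \<Rightarrow> 'p set \<Rightarrow>
    ('v::complex_vector \<Rightarrow> 'p) set \<Rightarrow> 'w set \<Rightarrow> ('v \<Rightarrow> 'p, 'w) tensor set \<Rightarrow> (('v \<Rightarrow> 'p) \<times> 'w) list"
  where "decomposition iP B E \<Omega>B X = (SOME ps. set ps \<subseteq> E \<times> \<Omega>B \<and>
    X = coset (balanced_null iP B E \<Omega>B) (\<Sum>(T, \<mu>)\<leftarrow>ps. T \<otimes> \<mu>))"

definition ext_cov_deriv :: "('p::star_algebra \<Rightarrow> 'w::graded_diff_star_algebra) \<Rightarrow> 'p set \<Rightarrow>
    ('v::complex_vector \<Rightarrow> 'p) set \<Rightarrow> 'w set \<Rightarrow> (('v \<Rightarrow> 'p) \<Rightarrow> ('v \<Rightarrow> 'p, 'w) tensor set) \<Rightarrow>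
    ('v \<Rightarrow> 'p, 'w) tensor set \<Rightarrow> ('v \<Rightarrow> 'p, 'w) tensor set"
  where "ext_cov_deriv iP B E \<Omega>B nabla X = coset (balanced_null iP B E \<Omega>B)
    (\<Sum>(T, \<mu>)\<leftarrow>decomposition iP B E \<Omega>B X.
      tmap id (\<lambda>\<nu>. \<nu> * \<mu>) (representative (nabla T)) + T \<otimes> diff \<mu>)"

end

theory Submission
  imports Defs
begin

text \<open>\<open>\<Upsilon>\<^sup>-\<^sup>1(T \<otimes> \<mu>) = T\<mu>\<close> turns the claim into the Leibniz rule
  \<open>D((iP p) \<mu>) = D(iP p) \<mu> + (iP p) d\<mu>\<close> for the dual covariant derivative \<open>D\<close> and a base form \<open>\<mu>\<close>,
  which holds because \<open>star \<mu>\<close> is a left factor on which \<open>\<omega>\<close> does not act. What remains is that \<open>\<Upsilon>\<^sup>-\<^sup>1\<close>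
  is injective, and that \<open>D \<circ> T\<close> lies in its range. For both it suffices to find morphisms \<open>R\<^sub>k\<close> and
  base-valued linear maps \<open>\<mu>\<^sub>k\<close> with \<open>\<tau>(v) = \<Sum>\<^sub>k R\<^sub>k(v) \<mu>\<^sub>k(\<tau>)\<close> for every covariant \<open>\<tau>\<close>; they come from
  the generators \<open>T\<^sup>L\<^sub>k\<close> of the irreducible constituents of the conjugate corepresentation. Covariance of
  \<open>D \<circ> T\<close> is a computation in degree zero, based on \<open>g\<^sub>1 \<pi>(g\<^sub>2) = dg\<close> and
  \<open>h\<^sub>1 ad(\<pi>(h\<^sub>2)) = \<pi>(h\<^sub>1) \<otimes> h\<^sub>2\<close>.\<close>

section \<open>Linear and bilinear maps\<close>

text \<open>The generators expand a covariant map as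
  \<open>\<tau>(v) = \<Sum>\<^sub>k \<mu>\<^sub>k T\<^sub>k(v)\<close>, with the base form to the
  left of the morphism, whereas \<open>T \<otimes>\<^sub>B \<mu> \<mapsto> T\<mu>\<close> needs it
  to the right. The involution exchanges the sides but also conjugates the corepresentation, hence
  the detour through the conjugate. Generators are given for irreducible corepresentations inside
  \<open>nat \<Rightarrow>\<^sub>0 complex\<close>, so complete reducibility and a transfer to that
  type have to be supplied.

  The exterior derivative is defined by choosing a decomposition of its argument and representatives
  of cosets, the covariant derivative by a definite description of the horizontal coaction.
  Independence of the choices is not treated separately: the result is identified through its image
  under \<open>\<Upsilon>\<^sup>-\<^sup>1\<close>, which depends only on the coset and is injective.
  The definite description is under control on finite sums of products of a base form and an element
  of \<open>P\<close>, and no other forms occur.\<close>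

lemma clinearI:
  assumes "\<And>x y. f (x + y) = f x + f y" "\<And>c x. f (c *\<^sub>C x) = c *\<^sub>C f x"
  shows "clinear f"
  by (intro Vector_Spaces.linear.intro module_hom.intro module_hom_axioms.intro
      complex_vector.module_axioms complex_vector.vector_space_axioms assms)

lemma clinear_add: "clinear f \<Longrightarrow> f (x + y) = f x + f y"
  and clinear_scale: "clinear f \<Longrightarrow> f (c *\<^sub>C x) = c *\<^sub>C f x"
  and clinear_zero: "clinear f \<Longrightarrow> f 0 = 0"
  and clinear_diff: "clinear f \<Longrightarrow> f (x - y) = f x - f y"
  and clinear_sum: "clinear f \<Longrightarrow> f (sum g A) = (\<Sum>a\<in>A. f (g a))"
  by (simp_all add: Vector_Spaces.linear.axioms module_hom.add module_hom.scale module_hom.zero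
      module_hom.diff module_hom.sum linear_iff_module_hom)

lemma clinear_sum_list: "clinear f \<Longrightarrow> f (sum_list xs) = sum_list (map f xs)"
  by (induction xs) (simp_all add: clinear_zero clinear_add)

lemma clinear_compose:
  assumes "clinear g" "clinear f"
  shows "clinear (\<lambda>x. g (f x))"
  by (rule clinearI) (simp_all add: assms[THEN clinear_add] assms[THEN clinear_scale])

lemma cbilinearI:
  "(\<And>x. clinear (\<lambda>y. f x y)) \<Longrightarrow> (\<And>y. clinear (\<lambda>x. f x y)) \<Longrightarrow> cbilinear f"
  by (simp add: cbilinear_def)

lemma cbilinearD:
  assumes "cbilinear f"
  shows "clinear (f x)" "clinear (\<lambda>x. f x y)"
  using assms by (simp_all add: cbilinear_def)

lemma clinear_ident: "clinear (\<lambda>x. x)"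
  and clinear_const_zero: "clinear (\<lambda>x. 0)"
  by (rule clinearI; simp)+

lemma clinear_plus:
  assumes "clinear f" "clinear g"
  shows "clinear (\<lambda>x. f x + g x)"
  by (rule clinearI)
    (simp_all add: assms[THEN clinear_add] assms[THEN clinear_scale] scaleC_add_right)

lemma clinear_minus:
  assumes "clinear f" "clinear g"
  shows "clinear (\<lambda>x. f x - g x)"
  by (rule clinearI) (simp_all add: assms[THEN clinear_add] assms[THEN clinear_scale]
      complex_vector.scale_right_diff_distrib)

lemma clinear_scaled:
  assumes "clinear f"
  shows "clinear (\<lambda>x. c *\<^sub>C f x)"
  by (rule clinearI) (simp_all add: assms[THEN clinear_add] assms[THEN clinear_scale]
      scaleC_add_right scaleC_scaleC mult.commute)

lemma clinear_sum_fun: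
  assumes "\<And>a. a \<in> A \<Longrightarrow> clinear (f a)"
  shows "clinear (\<lambda>x. \<Sum>a\<in>A. f a x)"
  by (rule clinearI) (simp_all add: assms[THEN clinear_add] assms[THEN clinear_scale] sum.distrib
      complex_vector.scale_sum_right cong: sum.cong)

lemma clinear_scaled_left:
  assumes "clinear f"
  shows "clinear (\<lambda>x. f x *\<^sub>C v)"
  by (rule clinearI) (simp_all add: assms[THEN clinear_add] assms[THEN clinear_scale]
      scaleC_add_left scaleC_scaleC scaleC_complex_def)

lemma
  assumes "clinear f"
  shows clinear_mult_left: "clinear (\<lambda>x. f x * (c :: 'a :: star_algebra))"
    and clinear_mult_right: "clinear (\<lambda>x. c * f x)"
  by (rule clinearI; simp add: assms[THEN clinear_add] assms[THEN clinear_scale] distrib_left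
      distrib_right mult_scaleC_left mult_scaleC_right)+

lemma
  assumes "clinear f"
  shows clinear_gmult_left: "clinear (\<lambda>x. f x * (c :: 'a :: graded_diff_star_algebra))"
    and clinear_gmult_right: "clinear (\<lambda>x. c * f x)"
    and clinear_hcomp: "clinear (\<lambda>x. hcomp k (f x))"
    and clinear_differential: "clinear (\<lambda>x. diff (f x))"
  by (rule clinearI; simp add: assms[THEN clinear_add] assms[THEN clinear_scale] distrib_left
      distrib_right gmult_scaleC_left gmult_scaleC_right hcomp_add hcomp_scaleC diff_add diff_scaleC)+

lemma tens_add_left: "(a + a') \<otimes> b = a \<otimes> b + a' \<otimes> b"
  and tens_add_right: "a \<otimes> (b + b') = a \<otimes> b + a \<otimes> b'"
  and tens_scale_left: "(c *\<^sub>C a) \<otimes> b = c *\<^sub>C (a \<otimes> b)"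
  and tens_scale_right: "a \<otimes> (c *\<^sub>C b) = c *\<^sub>C (a \<otimes> b)"
proof -
  have A1: "Poly_Mapping.single (a + a', b) 1 - (Poly_Mapping.single (a, b) 1 + Poly_Mapping.single (a', b) 1)
      \<in> tensor_null"
    unfolding tensor_null_def diff_diff_eq[symmetric]
    by (rule complex_vector.span_base, rule UnI1, rule UnI1, rule UnI1) blast
  have A2: "Poly_Mapping.single (a, b + b') 1 - (Poly_Mapping.single (a, b) 1 + Poly_Mapping.single (a, b') 1)
      \<in> tensor_null"
    unfolding tensor_null_def diff_diff_eq[symmetric]
    by (rule complex_vector.span_base, rule UnI1, rule UnI1, rule UnI2) blast
  have A3: "Poly_Mapping.single (c *\<^sub>C a, b) 1 - c *\<^sub>C Poly_Mapping.single (a, b) 1 \<in> tensor_null"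
    unfolding tensor_null_def
    by (rule complex_vector.span_base, rule UnI1, rule UnI2) blast
  have A4: "Poly_Mapping.single (a, c *\<^sub>C b) 1 - c *\<^sub>C Poly_Mapping.single (a, b) 1 \<in> tensor_null"
    unfolding tensor_null_def
    by (rule complex_vector.span_base, rule UnI2) blast
  show "(a + a') \<otimes> b = a \<otimes> b + a' \<otimes> b" "a \<otimes> (b + b') = a \<otimes> b + a \<otimes> b'"
    "(c *\<^sub>C a) \<otimes> b = c *\<^sub>C (a \<otimes> b)" "a \<otimes> (c *\<^sub>C b) = c *\<^sub>C (a \<otimes> b)"
    using A1 A2 A3 A4 by (simp_all add: tens.abs_eq plus_tensor.abs_eq scaleC_tensor.abs_eq
        tensor.abs_eq_iff tensor_rel_def)
qed

lemma
  assumes "clinear f"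
  shows clinear_tens_left: "clinear (\<lambda>x. f x \<otimes> b)"
    and clinear_tens_right: "clinear (\<lambda>x. b \<otimes> f x)"
  by (rule clinearI; simp add: assms[THEN clinear_add] assms[THEN clinear_scale] tens_add_left
      tens_add_right tens_scale_left tens_scale_right)+

lemma tens_zero_left [simp]: "0 \<otimes> b = 0"
  and tens_zero_right [simp]: "a \<otimes> 0 = 0"
  using clinear_zero[OF clinear_tens_left[OF clinear_ident]]
    clinear_zero[OF clinear_tens_right[OF clinear_ident]] by blast+

lemma tens_sum_left: "sum f A \<otimes> b = (\<Sum>i\<in>A. f i \<otimes> b)"
  and tens_sum_right: "a \<otimes> sum g A = (\<Sum>i\<in>A. a \<otimes> g i)"
  using clinear_sum[OF clinear_tens_left[OF clinear_ident]]
    clinear_sum[OF clinear_tens_right[OF clinear_ident]] by blast+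

lemma clinear_tlift: "cbilinear f \<Longrightarrow> clinear t \<Longrightarrow> clinear (\<lambda>x. tlift f (t x))"
  by (rule clinear_compose[OF tlift_linear])

text \<open>For a fixed \<open>t\<close>, \<open>tlift\<close> is a finite sum over the
  representative \<open>rep_tensor t\<close>, and linearity in \<open>x\<close> holds summand by
  summand. Nested Sweedler sums become linear in the parameters of their inner functions this
  way.\<close>

lemma clinear_tlift_fun:
  assumes "\<And>a b. clinear (\<lambda>x. F x a b)"
  shows "clinear (\<lambda>x. tlift (\<lambda>a b. F x a b) t)"
  unfolding tlift_def free_lift_def
  by (rule clinear_sum_fun) (auto intro!: clinear_scaled assms)

lemma clinear_tmap:
  "clinear f \<Longrightarrow> clinear g \<Longrightarrow> clinear t \<Longrightarrow> clinear (\<lambda>x. tmap f g (t x))"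
  unfolding tmap_def by (intro clinear_tlift cbilinearI clinear_tens_left clinear_tens_right)

lemma clinear_id: "clinear id"
  using clinear_ident by (simp add: id_def)

text \<open>Backward chaining on the outermost constructor proves linearity and bilinearity of
  Sweedler expressions; later sections append composition with each structure map to this
  list.\<close>

lemmas linear_intros = cbilinearI clinear_tlift clinear_tlift_fun clinear_tmap clinear_tens_left
  clinear_tens_right clinear_id clinear_hcomp clinear_differential clinear_gmult_left
  clinear_gmult_right clinear_mult_left clinear_mult_right clinear_scaled clinear_scaled_left
  clinear_sum_fun clinear_plus clinear_minus clinear_ident


section \<open>Tensor products\<close>

text \<open>A scalar is absorbed into the first factor,
  \<open>c (a \<otimes> b) = (c a) \<otimes> b\<close>, and zero is \<open>0 \<otimes> 0\<close>, so
  pure tensors and sums are the only cases.\<close>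

lemma tensor_induct [consumes 0, case_names tens add]:
  assumes tens: "\<And>a b. P (a \<otimes> b)" and add: "\<And>s t. P s \<Longrightarrow> P t \<Longrightarrow> P (s + t)"
  shows "P t"
proof -
  obtain p where t: "t = abs_tensor p"
    by (metis Quotient3_abs_rep Quotient3_tensor)
  have P: "P (abs_tensor (Poly_Mapping.single x c))" for x :: "'a \<times> 'b" and c
  proof -
    have "Poly_Mapping.single x c = c *\<^sub>C Poly_Mapping.single x 1"
      by (rule poly_mapping_eqI) (simp add: lookup_scaleC lookup_single scaleC_complex_def when_def)
    then have "abs_tensor (Poly_Mapping.single x c) = (c *\<^sub>C fst x) \<otimes> snd x"
      using tens_scale_left[of c "fst x" "snd x"] by (simp add: tens.abs_eq scaleC_tensor.abs_eq)
    then show ?thesis using tens by simp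
  qed
  show ?thesis unfolding t
  proof (induction p rule: update_induct)
    case const
    show ?case using tens[of 0 0] by (simp add: zero_tensor.abs_eq)
  next
    case (update p x c)
    have "Poly_Mapping.update x c p = p + Poly_Mapping.single x c"
      using update(1) by (intro poly_mapping_eqI)
        (auto simp: lookup_update lookup_add lookup_single when_def in_keys_iff)
    then show ?case
      using add[OF update(3) P] by (simp add: plus_tensor.abs_eq)
  qed
qed

lemma clinear_tensor_eqI:
  assumes "clinear f" "clinear g" "\<And>a b. f (a \<otimes> b) = g (a \<otimes> b)"
  shows "f t = g t"
  by (induction t rule: tensor_induct) (simp_all add: assms(3) assms(1,2)[THEN clinear_add])

lemma clinear_tlift_apply:
  assumes "clinear L" "cbilinear f"
  shows "L (tlift f t) = tlift (\<lambda>a b. L (f a b)) t"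
proof -
  have b: "cbilinear (\<lambda>a b. L (f a b))"
    by (rule cbilinearI; rule clinear_compose[OF assms(1)]; rule cbilinearD[OF assms(2)])
  show ?thesis
  proof (rule clinear_tensor_eqI[where f = "\<lambda>t. L (tlift f t)"])
    show "clinear (\<lambda>t. L (tlift f t))"
      by (rule clinear_compose[OF assms(1) tlift_linear[OF assms(2)]])
    show "clinear (tlift (\<lambda>a b. L (f a b)))"
      by (rule tlift_linear[OF b])
  qed (simp only: tlift_tens[OF b] tlift_tens[OF assms(2)])
qed

lemma tmap_tens: "clinear f \<Longrightarrow> clinear g \<Longrightarrow> tmap f g (a \<otimes> b) = f a \<otimes> g b"
  unfolding tmap_def by (intro tlift_tens linear_intros)

lemma tlift_tmap:
  assumes "cbilinear h" "clinear f" "clinear g"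
  shows "tlift h (tmap f g t) = tlift (\<lambda>a b. h (f a) (g b)) t"
proof -
  have "cbilinear (\<lambda>a b. f a \<otimes> g b)"
    by (intro linear_intros assms(2,3))
  then show ?thesis
    unfolding tmap_def by (simp add: clinear_tlift_apply tlift_linear tlift_tens assms)
qed

lemma tmap_tmap:
  assumes "clinear f" "clinear g" "clinear f'" "clinear g'"
  shows "tmap f' g' (tmap f g t) = tmap (\<lambda>x. f' (f x)) (\<lambda>x. g' (g x)) t"
  unfolding tmap_def[of f'] tmap_def[of "\<lambda>x. f' (f x)"]
  by (rule tlift_tmap) (intro linear_intros clinear_compose[OF assms(3)] clinear_compose[OF assms(4)] assms)+

lemma tlift_add_fun: "tlift (\<lambda>a b. f a b + g a b) t = tlift f t + tlift g t"
  and tlift_diff_fun: "tlift (\<lambda>a b. f a b - g a b) t = tlift f t - tlift g t"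
  by (simp_all add: tlift_def free_lift_def scaleC_add_right sum.distrib case_prod_beta
      complex_vector.scale_right_diff_distrib sum_subtractf)

lemma tlift_tens_id: "tlift (\<lambda>a b. a \<otimes> b) t = t"
  by (rule clinear_tensor_eqI[where f = "tlift (\<lambda>a b. a \<otimes> b)" and g = "\<lambda>t. t"])
    (auto intro!: linear_intros tlift_linear tlift_tens)

lemma tmap_id: "tmap id id t = t" "tmap (\<lambda>x. x) (\<lambda>x. x) t = t"
  by (simp_all add: tmap_def tlift_tens_id)

text \<open>Over a field an injective linear map has a linear left inverse, and the tensor product
  of two left inverses is a left inverse of \<open>tmap f g\<close>.\<close>

lemma inj_tmap:
  assumes f: "clinear f" "inj f" and g: "clinear g" "inj g"
  shows "inj (tmap f g)"
proof -
  interpret F: vector_space_pair "scaleC :: complex \<Rightarrow> 'a \<Rightarrow> 'a" "scaleC :: complex \<Rightarrow> 'b \<Rightarrow> 'b"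
    by (simp add: vector_space_pair_def complex_vector.vector_space_axioms)
  interpret G: vector_space_pair "scaleC :: complex \<Rightarrow> 'c \<Rightarrow> 'c" "scaleC :: complex \<Rightarrow> 'd \<Rightarrow> 'd"
    by (simp add: vector_space_pair_def complex_vector.vector_space_axioms)
  obtain f' g' where f': "clinear f'" "\<And>x. f' (f x) = x" and g': "clinear g'" "\<And>x. g' (g x) = x"
    using F.linear_injective_left_inverse[OF f] G.linear_injective_left_inverse[OF g]
    by (metis comp_apply id_apply)
  have "tmap f' g' (tmap f g t) = t" for t
    by (simp add: tmap_tmap f g f' g' tmap_id)
  then show ?thesis
    by (metis injI)
qed

lemma tassoc_tens: "tassoc (t \<otimes> c) = tmap (\<lambda>a. a) (\<lambda>b. b \<otimes> c) t"
  unfolding tassoc_def tmap_def by (rule tlift_tens) (intro linear_intros)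

section \<open>The star operation and the graded product of a tensor product\<close>

lemma star_zero: "star (0 :: 'a :: star_vector) = 0"
  by (metis add.right_neutral add_left_cancel star_add)

lemma star_sum: "star (sum f A) = (\<Sum>a\<in>A. star (f a :: 'a :: star_vector))"
  by (induction A rule: infinite_finite_induct) (simp_all add: star_zero star_add)

lemma star_sum_list: "star (sum_list xs) = sum_list (map star (xs :: 'a :: star_vector list))"
  by (induction xs) (simp_all add: star_zero star_add)

text \<open>The representative-level form of \<open>tstar\<close>. It is antilinear, so
  \<open>tlift\<close> and its quotient argument do not apply, and invariance under
  \<open>tensor_null\<close> is proved for it directly.\<close>

definition free_star :: "('a::star_vector \<times> 'b::star_vector \<Rightarrow>\<^sub>0 complex) \<Rightarrow> ('a, 'b) tensor"
  where "free_star p = (\<Sum>x\<in>Poly_Mapping.keys p. cnj (Poly_Mapping.lookup p x) *\<^sub>C (star (fst x) \<otimes> star (snd x)))"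

lemma free_star_superset:
  assumes "finite A" "Poly_Mapping.keys p \<subseteq> A"
  shows "free_star p = (\<Sum>x\<in>A. cnj (Poly_Mapping.lookup p x) *\<^sub>C (star (fst x) \<otimes> star (snd x)))"
  unfolding free_star_def using assms by (intro sum.mono_neutral_left) (auto simp: in_keys_iff)

lemma free_star_add: "free_star (p + q) = free_star p + free_star q"
proof -
  let ?A = "Poly_Mapping.keys p \<union> Poly_Mapping.keys q"
  have "Poly_Mapping.keys (p + q) \<subseteq> ?A" by (rule keys_add)
  then show ?thesis
    by (simp add: free_star_superset[of ?A] lookup_add scaleC_add_left sum.distrib)
qed

lemma free_star_scale: "free_star (c *\<^sub>C p) = cnj c *\<^sub>C free_star p"
proof -
  have "Poly_Mapping.keys (c *\<^sub>C p) \<subseteq> Poly_Mapping.keys p"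
    by (auto simp: in_keys_iff lookup_scaleC)
  then show ?thesis
    by (simp add: free_star_superset[of "Poly_Mapping.keys p"] lookup_scaleC scaleC_complex_def
        complex_vector.scale_sum_right scaleC_scaleC)
qed

lemma free_star_single: "free_star (Poly_Mapping.single (a, b) c) = cnj c *\<^sub>C (star a \<otimes> star b)"
  by (simp add: free_star_def)

lemma free_star_diff: "free_star (p - q) = free_star p - free_star q"
  by (metis add_diff_cancel diff_add_cancel free_star_add)

lemma free_star_null: "p \<in> tensor_null \<Longrightarrow> free_star p = 0"
proof -
  let ?Z = "{p :: 'a \<times> 'b \<Rightarrow>\<^sub>0 complex. free_star p = 0}"
  have "csubspace ?Z"
    by (rule complex_vector.subspaceI)
      (simp_all add: free_star_add free_star_scale, simp add: free_star_def)
  then have "tensor_null \<subseteq> ?Z"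
    unfolding tensor_null_def
    by (intro complex_vector.span_minimal)
      (auto simp: free_star_diff free_star_scale free_star_single scaleC_one star_add star_scaleC
        tens_add_left tens_add_right tens_scale_left tens_scale_right)
  then show "p \<in> tensor_null \<Longrightarrow> free_star p = 0" by blast
qed

lemma tstar_abs: "tstar (abs_tensor p) = free_star p"
proof -
  have "tensor_rel (rep_tensor (abs_tensor p)) p"
    using Quotient3_tensor by (rule rep_abs_rsp_left) (simp add: tensor_rel_def tensor_null_0)
  then have "free_star (rep_tensor (abs_tensor p)) = free_star p"
    using free_star_null[of "rep_tensor (abs_tensor p) - p"]
    by (simp add: tensor_rel_def free_star_diff)
  then show ?thesis
    by (simp add: tstar_def free_star_def case_prod_beta)
qed

lemma tstar_tens: "tstar (a \<otimes> b) = star a \<otimes> star b"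
  by (simp add: tens.abs_eq tstar_abs free_star_single scaleC_one)

lemma tstar_add: "tstar (s + t) = tstar s + tstar t"
proof -
  obtain p q where "s = abs_tensor p" "t = abs_tensor q"
    by (metis Quotient3_abs_rep Quotient3_tensor)
  then show ?thesis
    by (simp add: tstar_abs free_star_add plus_tensor.abs_eq)
qed

lemma tstar_sum: "tstar (sum f A) = (\<Sum>a\<in>A. tstar (f a))"
proof (induction A rule: infinite_finite_induct)
  case (insert a A)
  then show ?case by (simp add: tstar_add)
qed (use tstar_tens[of 0 0] in \<open>simp_all add: star_zero\<close>)

text \<open>Conjugation by star turns a linear map into a linear map, and \<open>tstar\<close> acts
  on each leg. This carries covariance of the derivative over to its dual.\<close>

lemma tstar_tmap_tstar:
  assumes "clinear f" "clinear g" "clinear f'" "clinear g'"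
    and "\<And>x. star (f (star x)) = f' x" "\<And>x. star (g (star x)) = g' x"
  shows "tstar (tmap f g (tstar t)) = tmap f' g' t"
  by (induction t rule: tensor_induct)
    (simp_all add: assms tstar_add tstar_tens tmap_tens clinear_add[OF clinear_tmap[OF _ _ clinear_ident]])

section \<open>Homogeneous components, graded product and differential of tensors\<close>

lemma hcomp_zero: "hcomp k 0 = 0"
  by (metis add_cancel_right_right hcomp_add)

lemma finite_degrees: "finite (degrees x)"
  by (simp add: degrees_def finite_hcomp)

lemma hcomp_eq_0: "k \<notin> degrees x \<Longrightarrow> hcomp k x = 0"
  by (simp add: degrees_def)

lemma sum_hcomp_superset:
  assumes "finite A" "degrees x \<subseteq> A"
  shows "(\<Sum>k\<in>A. hcomp k x) = x"
proof -
  have "(\<Sum>k\<in>A. hcomp k x) = (\<Sum>k | hcomp k x \<noteq> 0. hcomp k x)"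
    using assms by (intro sum.mono_neutral_right) (auto simp: degrees_def)
  then show ?thesis by (simp only: sum_hcomp)
qed

text \<open>The range of summation varies with \<open>x\<close>. Both sides are compared over one
  finite set containing all the degrees involved, since a linear \<open>g k\<close> contributes zero
  outside them.\<close>

lemma clinear_degree_sum:
  assumes "\<And>k. clinear (g k)"
  shows "clinear (\<lambda>x. \<Sum>k\<in>degrees x. g k (hcomp k x))"
proof -
  have *: "(\<Sum>k\<in>degrees x. g k (hcomp k x)) = (\<Sum>k\<in>A. g k (hcomp k x))"
    if "finite A" "degrees x \<subseteq> A" for A x
    using that by (intro sum.mono_neutral_left) (auto simp: hcomp_eq_0 clinear_zero[OF assms])
  show ?thesis
  proof (rule clinearI)
    fix x y :: 'a and c
    define A where "A = degrees x \<union> degrees y \<union> degrees (x + y) \<union> degrees (c *\<^sub>C x)"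
    have A: "finite A" "degrees x \<subseteq> A" "degrees y \<subseteq> A" "degrees (x + y) \<subseteq> A" "degrees (c *\<^sub>C x) \<subseteq> A"
      by (auto simp: A_def finite_degrees)
    show "(\<Sum>k\<in>degrees (x + y). g k (hcomp k (x + y))) =
        (\<Sum>k\<in>degrees x. g k (hcomp k x)) + (\<Sum>k\<in>degrees y. g k (hcomp k y))"
      unfolding A(2-)[THEN *[OF A(1)]]
      by (simp add: hcomp_add clinear_add[OF assms] sum.distrib)
    show "(\<Sum>k\<in>degrees (c *\<^sub>C x). g k (hcomp k (c *\<^sub>C x))) = c *\<^sub>C (\<Sum>k\<in>degrees x. g k (hcomp k x))"
      unfolding A(2-)[THEN *[OF A(1)]]
      by (simp add: hcomp_scaleC clinear_scale[OF assms] complex_vector.scale_sum_right)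
  qed
qed

lemma gtmult_bilinear: "cbilinear (\<lambda>a b. tlift (\<lambda>c d. \<Sum>k\<in>degrees b. \<Sum>l\<in>degrees c.
    (- 1) ^ (k * l) *\<^sub>C ((a * hcomp l c) \<otimes> (hcomp k b * d))) t)"
proof (rule cbilinearI)
  fix a
  show "clinear (\<lambda>b. tlift (\<lambda>c d. \<Sum>k\<in>degrees b. \<Sum>l\<in>degrees c.
    (- 1) ^ (k * l) *\<^sub>C ((a * hcomp l c) \<otimes> (hcomp k b * d))) t)"
    by (rule clinear_tlift_fun, rule clinear_degree_sum, intro linear_intros)
qed (intro linear_intros)

lemma clinear_gtmult_left: "clinear f \<Longrightarrow> clinear (\<lambda>x. gtmult (f x) t)"
  unfolding gtmult_def by (intro clinear_tlift gtmult_bilinear)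

text \<open>The sign exponent is the degree of \<open>b\<close> times that of a component of
  \<open>c\<close>, hence zero, and the components of \<open>c\<close> then add up to
  \<open>c\<close>. All products of coactions below have such a left factor, with second leg
  \<open>1\<close> or in the range of \<open>iH\<close>.\<close>

lemma gtmult_homogeneous_0:
  assumes "b \<in> homogeneous 0"
  shows "gtmult (a \<otimes> b) t = tmap (\<lambda>c. a * c) (\<lambda>d. b * d) t"
proof -
  have deg: "hcomp k b = (if k = 0 then b else 0)" for k
    using assms hcomp_hcomp[of k 0 b] by (auto simp: homogeneous_def)
  then have sub: "degrees b \<subseteq> {0}" by (auto simp: degrees_def split: if_splits)
  have "(\<Sum>k\<in>degrees b. \<Sum>l\<in>degrees c. (- 1) ^ (k * l) *\<^sub>C ((a * hcomp l c) \<otimes> (hcomp k b * d))) =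
      (a * c) \<otimes> (b * d)" (is "?l = _") for c d
  proof -
    have "?l = (\<Sum>k\<in>{0}. \<Sum>l\<in>degrees c. (- 1) ^ (k * l) *\<^sub>C ((a * hcomp l c) \<otimes> (hcomp k b * d)))"
      using sub by (intro sum.mono_neutral_left) (auto simp: hcomp_eq_0)
    also have "\<dots> = (a * (\<Sum>l\<in>degrees c. hcomp l c)) \<otimes> (b * d)"
      by (simp add: deg scaleC_one tens_sum_left[symmetric] sum_distrib_left)
    finally show ?thesis
      by (simp add: sum_hcomp_superset finite_degrees)
  qed
  then show ?thesis
    unfolding gtmult_def tlift_tens[OF gtmult_bilinear] tmap_def by simp
qed

lemma gtmult_tmap:
  assumes "clinear f" "clinear g" "\<And>h. g h \<in> homogeneous 0"
  shows "gtmult (tmap f g s) t = tlift (\<lambda>a h. tmap (\<lambda>c. f a * c) (\<lambda>d. g h * d) t) s"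
  unfolding tmap_def[of f g]
  by (subst clinear_tlift_apply[where L = "\<lambda>s. gtmult s t"])
    (auto intro!: linear_intros clinear_gtmult_left assms simp: gtmult_homogeneous_0 assms(3))

lemma diff_one: "diff (1 :: 'a :: graded_diff_star_algebra) = 0"
  using diff_mult[of 0 1 "1 :: 'a"] by (simp add: hcomp_one scaleC_one)

lemma gtdiff_bilinear:
  "cbilinear (\<lambda>a b. diff a \<otimes> b + (\<Sum>k\<in>degrees a. (- 1) ^ k *\<^sub>C (hcomp k a \<otimes> diff b)))"
  by (rule cbilinearI) (intro linear_intros clinear_degree_sum)+

text \<open>The second term of the graded Leibniz rule carries the sign of the first leg, which is
  trivial in degree zero.\<close>

lemma gtdiff_tmap:
  assumes f: "clinear f" and g: "clinear g" and 0: "\<And>x. f x \<in> homogeneous 0"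
  shows "gtdiff (tmap f g t) = tmap (\<lambda>x. diff (f x)) g t + tmap f (\<lambda>x. diff (g x)) t"
proof -
  have *: "(\<Sum>k\<in>degrees (f x). (- 1) ^ k *\<^sub>C (hcomp k (f x) \<otimes> y)) = f x \<otimes> y" for x y
  proof -
    have deg: "hcomp k (f x) = (if k = 0 then f x else 0)" for k
      using 0[of x] hcomp_hcomp[of k 0 "f x"] by (auto simp: homogeneous_def)
    have "degrees (f x) \<subseteq> {0}" by (auto simp: degrees_def deg split: if_splits)
    then have "(\<Sum>k\<in>degrees (f x). (- 1) ^ k *\<^sub>C (hcomp k (f x) \<otimes> y)) =
        (\<Sum>k\<in>{0}. (- 1) ^ k *\<^sub>C (hcomp k (f x) \<otimes> y))"
      by (intro sum.mono_neutral_left) (auto simp: hcomp_eq_0)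
    then show ?thesis by (simp add: deg scaleC_one)
  qed
  show ?thesis
    unfolding gtdiff_def by (subst tlift_tmap[OF gtdiff_bilinear f g]) (simp add: * tlift_add_fun tmap_def)
qed

lemma gtdiff_tens_1: "gtdiff (a \<otimes> 1) = diff a \<otimes> 1"
  unfolding gtdiff_def by (subst tlift_tens[OF gtdiff_bilinear]) (simp add: diff_one)

lemma gthcomp_tens_1: "gthcomp n (a \<otimes> 1) = hcomp n a \<otimes> 1"
proof -
  have 1: "hcomp k (1 :: 'b) = (if k = 0 then 1 else 0)" for k
    using hcomp_hcomp[of k 0 "1 :: 'b"] by (simp add: hcomp_one)
  have "gthcomp n (a \<otimes> 1) = (\<Sum>i\<le>n. hcomp i a \<otimes> hcomp (n - i) (1 :: 'b))"
    unfolding gthcomp_def by (intro tlift_tens linear_intros)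
  also have "\<dots> = (\<Sum>i\<in>{n}. hcomp i a \<otimes> hcomp (n - i) (1 :: 'b))"
    by (rule sum.mono_neutral_right) (auto simp: 1)
  finally show ?thesis by (simp add: 1)
qed

section \<open>Sweedler calculus\<close>

lemma clinear_bilinear_left: "cbilinear h \<Longrightarrow> clinear f \<Longrightarrow> clinear (\<lambda>x. h (f x) c)"
  by (rule clinear_compose[where g = "\<lambda>x. h x c"], erule cbilinearD, assumption)

lemma clinear_bilinear_right: "cbilinear h \<Longrightarrow> clinear f \<Longrightarrow> clinear (\<lambda>x. h c (f x))"
  by (rule clinear_compose[where g = "h c"], erule cbilinearD, assumption)

text \<open>Every trilinear \<open>f\<close> factors through the triple tensor product. Evaluating
  the linear map \<open>F\<close> on both sides of \<open>co\<close> gives coassociativity in the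
  form used inside Sweedler sums: the two legs obtained from \<open>a\<close> may be traded for the
  two legs obtained from \<open>b\<close>.\<close>

lemma coaction_coassociative:
  assumes \<delta>: "clinear \<delta>" and \<Delta>: "clinear \<Delta>"
    and f: "\<And>a. cbilinear (f a)" "\<And>b c. clinear (\<lambda>a. f a b c)"
    and co: "tassoc (tmap \<delta> id (\<delta> v)) = tmap id \<Delta> (\<delta> v)"
  shows "tlift (\<lambda>a b. tlift (\<lambda>a1 a2. f a1 a2 b) (\<delta> a)) (\<delta> v) =
    tlift (\<lambda>a b. tlift (\<lambda>b1 b2. f a b1 b2) (\<Delta> b)) (\<delta> v)"
proof -
  define F where "F = tlift (\<lambda>a t. tlift (\<lambda>b c. f a b c) t)"
  have k: "cbilinear (\<lambda>a t. tlift (\<lambda>b c. f a b c) t)"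
    by (intro linear_intros f)
  have lin_F: "clinear F" unfolding F_def by (rule tlift_linear[OF k])
  note lin = linear_intros f clinear_compose[OF \<delta>] clinear_compose[OF \<Delta>] clinear_compose[OF lin_F]
    clinear_bilinear_left[OF f(1)] clinear_bilinear_right[OF f(1)]
  have lin_tassoc: "clinear tassoc"
    unfolding tassoc_def by (intro lin tlift_linear)
  have "F (tassoc (tmap \<delta> id (\<delta> v))) = tlift (\<lambda>a b. F (tassoc (\<delta> a \<otimes> b))) (\<delta> v)"
    unfolding tmap_def
    by (subst clinear_tlift_apply[where L = "\<lambda>t. F (tassoc t)"])
      (intro lin clinear_compose[OF lin_tassoc] | simp)+
  also have "\<dots> = tlift (\<lambda>a b. tlift (\<lambda>a1 a2. f a1 a2 b) (\<delta> a)) (\<delta> v)"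
  proof -
    have "F (tassoc (\<delta> a \<otimes> b)) = tlift (\<lambda>a1 a2. f a1 a2 b) (\<delta> a)" for a b
      unfolding tassoc_tens F_def
      by (subst tlift_tmap[OF k]; (intro lin)?) (simp add: tlift_tens f)
    then show ?thesis by simp
  qed
  finally have "F (tmap id \<Delta> (\<delta> v)) = tlift (\<lambda>a b. tlift (\<lambda>a1 a2. f a1 a2 b) (\<delta> a)) (\<delta> v)"
    by (simp only: co)
  moreover have "F (tmap id \<Delta> (\<delta> v)) = tlift (\<lambda>a b. tlift (\<lambda>b1 b2. f a b1 b2) (\<Delta> b)) (\<delta> v)"
    unfolding F_def by (subst tlift_tmap[OF k clinear_id \<Delta>]) simp
  ultimately show ?thesis by simp
qed

context hopf_star_algebra
begin

lemmas comult_coassociative = coaction_coassociative[OF comult_linear comult_linear _ _ coassociative]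

lemmas hopf_linear = clinear_compose[OF comult_linear] clinear_compose[OF antipode_linear]
  clinear_compose[OF counit_linear]

lemma counit_left_apply:
  assumes "clinear f"
  shows "tlift (\<lambda>a b. \<epsilon> a *\<^sub>C f b) (\<Delta> x) = f x"
proof -
  have "f (tlift (\<lambda>a b. \<epsilon> a *\<^sub>C b) (\<Delta> x)) = tlift (\<lambda>a b. f (\<epsilon> a *\<^sub>C b)) (\<Delta> x)"
    by (rule clinear_tlift_apply[OF assms]) (intro linear_intros hopf_linear)
  then show ?thesis by (simp add: counit_left clinear_scale[OF assms])
qed

text \<open>In Sweedler terms \<open>x\<^sub>1 S(x\<^sub>2) \<otimes> x\<^sub>3\<close> collapses to
  \<open>1 \<otimes> x\<close>: the antipode axiom leaves \<open>\<epsilon>(x\<^sub>1)\<close> in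
  front of the last leg, and the counit removes it.\<close>

lemma antipode_right_apply:
  assumes f: "\<And>b. clinear (\<lambda>a. f a b)" "clinear (f 1)"
  shows "tlift (\<lambda>a b. tlift (\<lambda>a1 a2. f (a1 * S a2) b) (\<Delta> a)) (\<Delta> x) = f 1 x"
proof -
  have "tlift (\<lambda>a1 a2. f (a1 * S a2) b) (\<Delta> a) = \<epsilon> a *\<^sub>C f 1 b" for a b
  proof -
    have "f (tlift (\<lambda>a1 a2. a1 * S a2) (\<Delta> a)) b = tlift (\<lambda>a1 a2. f (a1 * S a2) b) (\<Delta> a)"
      by (rule clinear_tlift_apply[OF f(1)]) (intro linear_intros hopf_linear)
    then show ?thesis by (simp add: antipode_right clinear_scale[OF f(1)])
  qed
  then show ?thesis by (simp add: counit_left_apply[OF f(2)])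
qed

lemma antipode_left_apply:
  assumes f: "\<And>b. clinear (\<lambda>a. f a b)" "clinear (f 1)"
  shows "tlift (\<lambda>a b. tlift (\<lambda>a1 a2. f (S a1 * a2) b) (\<Delta> a)) (\<Delta> x) = f 1 x"
proof -
  have "tlift (\<lambda>a1 a2. f (S a1 * a2) b) (\<Delta> a) = \<epsilon> a *\<^sub>C f 1 b" for a b
  proof -
    have "f (tlift (\<lambda>a1 a2. S a1 * a2) (\<Delta> a)) b = tlift (\<lambda>a1 a2. f (S a1 * a2) b) (\<Delta> a)"
      by (rule clinear_tlift_apply[OF f(1)]) (intro linear_intros hopf_linear)
    then show ?thesis by (simp add: antipode_left clinear_scale[OF f(1)])
  qed
  then show ?thesis by (simp add: counit_left_apply[OF f(2)])
qed

end

section \<open>Germs of the first-order calculus\<close>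

text \<open>The componentwise action of the algebra \<open>H \<otimes> H\<close> on
  \<open>H \<otimes> \<Gamma>\<close>. Left covariance amounts to \<open>\<Delta>L\<close> being a
  module map along \<open>\<Delta>\<close> for this action.\<close>

definition tensor_act :: "('h::star_algebra \<Rightarrow> 'c::complex_vector \<Rightarrow> 'c) \<Rightarrow> ('h, 'h) tensor \<Rightarrow>
    ('h, 'c) tensor \<Rightarrow> ('h, 'c) tensor"
  where "tensor_act act s t = tlift (\<lambda>x y. tlift (\<lambda>a \<gamma>. (x * a) \<otimes> act y \<gamma>) t) s"

lemma tensor_act_bilinear:
  assumes "cbilinear act"
  shows "cbilinear (tensor_act act)"
  unfolding tensor_act_def[abs_def]
  by (intro linear_intros clinear_bilinear_left[OF assms] clinear_bilinear_right[OF assms])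

lemma tensor_act_tens:
  assumes "cbilinear act"
  shows "tensor_act act (x \<otimes> y) (a \<otimes> \<gamma>) = (x * a) \<otimes> act y \<gamma>"
proof -
  note lin = linear_intros clinear_bilinear_left[OF assms] clinear_bilinear_right[OF assms]
  show ?thesis
    unfolding tensor_act_def
    by (subst tlift_tens, intro lin, subst tlift_tens, intro lin, rule refl)
qed

lemma tmult_tens: "tmult (a \<otimes> b) (c \<otimes> d) = (a * c) \<otimes> (b * d)"
  unfolding tmult_def by (subst tlift_tens, intro linear_intros, subst tlift_tens, intro linear_intros, rule refl)

lemma tmult_bilinear: "cbilinear tmult"
  unfolding tmult_def[abs_def] by (intro linear_intros)

lemma tensor_act_tmult:
  assumes b: "cbilinear act" and m: "\<And>x y \<gamma>. act (x * y) \<gamma> = act x (act y \<gamma>)"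
  shows "tensor_act act (tmult s s') t = tensor_act act s (tensor_act act s' t)"
proof -
  note bil = tensor_act_bilinear[OF b]
  note add = clinear_add[OF cbilinearD(1)[OF bil]] clinear_add[OF cbilinearD(2)[OF bil]]
    clinear_add[OF cbilinearD(1)[OF tmult_bilinear]] clinear_add[OF cbilinearD(2)[OF tmult_bilinear]]
  show ?thesis
  proof (induction s rule: tensor_induct)
    case (tens x y)
    show ?case
    proof (induction s' rule: tensor_induct)
      case (tens x' y')
      show ?case
        by (induction t rule: tensor_induct)
          (simp_all add: add tmult_tens tensor_act_tens[OF b] m mult.assoc)
    qed (simp add: add)
  qed (simp add: add)
qed

context bicovariant_star_calculus
begin

abbreviation germ :: "'h \<Rightarrow> 'c"
  where "germ \<equiv> germ_map \<Delta> S lact d"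

lemma act_linear:
  "clinear f \<Longrightarrow> clinear (\<lambda>x. lact (f x) \<gamma>)" "clinear g \<Longrightarrow> clinear (\<lambda>x. lact h (g x))"
  by (rule clinear_bilinear_left[OF lact_bilinear] clinear_bilinear_right[OF lact_bilinear], assumption)+

lemma germ_linear: "clinear germ"
  unfolding germ_map_def[abs_def]
  by (intro linear_intros hopf_linear act_linear clinear_compose[OF d_linear])

lemma ad_linear: "clinear ad"
  using ad_corep by (simp add: corepresentation_def)

lemmas calculus_linear = linear_intros hopf_linear act_linear clinear_compose[OF d_linear]
  clinear_compose[OF germ_linear] clinear_compose[OF ad_linear] clinear_compose[OF left_covariant(1)]

text \<open>Expanding the germ gives \<open>g\<^sub>1 S(g\<^sub>2) d(g\<^sub>3)\<close>, in which
  the first two factors cancel.\<close>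

lemma germ_differential: "tlift (\<lambda>a b. lact a (germ b)) (\<Delta> g) = d g"
proof -
  have "lact a (germ b) = tlift (\<lambda>b1 b2. lact (a * S b1) (d b2)) (\<Delta> b)" for a b
    unfolding germ_map_def lact_mult
    by (rule clinear_tlift_apply) (intro calculus_linear)+
  then have "tlift (\<lambda>a b. lact a (germ b)) (\<Delta> g) =
      tlift (\<lambda>a b. tlift (\<lambda>b1 b2. lact (a * S b1) (d b2)) (\<Delta> b)) (\<Delta> g)"
    by simp
  also have "\<dots> = tlift (\<lambda>a b. tlift (\<lambda>a1 a2. lact (a1 * S a2) (d b)) (\<Delta> a)) (\<Delta> g)"
    by (rule comult_coassociative[symmetric]) (intro calculus_linear)+
  also have "\<dots> = lact 1 (d g)"
    by (rule antipode_right_apply) (intro calculus_linear)+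
  finally show ?thesis by (simp add: lact_one)
qed

text \<open>Covariance is given on products \<open>x dy\<close>. They span \<Gamma>, both sides are
  linear in \<gamma>, and on such products multiplicativity of \<Delta> matches the two
  actions.\<close>

lemma left_coaction_lact: "\<Delta>L (lact x \<gamma>) = tensor_act lact (\<Delta> x) (\<Delta>L \<gamma>)"
proof -
  note bil = tensor_act_bilinear[OF lact_bilinear]
  have base: "\<Delta>L (lact x (d y)) = tensor_act lact (\<Delta> x) (tmap id d (\<Delta> y))" for x y
    unfolding left_covariant(2) tensor_act_def
    by (subst tlift_tmap) (intro calculus_linear | simp)+
  have "\<Delta>L (lact x \<gamma>) - tensor_act lact (\<Delta> x) (\<Delta>L \<gamma>) = 0"
  proof (rule complex_vector.span_induct[where S = "{lact x (d y) | x y. True}"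
        and P = "\<lambda>\<gamma>. \<Delta>L (lact x \<gamma>) - tensor_act lact (\<Delta> x) (\<Delta>L \<gamma>) = 0"])
    have lin: "clinear (\<lambda>\<gamma>. \<Delta>L (lact x \<gamma>) - tensor_act lact (\<Delta> x) (\<Delta>L \<gamma>))"
      by (intro calculus_linear clinear_bilinear_right[OF bil])
    show "csubspace {\<gamma>. \<Delta>L (lact x \<gamma>) - tensor_act lact (\<Delta> x) (\<Delta>L \<gamma>) = 0}"
      by (rule complex_vector.subspaceI)
        (simp_all only: mem_Collect_eq clinear_zero[OF lin] clinear_add[OF lin] clinear_scale[OF lin], simp_all)
    show "\<gamma> \<in> cspan {lact x (d y) | x y. True}"
      by (simp only: d_generates UNIV_I)
  qed (auto simp: base lact_mult[symmetric] comult_mult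
      tensor_act_tmult[OF lact_bilinear lact_mult])
  then show ?thesis by simp
qed

lemma left_coaction_differential: "\<Delta>L (d y) = tmap id d (\<Delta> y)"
proof -
  have "\<Delta>L (lact 1 (d y)) = tlift (\<lambda>y1 y2. y1 \<otimes> d y2) (\<Delta> y)"
    unfolding left_covariant(2) comult_one
    by (subst tlift_tens) (intro calculus_linear | simp add: lact_one)+
  then show ?thesis by (simp add: lact_one tmap_def)
qed

text \<open>The difference \<open>F g = \<Delta>L (\<pi> g) - 1 \<otimes> \<pi> g\<close> satisfies \<open>\<Delta>(g\<^sub>1) F(g\<^sub>2) = 0\<close>, since both terms give
  \<open>\<Delta>L (d g)\<close>; multiplying by \<open>\<Delta>(S g\<^sub>0)\<close> recovers \<open>F g = 0\<close> without anticomultiplicativity of \<open>S\<close>.\<close>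

lemma germ_left_invariant: "germ g \<in> left_invariant \<Delta>L"
proof -
  note bil = tensor_act_bilinear[OF lact_bilinear]
  define F where "F g = \<Delta>L (germ g) - 1 \<otimes> germ g" for g
  have lin_F: "clinear F"
    unfolding F_def[abs_def] by (intro calculus_linear)
  note lin = calculus_linear clinear_compose[OF lin_F] clinear_bilinear_left[OF bil]
    clinear_bilinear_right[OF bil]
  have act_1: "tensor_act lact s (1 \<otimes> \<gamma>) = tlift (\<lambda>a1 a2. a1 \<otimes> lact a2 \<gamma>) s" for s \<gamma>
    unfolding tensor_act_def by (subst tlift_tens) (intro lin | simp)+
  have zero: "tlift (\<lambda>a b. tensor_act lact (\<Delta> a) (F b)) (\<Delta> g) = 0" for g
  proof -
    have "tlift (\<lambda>a b. tensor_act lact (\<Delta> a) (\<Delta>L (germ b))) (\<Delta> g) =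
        tlift (\<lambda>a b. \<Delta>L (lact a (germ b))) (\<Delta> g)"
      by (simp add: left_coaction_lact)
    also have "\<dots> = \<Delta>L (tlift (\<lambda>a b. lact a (germ b)) (\<Delta> g))"
      by (rule clinear_tlift_apply[symmetric]) (intro lin left_covariant(1))+
    finally have 1: "tlift (\<lambda>a b. tensor_act lact (\<Delta> a) (\<Delta>L (germ b))) (\<Delta> g) = tmap id d (\<Delta> g)"
      by (simp only: germ_differential left_coaction_differential)
    have "tlift (\<lambda>a b. tensor_act lact (\<Delta> a) (1 \<otimes> germ b)) (\<Delta> g) =
        tlift (\<lambda>a b. tlift (\<lambda>a1 a2. a1 \<otimes> lact a2 (germ b)) (\<Delta> a)) (\<Delta> g)"
      by (simp add: act_1)
    also have "\<dots> = tlift (\<lambda>a b. tlift (\<lambda>b1 b2. a \<otimes> lact b1 (germ b2)) (\<Delta> b)) (\<Delta> g)"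
      by (rule comult_coassociative) (intro lin)+
    also have "\<dots> = tlift (\<lambda>a b. a \<otimes> d b) (\<Delta> g)"
    proof -
      have "a \<otimes> tlift (\<lambda>b1 b2. lact b1 (germ b2)) (\<Delta> b) =
          tlift (\<lambda>b1 b2. a \<otimes> lact b1 (germ b2)) (\<Delta> b)" for a :: 'h and b
        by (rule clinear_tlift_apply) (intro lin)+
      then show ?thesis by (simp only: germ_differential)
    qed
    finally have 2: "tlift (\<lambda>a b. tensor_act lact (\<Delta> a) (1 \<otimes> germ b)) (\<Delta> g) = tmap id d (\<Delta> g)"
      by (simp add: tmap_def)
    show ?thesis
      unfolding F_def clinear_diff[OF cbilinearD(1)[OF bil]] tlift_diff_fun 1 2 by simp
  qed
  have "0 = tlift (\<lambda>a b. tensor_act lact (\<Delta> (S a)) (tlift (\<lambda>b1 b2. tensor_act lact (\<Delta> b1) (F b2)) (\<Delta> b))) (\<Delta> g)"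
    by (simp add: zero clinear_zero[OF cbilinearD(1)[OF bil]]) (simp add: tlift_def free_lift_def case_prod_beta)
  also have "\<dots> = tlift (\<lambda>a b. tlift (\<lambda>b1 b2. tensor_act lact (\<Delta> (S a * b1)) (F b2)) (\<Delta> b)) (\<Delta> g)"
  proof -
    have "tensor_act lact (\<Delta> (S a)) (tlift (\<lambda>b1 b2. tensor_act lact (\<Delta> b1) (F b2)) (\<Delta> b)) =
        tlift (\<lambda>b1 b2. tensor_act lact (\<Delta> (S a)) (tensor_act lact (\<Delta> b1) (F b2))) (\<Delta> b)" for a b
      by (rule clinear_tlift_apply) (intro lin)+
    then show ?thesis by (simp add: comult_mult tensor_act_tmult[OF lact_bilinear lact_mult])
  qed
  also have "\<dots> = tlift (\<lambda>a b. tlift (\<lambda>a1 a2. tensor_act lact (\<Delta> (S a1 * a2)) (F b)) (\<Delta> a)) (\<Delta> g)"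
    by (rule comult_coassociative[symmetric]) (intro lin)+
  also have "\<dots> = tensor_act lact (\<Delta> 1) (F g)"
    by (rule antipode_left_apply) (intro lin)+
  also have "\<dots> = F g"
  proof -
    have "tensor_act lact (1 \<otimes> 1) t = t" for t
      by (induction t rule: tensor_induct)
        (simp_all add: tensor_act_tens[OF lact_bilinear] lact_one clinear_add[OF cbilinearD(1)[OF bil]])
    then show ?thesis by (simp only: comult_one)
  qed
  finally show ?thesis by (simp add: F_def left_invariant_def)
qed

text \<open>Inserting the formula for \<open>ad\<close> turns the left side into
  \<open>\<pi>(h\<^sub>3) \<otimes> h\<^sub>1 S(h\<^sub>2) h\<^sub>4\<close>, in which
  \<open>h\<^sub>1 S(h\<^sub>2)\<close> cancels.\<close>

lemma ad_germ_comult: "tlift (\<lambda>h1 h2. tmap id (\<lambda>y. h1 * y) (ad (germ h2))) (\<Delta> h) = tmap germ id (\<Delta> h)"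
proof -
  have "tmap id (\<lambda>y. h1 * y) (ad (germ h2)) =
      tlift (\<lambda>g1 r. tlift (\<lambda>g2 g3. germ g2 \<otimes> ((h1 * S g1) * g3)) (\<Delta> r)) (\<Delta> h2)" for h1 h2
  proof -
    have "ad (germ h2) = tlift (\<lambda>g1 r. tlift (\<lambda>g2 g3. germ g2 \<otimes> (S g1 * g3)) (\<Delta> r)) (\<Delta> h2)"
      unfolding ad_germ by (subst tlift_tmap) (intro calculus_linear comult_linear | simp)+
    then have "tmap id (\<lambda>y. h1 * y) (ad (germ h2)) =
        tlift (\<lambda>g1 r. tmap id (\<lambda>y. h1 * y) (tlift (\<lambda>g2 g3. germ g2 \<otimes> (S g1 * g3)) (\<Delta> r))) (\<Delta> h2)"
      by simp (rule clinear_tlift_apply; intro calculus_linear)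
    moreover have "tmap id (\<lambda>y. h1 * y) (tlift (\<lambda>g2 g3. germ g2 \<otimes> (S g1 * g3)) t) =
        tlift (\<lambda>g2 g3. germ g2 \<otimes> ((h1 * S g1) * g3)) t" for g1 t
    proof -
      have "tmap id (\<lambda>y. h1 * y) (germ g2 \<otimes> (S g1 * g3)) = germ g2 \<otimes> ((h1 * S g1) * g3)" for g2 g3
        by (subst tmap_tens) (intro calculus_linear | simp add: mult.assoc)+
      then show ?thesis
        by (subst clinear_tlift_apply[where L = "tmap id (\<lambda>y. h1 * y)"])
          (intro calculus_linear | simp)+
    qed
    ultimately show ?thesis by simp
  qed
  then have "tlift (\<lambda>h1 h2. tmap id (\<lambda>y. h1 * y) (ad (germ h2))) (\<Delta> h) =
      tlift (\<lambda>a b. tlift (\<lambda>b1 b2. tlift (\<lambda>g2 g3. germ g2 \<otimes> ((a * S b1) * g3)) (\<Delta> b2)) (\<Delta> b)) (\<Delta> h)"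
    by simp
  also have "\<dots> = tlift (\<lambda>a b. tlift (\<lambda>a1 a2. tlift (\<lambda>g2 g3. germ g2 \<otimes> ((a1 * S a2) * g3)) (\<Delta> b)) (\<Delta> a)) (\<Delta> h)"
    by (rule comult_coassociative[symmetric]) (intro calculus_linear)+
  also have "\<dots> = tlift (\<lambda>g2 g3. germ g2 \<otimes> (1 * g3)) (\<Delta> h)"
    by (rule antipode_right_apply) (intro calculus_linear)+
  finally show ?thesis by (simp add: tmap_def)
qed

end

section \<open>Injectivity of the map from \<open>H\<close> to its envelope\<close>

context universal_envelope
begin

lemma iH_inj: "inj iH"
proof -
  \<comment> \<open>the projection onto words of length 0 kills all relators\<close>
  define P where "P = free_lift (\<lambda>(h :: 'h, gs :: 'c list). if gs = [] then h else 0)"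
  have lin: "clinear P" unfolding P_def by (rule free_lift_linear)
  have sum_single: "P (\<Sum>(g, h)\<leftarrow>ps. Poly_Mapping.single (y, gs @ d g # ract (d h) x # gs') 1) = 0"
    for ps y gs x gs'
    by (induction ps) (auto simp: clinear_zero[OF lin] clinear_add[OF lin], auto simp: P_def)
  have "h = 0" if "iH h = 0" for h
  proof -
    have "word_eval iH i\<Gamma> (Poly_Mapping.single (h, []) 1) = 0"
      using that by (simp add: word_eval_def scaleC_one)
    then have "Poly_Mapping.single (h, []) 1 \<in>
        cspan (bimodule_tensor_relators lact ract \<union> envelope_relators lact ract d)"
      using word_eval_kernel by blast
    moreover have "cspan (bimodule_tensor_relators lact ract \<union> envelope_relators lact ract d) \<subseteq> {p. P p = 0}"
    proof (rule complex_vector.span_minimal)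
      show "csubspace {p. P p = 0}"
        by (rule complex_vector.subspaceI)
          (simp_all add: clinear_zero[OF lin] clinear_add[OF lin] clinear_scale[OF lin])
      have "bimodule_tensor_relators lact ract \<subseteq> {p. P p = 0}"
        by (auto simp: bimodule_tensor_relators_def clinear_diff[OF lin] clinear_scale[OF lin])
          (auto simp: P_def scaleC_one)
      moreover have "envelope_relators lact ract d \<subseteq> {p. P p = 0}"
        using sum_single by (auto simp: envelope_relators_def)
      ultimately show "bimodule_tensor_relators lact ract \<union> envelope_relators lact ract d \<subseteq> {p. P p = 0}"
        by blast
    qed
    ultimately have "P (Poly_Mapping.single (h, []) 1) = 0" by blast
    then show "h = 0" by (simp add: P_def scaleC_one)
  qed
  then show ?thesis
    by (metis clinear_diff[OF iH_linear] injI right_minus_eq)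
qed

end

section \<open>Forms of degree zero\<close>

lemma hcomp_homogeneous: "x \<in> homogeneous j \<Longrightarrow> hcomp k x = (if k = j then x else 0)"
  using hcomp_hcomp[of k j x] by (simp add: homogeneous_def)

lemma homogeneous_one: "1 \<in> homogeneous 0"
  by (simp add: homogeneous_def hcomp_one)

lemma homogeneous_add: "x \<in> homogeneous k \<Longrightarrow> y \<in> homogeneous k \<Longrightarrow> x + y \<in> homogeneous k"
  by (simp add: homogeneous_def hcomp_add)

lemma homogeneous_mult: "x \<in> homogeneous k \<Longrightarrow> y \<in> homogeneous l \<Longrightarrow> x * y \<in> homogeneous (k + l)"
  using hcomp_mult[of k l x y] by (simp add: homogeneous_def)

lemma hcomp_diff_eq: "hcomp k (x - y) = hcomp k x - hcomp k y"
  by (rule clinear_diff[OF clinear_hcomp[OF clinear_ident]])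

lemma homogeneous_diff: "x \<in> homogeneous k \<Longrightarrow> y \<in> homogeneous k \<Longrightarrow> x - y \<in> homogeneous k"
  by (simp add: homogeneous_def hcomp_diff_eq)

lemma homogeneous_differential: "x \<in> homogeneous k \<Longrightarrow> diff x \<in> homogeneous (Suc k)"
  by (simp add: homogeneous_def hcomp_diff)

lemma decompose_hcomp: "(\<Sum>k\<in>degrees x. hcomp k x) = x"
  by (rule sum_hcomp_superset) (simp_all add: finite_degrees)

lemma hcomp_mult_0:
  assumes "y \<in> homogeneous 0"
  shows "hcomp k (x * y) = hcomp k x * y"
proof -
  have "hcomp k (x * y) = (\<Sum>j\<in>degrees x. hcomp k (hcomp j x * y))"
    by (subst decompose_hcomp[of x, symmetric])
      (simp only: sum_distrib_right clinear_sum[OF clinear_hcomp[OF clinear_ident]])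
  also have "\<dots> = (\<Sum>j\<in>degrees x. if j = k then hcomp k x * y else 0)"
  proof (rule sum.cong[OF refl])
    fix j
    have "hcomp j x * y \<in> homogeneous (j + 0)"
      using assms by (intro homogeneous_mult) (simp_all add: homogeneous_def hcomp_hcomp)
    then show "hcomp k (hcomp j x * y) = (if j = k then hcomp k x * y else 0)"
      by (simp add: hcomp_homogeneous)
  qed
  also have "\<dots> = hcomp k x * y"
    by (simp add: finite_degrees hcomp_eq_0)
  finally show ?thesis .
qed

lemma star_mult_homogeneous:
  assumes "x \<in> homogeneous k" "y \<in> homogeneous l"
  shows "star (x * y) = (- 1) ^ (k * l) *\<^sub>C (star y * star x)"
  using star_gmult[of k x l y] assms by (simp add: homogeneous_def)

text \<open>Every component of \<open>y\<close> meets \<open>x\<close> with sign exponent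
  \<open>0 * j\<close>.\<close>

lemma star_mult_0_left:
  assumes "x \<in> homogeneous 0"
  shows "star (x * y) = star y * star x"
proof -
  have "star (x * y) = (\<Sum>j\<in>degrees y. star (x * hcomp j y))"
    by (subst decompose_hcomp[of y, symmetric]) (simp only: sum_distrib_left star_sum)
  also have "\<dots> = (\<Sum>j\<in>degrees y. star (hcomp j y) * star x)"
    using star_mult_homogeneous[OF assms, of "hcomp j y" j for j]
    by (simp add: homogeneous_def hcomp_hcomp scaleC_one)
  also have "\<dots> = star y * star x"
    by (simp only: sum_distrib_right[symmetric] star_sum[symmetric] decompose_hcomp)
  finally show ?thesis .
qed

lemma star_mult_0_right:
  assumes "y \<in> homogeneous 0"
  shows "star (x * y) = star y * star x"
proof -
  have "star y \<in> homogeneous 0"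
    using assms by (simp add: homogeneous_def hcomp_star)
  then have "star (star y * star x) = x * y"
    by (simp add: star_mult_0_left star_star)
  then show ?thesis by (metis star_star)
qed

section \<open>Base forms and covariant maps\<close>

context qpb_calculus
begin

lemma iP_degree: "iP p \<in> homogeneous 0"
  using iP_range by blast

lemma coact_forms_linear: "clinear \<Delta>\<Omega>"
  and coact_forms_one: "\<Delta>\<Omega> 1 = 1 \<otimes> 1"
  and coact_forms_mult: "\<Delta>\<Omega> (x * y) = gtmult (\<Delta>\<Omega> x) (\<Delta>\<Omega> y)"
  and coact_forms_star: "\<Delta>\<Omega> (star x) = tstar (\<Delta>\<Omega> x)"
  and coact_forms_diff: "\<Delta>\<Omega> (diff x) = gtdiff (\<Delta>\<Omega> x)"
  and coact_forms_hcomp: "\<Delta>\<Omega> (hcomp n x) = gthcomp n (\<Delta>\<Omega> x)"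
  using coact_forms by (simp_all add: gdsa_tensor_morphism_def)

lemma coact_linear: "clinear \<Delta>P"
  using coact_corep by (simp add: corepresentation_def)

lemma coact_coassociative: "tassoc (tmap \<Delta>P id (\<Delta>P p)) = tmap id \<Delta> (\<Delta>P p)"
  using coact_corep by (simp add: corepresentation_def)

lemmas bundle_coassociative =
  coaction_coassociative[OF coact_linear comult_linear _ _ coact_coassociative]

lemmas bundle_linear = calculus_linear clinear_compose[OF coact_forms_linear]
  clinear_compose[OF coact_linear] clinear_compose[OF iP_linear] clinear_compose[OF iH_linear]
  clinear_compose[OF i\<Gamma>_linear]

abbreviation "\<Omega>B \<equiv> base_forms \<Delta>\<Omega>"

lemma base_forms_mult: "\<mu> \<in> \<Omega>B \<Longrightarrow> \<nu> \<in> \<Omega>B \<Longrightarrow> \<mu> * \<nu> \<in> \<Omega>B"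
  unfolding base_forms_def
  by (simp add: coact_forms_mult gtmult_homogeneous_0[OF homogeneous_one] tmap_tens bundle_linear)

lemma base_forms_star: "\<mu> \<in> \<Omega>B \<Longrightarrow> star \<mu> \<in> \<Omega>B"
proof -
  \<comment> \<open>The star axiom of the envelope is signed and refers to homogeneous components;
    the unsigned one of \<open>H\<close>, transported by \<open>iH\<close>, yields
    \<open>star 1 = 1\<close>.\<close>
  have "star (1 :: 'g) = 1" by (metis iH_one iH_star mult_1_right mult_1_left star_mult star_star)
  then show "\<mu> \<in> \<Omega>B \<Longrightarrow> star \<mu> \<in> \<Omega>B"
    by (simp add: base_forms_def coact_forms_star tstar_tens)
qed

lemma base_forms_diff: "\<mu> \<in> \<Omega>B \<Longrightarrow> diff \<mu> \<in> \<Omega>B"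
  and base_forms_hcomp: "\<mu> \<in> \<Omega>B \<Longrightarrow> hcomp k \<mu> \<in> \<Omega>B"
  by (simp_all add: base_forms_def coact_forms_diff coact_forms_hcomp gtdiff_tens_1 gthcomp_tens_1)

lemma base_forms_one: "1 \<in> \<Omega>B"
  by (simp add: base_forms_def coact_forms_one)

lemma csubspace_base_forms: "csubspace \<Omega>B"
  by (rule complex_vector.subspaceI)
    (simp_all add: base_forms_def clinear_zero[OF coact_forms_linear] clinear_add[OF coact_forms_linear]
      clinear_scale[OF coact_forms_linear] tens_add_left tens_scale_left)

text \<open>Injectivity of \<open>iP \<otimes> iH\<close> pulls invariance of \<open>iP b\<close>
  back to the coaction on \<open>P\<close>, whose invariants are \<open>B\<close>. In the expansion
  of a morphism this turns coefficients that are base forms into elements of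
  \<open>B\<close>.\<close>

lemma base_forms_iP: "iP b \<in> \<Omega>B \<longleftrightarrow> b \<in> B"
proof -
  have "iP b \<in> \<Omega>B \<longleftrightarrow> tmap iP iH (\<Delta>P b) = tmap iP iH (b \<otimes> 1)"
    by (simp add: base_forms_def coact_extends tmap_tens iP_linear iH_linear iH_one)
  also have "\<dots> \<longleftrightarrow> \<Delta>P b = b \<otimes> 1"
    using inj_tmap[OF iP_linear iP_inj iH_linear iH_inj] by (auto dest: injD)
  finally show ?thesis by (simp add: base_iff)
qed

text \<open>The morphisms from \<open>\<delta>\<close> to the horizontal forms. Horizontality of the
  values is implied, as the second leg lies in the range of \<open>iH\<close>; stating the condition
  in \<open>\<Omega>(P) \<otimes> \<Gamma>\<^sup>\<and>\<close> avoids the definite description in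
  \<open>coact_hor\<close>.\<close>

definition covariant :: "'v::complex_vector set \<Rightarrow> ('v \<Rightarrow> ('v, 'h) tensor) \<Rightarrow> ('v \<Rightarrow> 'w) \<Rightarrow> bool"
  where "covariant V \<delta> \<tau> \<longleftrightarrow> clinear \<tau> \<and> (\<forall>v\<in>V. \<Delta>\<Omega> (\<tau> v) = tmap \<tau> iH (\<delta> v))"

lemma covariant_Mor: "T \<in> Mor V \<delta> UNIV \<Delta>P \<Longrightarrow> covariant V \<delta> (\<lambda>v. iP (T v))"
proof -
  assume T: "T \<in> Mor V \<delta> UNIV \<Delta>P"
  then have lin: "clinear T" by (simp add: Mor_def)
  have "\<Delta>\<Omega> (iP (T v)) = tmap iP iH (tmap T id (\<delta> v))" if "v \<in> V" for v
    using T that by (simp add: Mor_def coact_extends)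
  then show ?thesis
    by (simp add: covariant_def tmap_tmap lin iP_linear iH_linear bundle_linear clinear_id)
qed

end


section \<open>The covariant derivative\<close>

locale qpb_connection = qpb_calculus \<Delta> \<epsilon> S B \<Delta>P lact ract d \<Delta>L \<Delta>R ad iH i\<Gamma> \<Delta>W iP \<Delta>\<Omega>
  for \<Delta> :: "'h::star_algebra \<Rightarrow> ('h, 'h) tensor" and \<epsilon> S
    and B :: "'p::star_algebra set" and \<Delta>P
    and lact :: "'h \<Rightarrow> 'c::star_vector \<Rightarrow> 'c" and ract d \<Delta>L \<Delta>R ad
    and iH :: "'h \<Rightarrow> 'g::graded_diff_star_algebra" and i\<Gamma> \<Delta>W
    and iP :: "'p \<Rightarrow> 'w::graded_diff_star_algebra" and \<Delta>\<Omega> +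
  fixes \<omega> :: "'c \<Rightarrow> 'w"
  assumes connection: "quantum_principal_connection \<Delta>L ad iH i\<Gamma> \<Delta>\<Omega> \<omega>"
begin

lemma connection_linear: "clinear \<omega>"
  and connection_degree: "\<omega> (germ h) \<in> homogeneous 1"
  and connection_coact: "\<Delta>\<Omega> (\<omega> (germ h)) = tmap \<omega> iH (ad (germ h)) + 1 \<otimes> i\<Gamma> (germ h)"
  using connection germ_left_invariant by (simp_all add: quantum_principal_connection_def)

lemmas connection_intros = bundle_linear clinear_compose[OF connection_linear]

text \<open>The covariant derivative on \<open>P\<close>, where the horizontal coaction is
  \<open>\<Delta>P\<close> itself; \<open>cov_iP\<close> identifies the two.\<close>

definition deriv_0 :: "'p \<Rightarrow> 'w"
  where "deriv_0 p = diff (iP p) - tlift (\<lambda>x h. iP x * \<omega> (germ h)) (\<Delta>P p)"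

lemma deriv_0_linear: "clinear deriv_0"
  unfolding deriv_0_def[abs_def] by (intro connection_intros)

lemma deriv_0_degree: "deriv_0 p \<in> homogeneous 1"
proof -
  have "tlift (\<lambda>x h. iP x * \<omega> (germ h)) t \<in> homogeneous 1" for t
  proof (induction t rule: tensor_induct)
    case (tens x h)
    have "tlift (\<lambda>x h. iP x * \<omega> (germ h)) (x \<otimes> h) = iP x * \<omega> (germ h)"
      by (rule tlift_tens) (intro connection_intros)
    then show ?case using homogeneous_mult[OF iP_degree connection_degree] by simp
  next
    case (add s t)
    have "clinear (tlift (\<lambda>x h. iP x * \<omega> (germ h)))"
      by (rule tlift_linear) (intro connection_intros)
    then show ?case using add by (simp add: clinear_add homogeneous_add)
  qed
  then show ?thesis
    unfolding deriv_0_def using homogeneous_differential[OF iP_degree]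
    by (intro homogeneous_diff) simp_all
qed

text \<open>The differential and the correction term produce the same vertical part
  \<open>p\<^sub>0 \<otimes> d p\<^sub>1\<close>, which cancels. In the correction term it stems
  from the summand \<open>1 \<otimes> \<theta>\<close> in the coaction of the connection, by
  \<open>germ_differential\<close>; the summand with \<open>ad\<close> becomes covariant by
  \<open>ad_germ_comult\<close>.\<close>

lemma deriv_0_coact: "\<Delta>\<Omega> (deriv_0 p) = tmap deriv_0 iH (\<Delta>P p)"
proof -
  define A where "A x = tlift (\<lambda>x h. iP x * \<omega> (germ h)) (\<Delta>P x)" for x
  \<comment> \<open>\<open>K x\<^sub>0 x\<^sub>1 h\<close> is the coaction of
    \<open>x * \<omega> (germ h)\<close>. With the legs as free arguments, coassociativity can first
    move the splitting from \<open>x\<close> to \<open>h\<close>, where the two germ identities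
    apply.\<close>
  define K where "K x h1 h2 = tmap (\<lambda>c. iP x * c) (\<lambda>e. iH h1 * e)
      (tmap \<omega> iH (ad (germ h2)) + 1 \<otimes> i\<Gamma> (germ h2))" for x h1 h2
  have lin_K: "cbilinear (K x)" "clinear (\<lambda>x. K x h1 h2)" for x h1 h2
    unfolding K_def[abs_def] tmap_def[of "\<lambda>c. iP x * c" for x]
    by (intro connection_intros connection_linear iH_linear)+
  have K: "tlift (\<lambda>h1 h2. K x h1 h2) (\<Delta> h) =
      tlift (\<lambda>h1 h2. (iP x * \<omega> (germ h1)) \<otimes> iH h2) (\<Delta> h) + iP x \<otimes> diff (iH h)" for x h
  proof -
    have K12: "K x h1 h2 = tmap (\<lambda>c. iP x * \<omega> c) iH (tmap id (\<lambda>y. h1 * y) (ad (germ h2)))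
        + iP x \<otimes> i\<Gamma> (lact h1 (germ h2))" for h1 h2
    proof -
      have lin: "clinear (tmap (\<lambda>c. iP x * c) (\<lambda>e. iH h1 * e))"
        unfolding tmap_def by (intro tlift_linear connection_intros)
      have "tmap (\<lambda>c. iP x * c) (\<lambda>e. iH h1 * e) (tmap \<omega> iH t) =
          tmap (\<lambda>c. iP x * \<omega> c) iH (tmap id (\<lambda>y. h1 * y) t)" for t
        by (simp add: tmap_tmap connection_intros connection_linear iH_linear iH_mult clinear_id)
      then show ?thesis
        by (simp add: K_def clinear_add[OF lin] tmap_tens connection_intros i\<Gamma>_lact)
    qed
    have "tlift (\<lambda>h1 h2. tmap (\<lambda>c. iP x * \<omega> c) iH (tmap id (\<lambda>y. h1 * y) (ad (germ h2)))) (\<Delta> h) =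
        tmap (\<lambda>c. iP x * \<omega> c) iH (tlift (\<lambda>h1 h2. tmap id (\<lambda>y. h1 * y) (ad (germ h2))) (\<Delta> h))"
    proof (rule clinear_tlift_apply[symmetric])
      show "cbilinear (\<lambda>h1 h2. tmap id (\<lambda>y. h1 * y) (ad (germ h2)))"
        unfolding tmap_def by (intro connection_intros)
    qed (intro connection_intros iH_linear)
    also have "\<dots> = tlift (\<lambda>h1 h2. (iP x * \<omega> (germ h1)) \<otimes> iH h2) (\<Delta> h)"
      unfolding ad_germ_comult
      by (subst tmap_tmap) (intro connection_intros germ_linear iH_linear | simp add: tmap_def)+
    finally have 1: "tlift (\<lambda>h1 h2. tmap (\<lambda>c. iP x * \<omega> c) iH (tmap id (\<lambda>y. h1 * y) (ad (germ h2)))) (\<Delta> h) =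
        tlift (\<lambda>h1 h2. (iP x * \<omega> (germ h1)) \<otimes> iH h2) (\<Delta> h)" .
    have 2: "tlift (\<lambda>h1 h2. iP x \<otimes> i\<Gamma> (lact h1 (germ h2))) (\<Delta> h) = iP x \<otimes> diff (iH h)"
    proof -
      have "iP x \<otimes> i\<Gamma> (tlift (\<lambda>h1 h2. lact h1 (germ h2)) (\<Delta> h)) =
          tlift (\<lambda>h1 h2. iP x \<otimes> i\<Gamma> (lact h1 (germ h2))) (\<Delta> h)"
        by (rule clinear_tlift_apply) (intro connection_intros i\<Gamma>_linear)+
      then show ?thesis by (simp only: germ_differential i\<Gamma>_d)
    qed
    show ?thesis unfolding K12 tlift_add_fun 1 2 ..
  qed
  have "\<Delta>\<Omega> (A p) = tlift (\<lambda>x h. \<Delta>\<Omega> (iP x * \<omega> (germ h))) (\<Delta>P p)"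
    unfolding A_def by (rule clinear_tlift_apply) (intro connection_intros coact_forms_linear)+
  also have "\<dots> = tlift (\<lambda>x h. tlift (\<lambda>x0 x1. K x0 x1 h) (\<Delta>P x)) (\<Delta>P p)"
    by (simp add: coact_forms_mult coact_extends connection_coact K_def
        gtmult_tmap[OF iP_linear iH_linear iH_degree])
  also have "\<dots> = tlift (\<lambda>x h. tlift (\<lambda>h1 h2. K x h1 h2) (\<Delta> h)) (\<Delta>P p)"
    by (rule bundle_coassociative) (rule lin_K)+
  also have "\<dots> = tlift (\<lambda>x h. tlift (\<lambda>h1 h2. (iP x * \<omega> (germ h1)) \<otimes> iH h2) (\<Delta> h)) (\<Delta>P p) +
      tmap iP (\<lambda>h. diff (iH h)) (\<Delta>P p)"
    unfolding K tlift_add_fun by (simp add: tmap_def)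
  also have "tlift (\<lambda>x h. tlift (\<lambda>h1 h2. (iP x * \<omega> (germ h1)) \<otimes> iH h2) (\<Delta> h)) (\<Delta>P p) =
      tlift (\<lambda>x h. tlift (\<lambda>x0 x1. (iP x0 * \<omega> (germ x1)) \<otimes> iH h) (\<Delta>P x)) (\<Delta>P p)"
    by (rule bundle_coassociative[symmetric]) (intro connection_intros)+
  also have "\<dots> = tmap A iH (\<Delta>P p)"
  proof -
    have "A x \<otimes> iH h = tlift (\<lambda>x0 x1. (iP x0 * \<omega> (germ x1)) \<otimes> iH h) (\<Delta>P x)" for x h
      unfolding A_def by (rule clinear_tlift_apply[where L = "\<lambda>y. y \<otimes> iH h"]) (intro connection_intros)+
    then show ?thesis by (simp add: tmap_def)
  qed
  finally have A: "\<Delta>\<Omega> (A p) = tmap A iH (\<Delta>P p) + tmap iP (\<lambda>h. diff (iH h)) (\<Delta>P p)" .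
  have "\<Delta>\<Omega> (diff (iP p)) = tmap (\<lambda>x. diff (iP x)) iH (\<Delta>P p) + tmap iP (\<lambda>h. diff (iH h)) (\<Delta>P p)"
    unfolding coact_forms_diff coact_extends by (rule gtdiff_tmap[OF iP_linear iH_linear iP_degree])
  then have "\<Delta>\<Omega> (deriv_0 p) = tmap (\<lambda>x. diff (iP x)) iH (\<Delta>P p) - tmap A iH (\<Delta>P p)"
    by (simp add: deriv_0_def A_def[symmetric] clinear_diff[OF coact_forms_linear] A)
  also have "\<dots> = tmap deriv_0 iH (\<Delta>P p)"
    unfolding tmap_def tlift_diff_fun[symmetric] deriv_0_def A_def
    by (simp add: clinear_diff[OF clinear_tens_left[OF clinear_ident]])
  finally show ?thesis .
qed

section \<open>Additivity of the covariant derivative on horizontal forms\<close>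

abbreviation "cov \<equiv> cov_deriv iH \<Delta>\<Omega> germ \<omega>"
abbreviation "dual \<equiv> dual_cov_deriv iH \<Delta>\<Omega> germ \<omega>"

definition cov_term :: "nat \<Rightarrow> 'w \<Rightarrow> 'w"
  where "cov_term k \<phi> = diff (hcomp k \<phi>) -
    (- 1) ^ k *\<^sub>C tlift (\<lambda>\<phi>0 \<phi>1. \<phi>0 * \<omega> (germ \<phi>1)) (coact_hor iH \<Delta>\<Omega> (hcomp k \<phi>))"

text \<open>Horizontality is required of each component because \<open>cov_deriv\<close> applies
  \<open>coact_hor\<close> to each component. On this set the definite description always has a
  witness, which is what additivity needs.\<close>

definition hor :: "'w set"
  where "hor = {\<phi>. \<forall>k. \<exists>t. tmap id iH t = \<Delta>\<Omega> (hcomp k \<phi>)}"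

text \<open>Uniqueness comes from injectivity of \<open>id \<otimes> iH\<close>. From here on
  \<open>coact_hor\<close> is computed by exhibiting a preimage.\<close>

lemma coact_hor_eq:
  assumes "tmap id iH t = \<Delta>\<Omega> \<phi>"
  shows "coact_hor iH \<Delta>\<Omega> \<phi> = t"
  unfolding coact_hor_def
proof (rule the_equality[where P = "\<lambda>t. tmap id iH t = \<Delta>\<Omega> \<phi>", OF assms])
  fix s
  assume "tmap id iH s = \<Delta>\<Omega> \<phi>"
  with assms have "tmap id iH s = tmap id iH t" by simp
  then show "s = t" by (rule injD[OF inj_tmap[OF clinear_id inj_on_id iH_linear iH_inj]])
qed

lemma cov_kernel_linear: "clinear (tlift (\<lambda>\<phi>0 \<phi>1. \<phi>0 * \<omega> (germ \<phi>1)))"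
  by (rule tlift_linear) (intro connection_intros)

lemma tmap_iH_linear: "clinear (tmap id iH)"
  unfolding tmap_def by (intro tlift_linear connection_intros)

lemma cov_term_zero: "hcomp k \<phi> = 0 \<Longrightarrow> cov_term k \<phi> = 0"
  using coact_hor_eq[of 0 0]
  by (simp add: cov_term_def clinear_zero[OF tmap_iH_linear] clinear_zero[OF coact_forms_linear]
      clinear_zero[OF cov_kernel_linear] clinear_zero[OF clinear_differential[OF clinear_ident]])

lemma cov_superset: "finite A \<Longrightarrow> degrees \<phi> \<subseteq> A \<Longrightarrow> cov \<phi> = (\<Sum>k\<in>A. cov_term k \<phi>)"
  unfolding cov_deriv_def cov_term_def[symmetric]
  by (rule sum.mono_neutral_left) (auto simp: hcomp_eq_0 cov_term_zero)

lemma hor_add: "\<phi> \<in> hor \<Longrightarrow> \<psi> \<in> hor \<Longrightarrow> \<phi> + \<psi> \<in> hor"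
  by (simp add: hor_def hcomp_add clinear_add[OF coact_forms_linear])
    (metis clinear_add[OF tmap_iH_linear])

lemma cov_term_add:
  assumes "\<phi> \<in> hor" "\<psi> \<in> hor"
  shows "cov_term k (\<phi> + \<psi>) = cov_term k \<phi> + cov_term k \<psi>"
proof -
  obtain s t where "tmap id iH s = \<Delta>\<Omega> (hcomp k \<phi>)" "tmap id iH t = \<Delta>\<Omega> (hcomp k \<psi>)"
    using assms unfolding hor_def by blast
  moreover from this have "tmap id iH (s + t) = \<Delta>\<Omega> (hcomp k (\<phi> + \<psi>))"
    by (simp add: hcomp_add clinear_add[OF coact_forms_linear] clinear_add[OF tmap_iH_linear])
  ultimately show ?thesis
    by (simp add: cov_term_def coact_hor_eq clinear_add[OF cov_kernel_linear] hcomp_add diff_add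
        scaleC_add_right)
qed

lemma cov_add:
  assumes "\<phi> \<in> hor" "\<psi> \<in> hor"
  shows "cov (\<phi> + \<psi>) = cov \<phi> + cov \<psi>"
proof -
  define A where "A = degrees \<phi> \<union> degrees \<psi> \<union> degrees (\<phi> + \<psi>)"
  have "finite A" "degrees \<phi> \<subseteq> A" "degrees \<psi> \<subseteq> A" "degrees (\<phi> + \<psi>) \<subseteq> A"
    by (auto simp: A_def finite_degrees)
  then show ?thesis
    by (simp add: cov_superset[of A] cov_term_add[OF assms] sum.distrib)
qed

section \<open>The Leibniz rule with a base form as a factor\<close>

lemma coact_base_iP:
  assumes "\<mu> \<in> \<Omega>B"
  shows "tmap id iH (tmap (\<lambda>x. \<mu> * iP x) id (\<Delta>P q)) = \<Delta>\<Omega> (\<mu> * iP q)"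
proof -
  have "\<Delta>\<Omega> (\<mu> * iP q) = tmap (\<lambda>c. \<mu> * c) (\<lambda>e. 1 * e) (tmap iP iH (\<Delta>P q))"
    using assms by (simp add: base_forms_def coact_forms_mult coact_extends
        gtmult_homogeneous_0[OF homogeneous_one])
  also have "\<dots> = tmap (\<lambda>x. \<mu> * iP x) iH (\<Delta>P q)"
    by (subst tmap_tmap) (simp_all add: iP_linear iH_linear connection_intros)
  also have "\<dots> = tmap id iH (tmap (\<lambda>x. \<mu> * iP x) id (\<Delta>P q))"
    by (subst tmap_tmap) (simp_all add: iP_linear iH_linear connection_intros clinear_id)
  finally show ?thesis ..
qed

lemma hor_base_iP:
  assumes "\<mu> \<in> \<Omega>B"
  shows "\<mu> * iP q \<in> hor"
  unfolding hor_def
  using coact_base_iP[OF base_forms_hcomp[OF assms]] by (auto simp: hcomp_mult_0[OF iP_degree])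

text \<open>The coaction leaves \<open>\<mu>\<close> in the first leg, so
  \<open>hcomp k \<mu>\<close> factors out of the correction term; the rest is the graded Leibniz
  rule for \<open>diff\<close>. The index set \<open>A\<close> is a parameter because the sum is
  later taken over \<open>{0}\<close> and over the degrees of a starred form.\<close>

lemma cov_base_iP:
  assumes "\<mu> \<in> \<Omega>B" "finite A" "degrees \<mu> \<subseteq> A"
  shows "cov (\<mu> * iP q) = diff \<mu> * iP q + (\<Sum>k\<in>A. (- 1) ^ k *\<^sub>C (hcomp k \<mu> * deriv_0 q))"
proof -
  have "cov_term k (\<mu> * iP q) = diff (hcomp k \<mu>) * iP q + (- 1) ^ k *\<^sub>C (hcomp k \<mu> * deriv_0 q)" for k
  proof -
    have "tlift (\<lambda>\<phi>0 \<phi>1. \<phi>0 * \<omega> (germ \<phi>1)) (tmap (\<lambda>x. hcomp k \<mu> * iP x) id (\<Delta>P q)) =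
        tlift (\<lambda>x h. hcomp k \<mu> * (iP x * \<omega> (germ h))) (\<Delta>P q)"
      by (subst tlift_tmap) (simp_all add: connection_intros clinear_id mult.assoc iP_linear)
    also have "\<dots> = hcomp k \<mu> * tlift (\<lambda>x h. iP x * \<omega> (germ h)) (\<Delta>P q)"
      by (rule clinear_tlift_apply[symmetric]) (intro connection_intros)+
    finally show ?thesis
      by (simp add: cov_term_def hcomp_mult_0[OF iP_degree] coact_hor_eq[OF coact_base_iP]
          base_forms_hcomp assms(1) deriv_0_def diff_mult right_diff_distrib
          complex_vector.scale_right_diff_distrib)
  qed
  moreover have "degrees (\<mu> * iP q) \<subseteq> A"
    using assms(3) by (auto simp: degrees_def hcomp_mult_0[OF iP_degree])
  ultimately have "cov (\<mu> * iP q) = (\<Sum>k\<in>A. diff (hcomp k \<mu>)) * iP q +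
      (\<Sum>k\<in>A. (- 1) ^ k *\<^sub>C (hcomp k \<mu> * deriv_0 q))"
    using assms(2) by (simp add: cov_superset[of A] sum.distrib sum_distrib_right)
  also have "(\<Sum>k\<in>A. diff (hcomp k \<mu>)) = diff \<mu>"
    using clinear_sum[OF clinear_differential[OF clinear_ident], symmetric]
      sum_hcomp_superset[OF assms(2,3)] by metis
  finally show ?thesis .
qed

lemma cov_iP: "cov (iP q) = deriv_0 q"
proof -
  \<comment> \<open>Only an inclusion: in the zero algebra \<open>degrees 1\<close> is
    empty.\<close>
  have "degrees (1 :: 'w) \<subseteq> {0}"
    by (auto simp: degrees_def hcomp_homogeneous[OF homogeneous_one] split: if_splits)
  from cov_base_iP[OF base_forms_one _ this, of q] show ?thesis
    by (simp add: diff_one hcomp_one scaleC_one)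
qed

lemma dual_iP: "dual (iP p) = star (deriv_0 (star p))"
  by (simp add: dual_cov_deriv_def iP_star[symmetric] cov_iP)

text \<open>The degree one factor \<open>deriv_0\<close> gives the graded star the sign
  \<open>(- 1) ^ k\<close>, which cancels the sign in \<open>cov_base_iP\<close>. The components of
  \<open>\<mu>\<close> then reassemble, and \<open>\<mu>\<close> appears on the right without any
  sign.\<close>

lemma dual_Leibniz:
  assumes "\<mu> \<in> \<Omega>B"
  shows "dual (iP p * \<mu>) = dual (iP p) * \<mu> + iP p * diff \<mu>"
proof -
  let ?A = "degrees (star \<mu>)"
  have "star ((- 1) ^ k *\<^sub>C (hcomp k (star \<mu>) * deriv_0 (star p))) = dual (iP p) * hcomp k \<mu>" for k
  proof -
    have "star (hcomp k (star \<mu>) * deriv_0 (star p)) =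
        (- 1) ^ k *\<^sub>C (dual (iP p) * hcomp k \<mu>)"
      using star_mult_homogeneous[OF _ deriv_0_degree, of "hcomp k (star \<mu>)" k]
      by (simp add: homogeneous_def hcomp_hcomp dual_iP hcomp_star star_star)
    then show ?thesis
      by (simp add: star_scaleC scaleC_scaleC power_mult_distrib[symmetric] scaleC_one)
  qed
  moreover have "(\<Sum>k\<in>?A. hcomp k \<mu>) = \<mu>"
    using decompose_hcomp[of "star \<mu>"] by (metis (no_types, lifting) hcomp_star star_star star_sum sum.cong)
  ultimately have "star (\<Sum>k\<in>?A. (- 1) ^ k *\<^sub>C (hcomp k (star \<mu>) * deriv_0 (star p))) = dual (iP p) * \<mu>"
    by (simp add: star_sum sum_distrib_left[symmetric])
  moreover have "star (iP p * \<mu>) = star \<mu> * iP (star p)"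
    by (simp add: star_mult_0_left iP_degree iP_star)
  moreover have "star (diff (star \<mu>) * iP (star p)) = iP p * diff \<mu>"
    by (simp add: star_mult_0_right iP_degree iP_star[symmetric] star_star diff_star[symmetric])
  ultimately show ?thesis
    using cov_base_iP[OF base_forms_star[OF assms] finite_degrees order_refl, of "star p"]
    by (simp add: dual_cov_deriv_def star_add add.commute)
qed

lemma dual_sum_list:
  assumes "set ps \<subseteq> UNIV \<times> \<Omega>B"
  shows "dual (\<Sum>(p, \<mu>)\<leftarrow>ps. iP p * \<mu>) = (\<Sum>(p, \<mu>)\<leftarrow>ps. dual (iP p * \<mu>))"
proof -
  \<comment> \<open>Additivity of \<open>cov\<close> is available on \<open>hor\<close>, so the
    induction also records that the star of the partial sum is horizontal.\<close>
  have "star (\<Sum>(p, \<mu>)\<leftarrow>ps. iP p * \<mu>) \<in> hor \<and> ?thesis"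
    using assms
  proof (induction ps)
    case Nil
    have 0: "degrees (0 :: 'w) = {}" by (simp add: degrees_def hcomp_zero)
    have "0 \<in> hor"
      using hor_base_iP[OF complex_vector.subspace_0[OF csubspace_base_forms]] by simp
    then show ?case
      by (simp add: dual_cov_deriv_def star_zero cov_deriv_def 0)
  next
    case (Cons a ps)
    obtain p \<mu> where a: "a = (p, \<mu>)" by (cases a)
    have "star (iP p * \<mu>) \<in> hor"
      using Cons.prems hor_base_iP[OF base_forms_star, of \<mu> "star p"]
      by (simp add: a star_mult_0_left iP_degree iP_star)
    then show ?case
      using Cons by (simp add: a star_add hor_add dual_cov_deriv_def cov_add)
  qed
  then show ?thesis ..
qed

lemma dual_covariant:
  assumes "T \<in> Mor V \<delta> UNIV \<Delta>P"
  shows "covariant V \<delta> (\<lambda>v. dual (iP (T v)))"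
proof -
  let ?D = "\<lambda>p. star (deriv_0 (star p))"
  have lin_D: "clinear ?D"
    by (rule clinearI) (simp_all add: star_add star_scaleC clinear_add[OF deriv_0_linear]
        clinear_scale[OF deriv_0_linear])
  have T: "clinear T" "\<And>v. v \<in> V \<Longrightarrow> \<Delta>P (T v) = tmap T id (\<delta> v)"
    using assms by (simp_all add: Mor_def)
  have "\<Delta>\<Omega> (?D p) = tmap ?D iH (\<Delta>P p)" for p
    unfolding coact_forms_star deriv_0_coact coact_star
    by (rule tstar_tmap_tstar) (simp_all add: deriv_0_linear iH_linear lin_D iH_star star_star)
  then show ?thesis
    by (simp add: covariant_def dual_iP clinear_compose[OF lin_D T(1)] T tmap_tmap lin_D iH_linear
        clinear_id)
qed

end

section \<open>Finite-dimensional spaces\<close>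

lemma clinear_eq_on_span:
  assumes "clinear f" "clinear g" "\<And>x. x \<in> S \<Longrightarrow> f x = g x" "x \<in> cspan S"
  shows "f x = g x"
  using assms(4,3)
  by (induction x rule: complex_vector.span_induct_alt)
    (simp_all add: assms(1,2)[THEN clinear_zero] assms(1,2)[THEN clinear_add] assms(1,2)[THEN clinear_scale])

text \<open>The strict bound for a proper subspace, obtained by adjoining an outside vector to a
  basis, makes the size of a spanning set a measure for the induction over invariant
  subspaces.\<close>

lemma subspace_spanned_finite:
  assumes "finite F" "csubspace W" "W \<subseteq> cspan F"
  obtains G where "finite G" "cspan G = W" "card G \<le> card F"
    "\<And>x. x \<in> cspan F \<Longrightarrow> x \<notin> W \<Longrightarrow> card G < card F"
proof -
  obtain G where G: "G \<subseteq> W" "complex_vector.independent G" "W \<subseteq> cspan G"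
    by (rule complex_vector.maximal_independent_subset)
  have span: "cspan G = W"
    using G complex_vector.span_minimal[OF G(1) assms(2)] by blast
  have fin: "finite G \<and> card G \<le> card F"
    using complex_vector.independent_span_bound[OF assms(1) G(2)] G(1) assms(3) by blast
  have "card G < card F" if "x \<in> cspan F" "x \<notin> W" for x
  proof -
    have "complex_vector.independent (insert x G)"
      using G(2) that(2) by (simp add: complex_vector.independent_insert span)
    moreover have "insert x G \<subseteq> cspan F"
      using G(1) assms(3) that(1) by blast
    moreover have "x \<notin> G" using G(1) that(2) by blast
    ultimately show ?thesis
      using complex_vector.independent_span_bound[OF assms(1), of "insert x G"] fin by simp
  qed
  with span fin show thesis by (intro that) auto
qed

text \<open>The coordinate functionals are extended linearly to the whole type, since linear maps
  are total in this development.\<close>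

lemma coordinates_exist:
  fixes e :: "nat \<Rightarrow> 'a::complex_vector"
  assumes "complex_vector.independent (e ` {..<n})" "inj_on e {..<n}"
  obtains \<xi> :: "nat \<Rightarrow> 'a \<Rightarrow> complex"
  where "\<And>i. clinear (\<xi> i)" "\<And>i j. j < n \<Longrightarrow> \<xi> i (e j) = (if i = j then 1 else 0)"
    "\<And>x. x \<in> cspan (e ` {..<n}) \<Longrightarrow> (\<Sum>i<n. \<xi> i x *\<^sub>C e i) = x"
proof -
  interpret VP: vector_space_pair "scaleC :: complex \<Rightarrow> 'a \<Rightarrow> 'a" "scaleC :: complex \<Rightarrow> complex \<Rightarrow> complex"
    by (simp add: vector_space_pair_def complex_vector.vector_space_axioms)
  have "\<exists>f :: 'a \<Rightarrow> complex. clinear f \<and> (\<forall>j<n. f (e j) = (if i = j then 1 else 0))" for i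
  proof -
    obtain f :: "'a \<Rightarrow> complex" where f: "clinear f"
      "\<forall>x\<in>e ` {..<n}. f x = (if x = e i \<and> i < n then 1 else 0)"
      using VP.linear_independent_extend[OF assms(1), of "\<lambda>x. if x = e i \<and> i < n then 1 else 0"] by blast
    have "e j = e i \<and> i < n \<longleftrightarrow> i = j" if "j < n" for j
      using that assms(2) by (auto simp: inj_on_def)
    with f show ?thesis by (intro exI[of _ f]) auto
  qed
  then obtain \<xi> :: "nat \<Rightarrow> 'a \<Rightarrow> complex" where \<xi>: "\<And>i. clinear (\<xi> i)"
    "\<And>i j. j < n \<Longrightarrow> \<xi> i (e j) = (if i = j then 1 else 0)"
    by metis
  have "(\<Sum>i<n. \<xi> i x *\<^sub>C e i) = x" if "x \<in> cspan (e ` {..<n})" for x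
  proof (rule clinear_eq_on_span[OF _ clinear_ident _ that])
    show "clinear (\<lambda>x. \<Sum>i<n. \<xi> i x *\<^sub>C e i)"
      by (intro linear_intros \<xi>)
    fix x
    assume "x \<in> e ` {..<n}"
    then obtain j where j: "j < n" "x = e j" by blast
    then have "(\<Sum>i<n. \<xi> i x *\<^sub>C e i) = (\<Sum>i<n. if i = j then e j else 0)"
      by (intro sum.cong) (auto simp: \<xi> scaleC_one)
    then show "(\<Sum>i<n. \<xi> i x *\<^sub>C e i) = x" using j by simp
  qed
  with \<xi> show thesis by (rule that)
qed

lemma orthonormal_independent:
  assumes ip: "inner_product_on V ip" and e: "orthonormal_basis V ip n e" and V: "csubspace V"
  shows "complex_vector.independent (e ` {..<n})" "inj_on e {..<n}"
proof -
  have eV: "e i \<in> V" if "i < n" for i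
    using e that complex_vector.span_base[of "e i" "e ` {..<n}"] by (auto simp: orthonormal_basis_def)
  have on: "ip (e i) (e j) = (if i = j then 1 else 0)" if "i < n" "j < n" for i j
    using e that by (simp add: orthonormal_basis_def)
  show inj: "inj_on e {..<n}"
  proof (rule inj_onI)
    fix i j
    assume ij: "i \<in> {..<n}" "j \<in> {..<n}" "e i = e j"
    then have "ip (e i) (e j) = 1" using on[of j j] by simp
    then show "i = j" using on[of i j] ij by (auto split: if_splits)
  qed
  have add: "ip (x + y) z = ip x z + ip y z" and scale: "ip (c *\<^sub>C x) z = c * ip x z"
    if "x \<in> V" "y \<in> V" "z \<in> V" for x y z c
    using ip that unfolding inner_product_on_def by blast+
  have 0: "ip 0 z = 0" if "z \<in> V" for z
    using scale[OF that that that, of 0] by simp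
  \<comment> \<open>The values of \<open>ip\<close> are constrained on \<open>V\<close> only, so
    membership of the partial sums travels with the formula.\<close>
  have sum: "(\<Sum>i\<in>A. c i *\<^sub>C e i) \<in> V \<and> ip (\<Sum>i\<in>A. c i *\<^sub>C e i) z = (\<Sum>i\<in>A. c i * ip (e i) z)"
    if "A \<subseteq> {..<n}" "z \<in> V" for A c z
    using infinite_super[OF that(1)] that
  proof (induction A rule: infinite_finite_induct)
    case (insert i A)
    then have "c i *\<^sub>C e i \<in> V" "(\<Sum>i\<in>A. c i *\<^sub>C e i) \<in> V"
      using eV complex_vector.subspace_scale[OF V] by auto
    with insert show ?case
      using scale[of "e i" "e i" z "c i"] eV by (simp add: add complex_vector.subspace_add[OF V])
  qed (simp_all add: 0 complex_vector.subspace_0[OF V])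
  show "complex_vector.independent (e ` {..<n})"
  proof
    assume "complex_vector.dependent (e ` {..<n})"
    then obtain c v where c: "v \<in> e ` {..<n}" "c v \<noteq> 0" "(\<Sum>v\<in>e ` {..<n}. c v *\<^sub>C v) = 0"
      by (auto simp: complex_vector.dependent_finite)
    then obtain j where j: "j < n" "v = e j" by blast
    have "(\<Sum>i<n. c (e i) *\<^sub>C e i) = 0"
      using c(3) by (simp add: sum.reindex[OF inj])
    then have "(\<Sum>i<n. c (e i) * ip (e i) (e j)) = 0"
      using sum[of "{..<n}" "e j" "\<lambda>i. c (e i)"] eV[OF j(1)] by (simp add: 0)
    moreover have "(\<Sum>i<n. c (e i) * ip (e i) (e j)) = (\<Sum>i<n. if i = j then c (e j) else 0)"
      by (rule sum.cong) (auto simp: on j(1))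
    ultimately show False using c(2) j by simp
  qed
qed

text \<open>Gram-Schmidt: \<open>P\<close> projects orthogonally onto the span of \<open>G\<close>,
  and the new vector is the normalised remainder \<open>y\<close> unless that is zero. The form is
  total but assumed positive on \<open>V\<close> only, which fits a form written in coordinates of
  \<open>V\<close>.\<close>

lemma orthonormal_expansion_exists:
  fixes g :: "'a::complex_vector \<Rightarrow> 'a \<Rightarrow> complex"
  assumes lin: "\<And>y. clinear (\<lambda>x. g x y)" and sym: "\<And>x y. g y x = cnj (g x y)"
    and pos: "\<And>x. x \<in> V \<Longrightarrow> x \<noteq> 0 \<Longrightarrow> g x x \<noteq> 0 \<and> (\<exists>r\<ge>0. g x x = complex_of_real r)"
    and V: "csubspace V" and G: "finite G" "G \<subseteq> V"
  shows "\<exists>F. finite F \<and> F \<subseteq> cspan G \<and> (\<forall>a\<in>F. \<forall>b\<in>F. g a b = (if a = b then 1 else 0)) \<and>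
    (\<forall>x\<in>cspan G. (\<Sum>a\<in>F. g x a *\<^sub>C a) = x)"
  using G
proof (induction G rule: finite_induct)
  case empty
  show ?case by (intro exI[of _ "{}"]) simp
next
  case (insert x G)
  then have "G \<subseteq> V" by blast
  from insert.IH[OF this] obtain F where F0: "finite F \<and> F \<subseteq> cspan G \<and>
      (\<forall>a\<in>F. \<forall>b\<in>F. g a b = (if a = b then 1 else 0)) \<and> (\<forall>x\<in>cspan G. (\<Sum>a\<in>F. g x a *\<^sub>C a) = x)" ..
  note F = F0[THEN conjunct1] F0[THEN conjunct2, THEN conjunct1]
    F0[THEN conjunct2, THEN conjunct2, THEN conjunct1, rule_format]
    F0[THEN conjunct2, THEN conjunct2, THEN conjunct2, rule_format]
  define P where "P z = (\<Sum>a\<in>F. g z a *\<^sub>C a)" for z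
  have lin_P: "clinear P" unfolding P_def[abs_def] by (intro linear_intros lin)
  note g_left = clinear_add[OF lin] clinear_diff[OF lin] clinear_scale[OF lin] clinear_sum[OF lin]
    clinear_zero[OF lin]
  have P_in: "P z \<in> cspan G" for z
    unfolding P_def using F(2) by (intro complex_vector.span_sum complex_vector.span_scale) auto
  have gP: "g (P z) b = g z b" if "b \<in> F" for z b
  proof -
    have "g (P z) b = (\<Sum>a\<in>F. if a = b then g z b else 0)"
      unfolding P_def g_left by (intro sum.cong) (auto simp: F(3) that scaleC_complex_def)
    then show ?thesis using that F(1) by simp
  qed
  define y where "y = x - P x"
  have y_F: "g y b = 0" if "b \<in> F" for b
    by (simp add: y_def g_left gP[OF that])
  have y_span: "g z y = 0" if "z \<in> cspan G" for z
  proof -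
    have "g z y = g (P z) y" using F(4)[OF that] by (simp add: P_def)
    also have "\<dots> = 0" unfolding P_def g_left
      by (rule sum.neutral) (simp add: sym[of _ y] y_F scaleC_complex_def)
    finally show ?thesis .
  qed
  have sub: "cspan G \<subseteq> cspan (insert x G)"
    by (rule complex_vector.span_mono) blast
  show ?case
  proof (cases "y = 0")
    case True
    then have "x \<in> cspan G" using P_in[of x] by (simp add: y_def)
    then have "cspan (insert x G) = cspan G"
      by (rule complex_vector.span_redundant)
    then show ?thesis
      by (simp only:) (rule exI, rule F0)
  next
    case False
    have xV: "x \<in> V" using insert by simp
    have "cspan G \<subseteq> V" using insert by (intro complex_vector.span_minimal V) auto
    then have "y \<in> V"
      unfolding y_def using P_in complex_vector.subspace_diff[OF V xV] by blast
    then obtain r where r: "g y y = complex_of_real r" "r > 0"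
      using pos[OF _ False] by (auto simp: less_eq_real_def)
    define s where "s = complex_of_real (1 / sqrt r)"
    have s: "cnj s = s" "s * s * g y y = 1"
      using r by (auto simp: s_def of_real_mult[symmetric] simp del: of_real_mult)
    define b where "b = s *\<^sub>C y"
    have g_right: "g z b = s * g z y" for z
    proof -
      have "g b z = s * g y z" by (simp add: b_def g_left scaleC_complex_def)
      moreover have "g z b = cnj (g b z)" "g z y = cnj (g y z)" by (rule sym)+
      ultimately show ?thesis by (simp only: complex_cnj_mult s(1))
    qed
    have bb: "g b b = 1"
      unfolding g_right unfolding b_def by (simp add: g_left scaleC_complex_def s(2)[symmetric] mult.assoc)
    have bF: "g b a = 0" "g a b = 0" if "a \<in> F" for a
      using y_F[OF that] sym[of y a] by (simp_all add: g_right, simp add: b_def g_left scaleC_complex_def)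
    have "b \<notin> F" using bb bF by fastforce
    have expand: "(\<Sum>a\<in>insert b F. g z a *\<^sub>C a) = P z + g z b *\<^sub>C b" for z
      using \<open>b \<notin> F\<close> F(1) by (simp add: P_def add.commute)
    have "x = P x + y" by (simp add: y_def)
    have "P x + g x b *\<^sub>C b = x"
    proof -
      have "g x y = g (P x) y + g y y"
        using g_left(1)[of "P x" y y] by (simp add: y_def)
      then have "g x b = s * g y y" by (simp add: g_right y_span P_in)
      then have "g x b *\<^sub>C b = (s * s * g y y) *\<^sub>C y"
        by (simp only: b_def scaleC_scaleC mult_ac)
      then have "g x b *\<^sub>C b = y" by (simp only: s(2) scaleC_one)
      then show ?thesis using \<open>x = P x + y\<close> by simp
    qed
    then have "P z + g z b *\<^sub>C b = z" if "z \<in> cspan (insert x G)" for z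
    proof (intro clinear_eq_on_span[OF _ clinear_ident _ that])
      show "clinear (\<lambda>z. P z + g z b *\<^sub>C b)"
        by (intro linear_intros clinear_compose[OF lin_P] lin)
      fix z
      assume "z \<in> insert x G"
      then consider "z = x" | "z \<in> cspan G" using complex_vector.span_base by blast
      then show "P z + g z b *\<^sub>C b = z"
      proof cases
        case 2
        then show ?thesis using F(4) by (simp add: P_def[symmetric] g_right y_span)
      qed (use \<open>P x + g x b *\<^sub>C b = x\<close> in simp)
    qed
    moreover have "b \<in> cspan (insert x G)"
      unfolding b_def y_def using sub P_in[of x]
      by (intro complex_vector.span_scale complex_vector.span_diff complex_vector.span_base[of x]) auto
    ultimately show ?thesis
      using F sub bb bF \<open>b \<notin> F\<close>
      by (intro exI[of _ "insert b F"]) (auto simp: expand)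
  qed
qed


section \<open>Complete reducibility\<close>

lemma tensor_coordinates:
  assumes \<xi>: "\<And>i. clinear (\<xi> i)" and e: "\<And>v. v \<in> V \<Longrightarrow> (\<Sum>i<n. \<xi> i v *\<^sub>C e i) = v"
    and t: "t \<in> tensor_sub V UNIV"
  shows "(\<Sum>i<n. e i \<otimes> tlift (\<lambda>v h. \<xi> i v *\<^sub>C h) t) = t"
proof (rule clinear_eq_on_span[OF _ clinear_ident _ t[unfolded tensor_sub_def]])
  have bil: "cbilinear (\<lambda>v h. \<xi> i v *\<^sub>C h)" for i
    by (intro linear_intros \<xi>)
  show "clinear (\<lambda>t. \<Sum>i<n. e i \<otimes> tlift (\<lambda>v h. \<xi> i v *\<^sub>C h) t)"
    by (intro linear_intros \<xi>)
  fix t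
  assume "t \<in> {v \<otimes> h | v h. v \<in> V \<and> h \<in> UNIV}"
  then obtain v h where t: "t = v \<otimes> h" "v \<in> V" by blast
  have "(\<Sum>i<n. e i \<otimes> tlift (\<lambda>v h. \<xi> i v *\<^sub>C h) t) = (\<Sum>i<n. \<xi> i v *\<^sub>C e i) \<otimes> h"
    by (simp add: t tlift_tens[OF bil] tens_sum_left tens_scale_left tens_scale_right)
  then show "(\<Sum>i<n. e i \<otimes> tlift (\<lambda>v h. \<xi> i v *\<^sub>C h) t) = t"
    by (simp add: e t)
qed

context hopf_star_algebra
begin

text \<open>Applying the functional \<open>\<xi> i\<close> to the first leg of the counit and
  coassociativity axioms at \<open>e j\<close> isolates the entry \<open>u i j\<close>.\<close>

lemma corep_matrix_coefficients:
  fixes \<xi> :: "nat \<Rightarrow> 'v::complex_vector \<Rightarrow> complex"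
  assumes \<delta>: "corepresentation \<Delta> \<epsilon> V \<delta>" and \<xi>: "\<And>i. clinear (\<xi> i)"
    "\<And>i j. j < n \<Longrightarrow> \<xi> i (e j) = (if i = j then 1 else 0)"
    and e: "\<And>j. j < n \<Longrightarrow> e j \<in> V" "\<And>j. j < n \<Longrightarrow> \<delta> (e j) = (\<Sum>i<n. e i \<otimes> u i j)"
  shows "corep_matrix \<Delta> \<epsilon> n u"
  unfolding corep_matrix_def
proof (intro allI impI conjI)
  fix i j
  assume ij: "i < n" "j < n"
  have lin_\<delta>: "clinear \<delta>" using \<delta> by (simp add: corepresentation_def)
  have pick: "(\<Sum>k<n. \<xi> i (e k) *\<^sub>C x k) = x i" for x :: "nat \<Rightarrow> 'z::complex_vector"
  proof -
    have "(\<Sum>k<n. \<xi> i (e k) *\<^sub>C x k) = (\<Sum>k<n. if k = i then x i else 0)"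
      by (rule sum.cong) (auto simp: \<xi>(2) scaleC_one)
    then show ?thesis using ij by simp
  qed
  have "tlift (\<lambda>w h. \<epsilon> h *\<^sub>C w) (\<delta> (e j)) = e j"
    using \<delta> e(1)[OF ij(2)] by (simp add: corepresentation_def)
  moreover have "tlift (\<lambda>w h. \<epsilon> h *\<^sub>C w) (\<delta> (e j)) = (\<Sum>k<n. \<epsilon> (u k j) *\<^sub>C e k)"
  proof -
    have bil: "cbilinear (\<lambda>(w::'v) h. \<epsilon> h *\<^sub>C w)"
      by (intro linear_intros counit_linear)
    show ?thesis
      by (simp add: e(2)[OF ij(2)] clinear_sum[OF tlift_linear[OF bil]] tlift_tens[OF bil])
  qed
  ultimately have "\<xi> i (e j) = (\<Sum>k<n. \<xi> i (\<epsilon> (u k j) *\<^sub>C e k))"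
    by (simp add: clinear_sum[OF \<xi>(1), symmetric])
  also have "\<dots> = (\<Sum>k<n. \<xi> i (e k) *\<^sub>C \<epsilon> (u k j))"
    by (simp add: clinear_scale[OF \<xi>(1)] scaleC_complex_def mult.commute)
  finally show "\<epsilon> (u i j) = (if i = j then 1 else 0)"
    unfolding pick using ij by (simp add: \<xi>(2))
  define L where "L = tlift (\<lambda>v t. \<xi> i v *\<^sub>C t :: ('h, 'h) tensor)"
  have bil: "cbilinear (\<lambda>v t. \<xi> i v *\<^sub>C t :: ('h, 'h) tensor)"
    by (intro linear_intros \<xi>(1))
  have lin_L: "clinear L" unfolding L_def by (rule tlift_linear[OF bil])
  have lin_assoc: "clinear tassoc"
    unfolding tassoc_def by (intro tlift_linear linear_intros)
  have lin_r: "clinear (\<lambda>t. tmap \<delta> id t)" "clinear (\<lambda>t. tmap id \<Delta> t)" "clinear (\<lambda>t. tmap (\<lambda>a. a) (\<lambda>b. b \<otimes> c) t)" for c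
    unfolding tmap_def
    by (intro tlift_linear linear_intros clinear_compose[OF lin_\<delta>] clinear_compose[OF comult_linear])+
  have "tassoc (tmap \<delta> id (\<delta> (e j))) = (\<Sum>k<n. \<Sum>l<n. e l \<otimes> (u l k \<otimes> u k j))"
    by (simp add: e(2) ij clinear_sum[OF lin_r(1)] tmap_tens lin_\<delta> clinear_id
        clinear_sum[OF lin_assoc] tassoc_tens clinear_sum[OF lin_r(3)] clinear_ident linear_intros)
  then have "L (tassoc (tmap \<delta> id (\<delta> (e j)))) = (\<Sum>k<n. \<Sum>l<n. \<xi> i (e l) *\<^sub>C (u l k \<otimes> u k j))"
    by (simp add: clinear_sum[OF lin_L]) (simp add: L_def tlift_tens[OF bil])
  then have 1: "L (tassoc (tmap \<delta> id (\<delta> (e j)))) = (\<Sum>k<n. u i k \<otimes> u k j)"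
    by (simp only: pick)
  have "tmap id \<Delta> (\<delta> (e j)) = (\<Sum>k<n. e k \<otimes> \<Delta> (u k j))"
    by (simp add: e(2) ij clinear_sum[OF lin_r(2)] tmap_tens comult_linear clinear_id)
  then have "L (tmap id \<Delta> (\<delta> (e j))) = (\<Sum>k<n. \<xi> i (e k) *\<^sub>C \<Delta> (u k j))"
    by (simp add: clinear_sum[OF lin_L]) (simp add: L_def tlift_tens[OF bil])
  then have 2: "L (tmap id \<Delta> (\<delta> (e j))) = \<Delta> (u i j)"
    by (simp only: pick)
  show "\<Delta> (u i j) = (\<Sum>k<n. u i k \<otimes> u k j)"
    using \<delta> e(1)[OF ij(2)] 1 2 by (simp add: corepresentation_def)
qed

text \<open>Both matrices invert \<open>u\<close>: \<open>S(u)\<close> from the left by the antipode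
  axiom, the adjoint from the right by unitarity. The double sum computes
  \<open>S(u) u u\<^sup>*\<close> in two ways.\<close>

lemma antipode_unitary:
  assumes u: "corep_matrix \<Delta> \<epsilon> n u"
    and unitary: "\<And>i j. i < n \<Longrightarrow> j < n \<Longrightarrow> (\<Sum>k<n. u i k * star (u j k)) = (if i = j then 1 else 0)"
    and ij: "i < n" "j < n"
  shows "S (u i j) = star (u j i)"
proof -
  have bil: "cbilinear (\<lambda>a b. S a * b)"
    by (intro linear_intros hopf_linear)
  have Su: "(\<Sum>k<n. S (u i k) * u k l) = (if i = l then 1 else 0)" if "l < n" for l
  proof -
    have "(\<Sum>k<n. S (u i k) * u k l) = tlift (\<lambda>a b. S a * b) (\<Delta> (u i l))"
      using u ij(1) that
      by (simp add: corep_matrix_def clinear_sum[OF tlift_linear[OF bil]] tlift_tens[OF bil])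
    then show ?thesis
      using u ij(1) that by (simp add: antipode_left corep_matrix_def scaleC_one)
  qed
  have "S (u i j) = (\<Sum>k<n. if k = j then S (u i k) else 0)"
    using ij by simp
  also have "\<dots> = (\<Sum>k<n. \<Sum>l<n. S (u i k) * (u k l * star (u j l)))"
    by (rule sum.cong[OF refl]) (use unitary ij in \<open>simp add: sum_distrib_left[symmetric]\<close>)
  also have "\<dots> = (\<Sum>l<n. (\<Sum>k<n. S (u i k) * u k l) * star (u j l))"
    by (subst sum.swap) (simp add: sum_distrib_right mult.assoc)
  also have "\<dots> = (\<Sum>l<n. if l = i then star (u j l) else 0)"
    by (rule sum.cong) (auto simp: Su)
  finally show ?thesis using ij by simp
qed

end

context compact_matrix_quantum_group
begin

text \<open>The projection is orthogonal with respect to an invariant inner product; its kernel is invariant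
  because \<open>S (u i j) = star (u j i)\<close> turns invariance of \<open>W\<close> into invariance of the complement.\<close>

lemma equivariant_projection:
  fixes V :: "(nat \<Rightarrow>\<^sub>0 complex) set"
  assumes \<delta>: "corepresentation \<Delta> \<epsilon> V \<delta>" and fin: "finite_dim V"
    and W: "csubspace W" "W \<subseteq> V" "\<delta> ` W \<subseteq> tensor_sub W UNIV"
  obtains p where "clinear p" "\<And>v. p v \<in> W" "\<And>w. w \<in> W \<Longrightarrow> p w = w"
    "\<And>v. v \<in> V \<Longrightarrow> tmap p id (\<delta> v) = \<delta> (p v)"
proof -
  have lin_\<delta>: "clinear \<delta>" and V: "csubspace V" using \<delta> by (simp_all add: corepresentation_def)
  obtain ip n e u where ip: "inner_product_on V ip" and e: "orthonormal_basis V ip n e"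
    and \<delta>e: "\<And>j. j < n \<Longrightarrow> \<delta> (e j) = (\<Sum>i<n. e i \<otimes> u i j)"
    and unitary: "\<And>i j. i < n \<Longrightarrow> j < n \<Longrightarrow> (\<Sum>k<n. u i k * star (u j k)) = (if i = j then 1 else 0)"
    using unitarizable[OF \<delta> fin] by (auto simp: unitary_corep_def)
  have span: "cspan (e ` {..<n}) = V" using e by (simp add: orthonormal_basis_def)
  obtain \<xi> :: "nat \<Rightarrow> (nat \<Rightarrow>\<^sub>0 complex) \<Rightarrow> complex"
    where \<xi>: "\<And>i. clinear (\<xi> i)" "\<And>i j. j < n \<Longrightarrow> \<xi> i (e j) = (if i = j then 1 else 0)"
      "\<And>x. x \<in> V \<Longrightarrow> (\<Sum>i<n. \<xi> i x *\<^sub>C e i) = x"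
    using coordinates_exist[OF orthonormal_independent[OF ip e V], unfolded span] by blast
  have eV: "e j \<in> V" if "j < n" for j
    using that span complex_vector.span_base[of "e j" "e ` {..<n}"] by auto
  have S: "S (u i j) = star (u j i)" if "i < n" "j < n" for i j
    by (rule antipode_unitary[OF corep_matrix_coefficients[OF \<delta> \<xi>(1,2) eV \<delta>e] unitary that])
  \<comment> \<open>On \<open>V\<close> this is \<open>ip\<close> written in orthonormal
    coordinates. Its linearity extends to the whole type, as the total projection \<open>p\<close>
    requires.\<close>
  define g where "g x y = (\<Sum>i<n. \<xi> i x * cnj (\<xi> i y))" for x y
  have lin_g: "clinear (\<lambda>x. g x y)" for y
    unfolding g_def[abs_def]
    by (rule clinear_sum_fun) (rule clinearI; simp add: clinear_add[OF \<xi>(1)] clinear_scale[OF \<xi>(1)]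
        scaleC_complex_def algebra_simps)
  have sym: "g y x = cnj (g x y)" for x y
    by (simp add: g_def mult.commute)
  have pos: "g x x \<noteq> 0 \<and> (\<exists>r\<ge>0. g x x = complex_of_real r)" if x: "x \<in> V" "x \<noteq> 0" for x
  proof -
    have g: "g x x = complex_of_real (\<Sum>i<n. (cmod (\<xi> i x))\<^sup>2)"
      unfolding g_def by (simp only: of_real_sum complex_norm_square)
    obtain i where "i < n" "\<xi> i x \<noteq> 0"
      using \<xi>(3)[OF x(1)] x(2) by (metis (mono_tags, lifting) complex_vector.scale_zero_left lessThan_iff sum.neutral)
    then have "(\<Sum>i<n. (cmod (\<xi> i x))\<^sup>2) > 0"
      by (intro sum_pos2[of _ i]) auto
    with g show ?thesis
      by (metis less_eq_real_def of_real_eq_0_iff order_less_irrefl)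
  qed
  obtain F0 where "finite F0" "cspan F0 = V" using fin by (auto simp: finite_dim_def)
  then obtain G where G: "finite G" "cspan G = W"
    using subspace_spanned_finite[of F0 W] W by metis
  have "G \<subseteq> V" using G W complex_vector.span_superset[of G] by blast
  from orthonormal_expansion_exists[of g V G, OF lin_g sym pos V G(1) this]
  obtain F where F0: "finite F \<and> F \<subseteq> W \<and>
      (\<forall>a\<in>F. \<forall>b\<in>F. g a b = (if a = b then 1 else 0)) \<and> (\<forall>x\<in>W. (\<Sum>a\<in>F. g x a *\<^sub>C a) = x)"
    unfolding G(2) ..
  note F = F0[THEN conjunct1] F0[THEN conjunct2, THEN conjunct1]
    F0[THEN conjunct2, THEN conjunct2, THEN conjunct1, rule_format]
    F0[THEN conjunct2, THEN conjunct2, THEN conjunct2, rule_format]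
  define p where "p x = (\<Sum>a\<in>F. g x a *\<^sub>C a)" for x
  have lin_p: "clinear p" unfolding p_def[abs_def] by (intro linear_intros lin_g)
  have pW: "p x \<in> W" for x
    unfolding p_def using F(2)
    by (intro complex_vector.subspace_sum[OF W(1)] complex_vector.subspace_scale[OF W(1)]) auto
  have p_id: "p w = w" if "w \<in> W" for w using F(4)[OF that] by (simp add: p_def)
  \<comment> \<open>The matrix coefficient \<open>g(v\<^sub>0, a) v\<^sub>1\<close>. Since
    \<open>(p \<otimes> id) \<delta>(v)\<close> is the sum of \<open>a \<otimes> H v a\<close> over
    the orthonormal basis \<open>F\<close> of \<open>W\<close>, it vanishes for \<open>v\<close> in
    the kernel of \<open>p\<close> as soon as these coefficients do.\<close>
  define H where "H v a = tlift (\<lambda>x h. g x a *\<^sub>C h) (\<delta> v)" for v a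
  have bil: "cbilinear (\<lambda>x (h::'h). g x a *\<^sub>C h)" for a
    by (intro linear_intros lin_g)
  have H: "H v a = (\<Sum>j<n. \<Sum>i<n. (\<xi> j v * cnj (\<xi> i a)) *\<^sub>C u i j)" if "v \<in> V" for v a
  proof -
    have ge: "g (e i) a = cnj (\<xi> i a)" if "i < n" for i
    proof -
      have "g (e i) a = (\<Sum>k<n. if k = i then cnj (\<xi> i a) else 0)"
        unfolding g_def by (rule sum.cong) (auto simp: \<xi>(2) that)
      then show ?thesis using that by simp
    qed
    have "\<delta> v = (\<Sum>j<n. \<xi> j v *\<^sub>C (\<Sum>i<n. e i \<otimes> u i j))"
      by (subst \<xi>(3)[OF that, symmetric]) (simp add: clinear_sum[OF lin_\<delta>] clinear_scale[OF lin_\<delta>] \<delta>e)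
    then show ?thesis
      by (simp add: H_def clinear_sum[OF tlift_linear[OF bil]] clinear_scale[OF tlift_linear[OF bil]]
          tlift_tens[OF bil] ge complex_vector.scale_sum_right scaleC_scaleC)
  qed
  have H_zero: "H v a = 0" if v: "v \<in> V" "p v = 0" and a: "a \<in> W" for v a
  proof -
    have gv: "g v b = 0" if "b \<in> F" for b
    proof -
      have "g (p v) b = (\<Sum>a\<in>F. if a = b then g v b else 0)"
        unfolding p_def clinear_sum[OF lin_g] clinear_scale[OF lin_g]
        by (intro sum.cong) (auto simp: F(3) that scaleC_complex_def)
      then show ?thesis using that F(1) v(2) by (simp add: clinear_zero[OF lin_g])
    qed
    have gW: "g w v = 0" if "w \<in> W" for w
    proof -
      have "g w v = g (\<Sum>a\<in>F. g w a *\<^sub>C a) v" by (simp add: F(4) that)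
      also have "\<dots> = 0"
        unfolding clinear_sum[OF lin_g] clinear_scale[OF lin_g]
        by (rule sum.neutral) (simp add: sym[of _ v] gv scaleC_complex_def)
      finally show ?thesis .
    qed
    have "H a v = 0"
      unfolding H_def
    proof (rule clinear_eq_on_span[OF tlift_linear[OF bil] clinear_const_zero])
      show "\<delta> a \<in> cspan {w \<otimes> h | w h. w \<in> W \<and> h \<in> UNIV}"
        using W(3) a by (auto simp: tensor_sub_def)
    qed (auto simp: tlift_tens[OF bil] gW)
    \<comment> \<open>By the formula for \<open>S (u i j)\<close>, applying
      \<open>star \<circ> S\<close> exchanges the two arguments of \<open>H\<close>.\<close>
    then have "0 = star (S (H a v))"
      by (simp add: clinear_zero[OF antipode_linear] star_zero)
    also have "\<dots> = (\<Sum>j<n. \<Sum>i<n. (\<xi> i v * cnj (\<xi> j a)) *\<^sub>C star (S (u i j)))"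
      using a W(2) by (simp add: H subset_iff clinear_sum[OF antipode_linear]
          clinear_scale[OF antipode_linear] star_sum star_scaleC mult.commute)
    also have "\<dots> = (\<Sum>j<n. \<Sum>i<n. (\<xi> i v * cnj (\<xi> j a)) *\<^sub>C u j i)"
      by (simp add: S star_star)
    also have "\<dots> = H v a"
      unfolding H[OF v(1)] by (rule sum.swap)
    finally show ?thesis ..
  qed
  have lin_tp: "clinear (tmap p id)"
    unfolding tmap_def by (intro tlift_linear linear_intros clinear_compose[OF lin_p])
  have zero: "tmap p id (\<delta> v) = 0" if "v \<in> V" "p v = 0" for v
  proof -
    have "tmap p id t = (\<Sum>a\<in>F. a \<otimes> tlift (\<lambda>x h. g x a *\<^sub>C h) t)" for t :: "(nat \<Rightarrow>\<^sub>0 complex, 'h) tensor"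
    proof (rule clinear_tensor_eqI[OF lin_tp])
      show "clinear (\<lambda>t. \<Sum>a\<in>F. a \<otimes> tlift (\<lambda>x (h::'h). g x a *\<^sub>C h) t)"
        by (intro linear_intros lin_g)
    qed (simp add: tmap_tens lin_p clinear_id tlift_tens[OF bil] p_def tens_sum_left tens_scale_left
        tens_scale_right)
    then show ?thesis
      using H_zero[OF that] F(2) by (simp add: H_def[symmetric] subset_iff)
  qed
  have fixed: "tmap p id (\<delta> w) = \<delta> w" if "w \<in> W" for w
  proof (rule clinear_eq_on_span[OF lin_tp clinear_ident])
    show "\<delta> w \<in> cspan {w \<otimes> h | w h. w \<in> W \<and> h \<in> UNIV}"
      using W(3) that by (auto simp: tensor_sub_def)
  qed (auto simp: tmap_tens lin_p clinear_id p_id)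
  have "tmap p id (\<delta> v) = \<delta> (p v)" if "v \<in> V" for v
  proof -
    have "v - p v \<in> V"
      using that pW W(2) by (intro complex_vector.subspace_diff[OF V]) auto
    moreover have "p (v - p v) = 0"
      by (simp add: clinear_diff[OF lin_p] p_id pW)
    ultimately have "tmap p id (\<delta> (v - p v)) = 0" by (rule zero)
    then show ?thesis
      by (simp add: clinear_diff[OF lin_\<delta>] clinear_diff[OF lin_tp] fixed pW)
  qed
  with lin_p pW p_id show thesis by (intro that[of p])
qed

end


section \<open>Frames of covariant maps\<close>

context qpb_calculus
begin

text \<open>A coefficient is stored as a formula \<open>ws\<close> that does not involve
  \<open>\<tau>\<close>, so one frame serves all covariant maps. In the right-handed version,
  applying it to morphisms into \<open>P\<close> determines the kernel of evaluation, and applying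
  it to form-valued maps gives preimages.\<close>

definition left_coeff :: "('v::complex_vector \<Rightarrow> 'w) \<Rightarrow> ('v \<times> 'p) list \<Rightarrow> 'w"
  where "left_coeff \<tau> ws = (\<Sum>(w, c)\<leftarrow>ws. \<tau> w * iP c)"

definition left_frame :: "'v::complex_vector set \<Rightarrow> ('v \<Rightarrow> ('v, 'h) tensor) \<Rightarrow>
    (('v \<Rightarrow> 'p) \<times> ('v \<times> 'p) list) list \<Rightarrow> bool"
  where "left_frame V \<delta> L \<longleftrightarrow> (\<forall>(T, ws)\<in>set L. T \<in> Mor V \<delta> UNIV \<Delta>P) \<and>
    (\<forall>\<tau>. covariant V \<delta> \<tau> \<longrightarrow> (\<forall>(T, ws)\<in>set L. left_coeff \<tau> ws \<in> \<Omega>B) \<and>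
      (\<forall>v\<in>V. \<tau> v = (\<Sum>(T, ws)\<leftarrow>L. left_coeff \<tau> ws * iP (T v))))"

text \<open>Inserting \<open>\<Sum>\<^sub>k star (T\<^sub>k e\<^sub>i) * T\<^sub>k e\<^sub>j =
  \<delta>\<^sub>i\<^sub>j\<close> into \<open>\<tau> e\<^sub>j = \<Sum>\<^sub>i \<tau> e\<^sub>i
  \<delta>\<^sub>i\<^sub>j\<close> shows that
  \<open>\<Sum>\<^sub>i \<tau> e\<^sub>i * star (T\<^sub>k e\<^sub>i)\<close> is the coefficient of
  \<open>T\<^sub>k\<close>.\<close>

lemma left_frame_irreducible:
  fixes V :: "(nat \<Rightarrow>\<^sub>0 complex) set"
  assumes \<delta>: "corepresentation \<Delta> \<epsilon> V \<delta>" and fin: "finite_dim V" and irr: "irreducible_corep V \<delta>"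
  shows "\<exists>L. left_frame V \<delta> L"
proof -
  obtain ip where ip: "inner_product_on V ip" "unitary_corep V ip \<delta>"
    using unitarizable[OF \<delta> fin] by blast
  then obtain n e u where e: "orthonormal_basis V ip n e"
    and \<delta>e: "\<And>j. j < n \<Longrightarrow> \<delta> (e j) = (\<Sum>i<n. e i \<otimes> u i j)"
    and unitary: "\<And>i j. i < n \<Longrightarrow> j < n \<Longrightarrow> (\<Sum>k<n. u i k * star (u j k)) = (if i = j then 1 else 0)"
    by (auto simp: unitary_corep_def)
  obtain m T where T: "\<And>k. k < m \<Longrightarrow> T k \<in> Mor V \<delta> UNIV \<Delta>P"
    and TT: "\<And>i j. i < n \<Longrightarrow> j < n \<Longrightarrow> (\<Sum>k<(m::nat). star (T k (e i)) * T k (e j)) = (if i = j then 1 else 0)"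
    using left_generators[OF \<delta> irr ip e] by blast
  have span: "cspan (e ` {..<n}) = V" using e by (simp add: orthonormal_basis_def)
  have eV: "e j \<in> V" if "j < n" for j
    using that span complex_vector.span_base[of "e j" "e ` {..<n}"] by auto
  define ws where "ws k = map (\<lambda>i. (e i, star (T k (e i)))) [0..<n]" for k
  have coeff: "left_coeff \<tau> (ws k) = (\<Sum>i<n. \<tau> (e i) * iP (star (T k (e i))))" for \<tau> :: "_ \<Rightarrow> 'w" and k
    by (simp add: left_coeff_def ws_def comp_def interv_sum_list_conv_sum_set_nat atLeast0LessThan)
  have "left_frame V \<delta> (map (\<lambda>k. (T k, ws k)) [0..<m])"
    unfolding left_frame_def
  proof (intro conjI allI impI ballI)
    fix \<tau>
    assume \<tau>: "covariant V \<delta> \<tau>"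
    then have lin: "clinear \<tau>" by (simp add: covariant_def)
    have lin_t: "clinear (tmap \<tau> iH)" "clinear (tmap iP iH)"
      unfolding tmap_def by (intro tlift_linear bundle_linear clinear_compose[OF lin])+
    have \<tau>e: "\<Delta>\<Omega> (\<tau> (e j)) = (\<Sum>i<n. \<tau> (e i) \<otimes> iH (u i j))" if "j < n" for j
      using \<tau> eV[OF that]
      by (simp add: covariant_def \<delta>e[OF that] clinear_sum[OF lin_t(1)] tmap_tens lin iH_linear)
    \<comment> \<open>The coaction turns \<open>\<tau> e\<^sub>i\<close> and
      \<open>star (T\<^sub>k e\<^sub>i)\<close> into sums with second legs
      \<open>u\<^sub>l\<^sub>i\<close> and \<open>star u\<^sub>r\<^sub>i\<close>. When their product
      is summed over \<open>i\<close>, unitarity leaves the terms with \<open>l = r\<close>, with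
      second leg \<open>1\<close>.\<close>
    have base: "left_coeff \<tau> (ws k) \<in> \<Omega>B" if k: "k < m" for k
    proof -
      have lin_T: "clinear (T k)" and T_e: "\<And>j. j < n \<Longrightarrow> \<Delta>P (T k (e j)) = tmap (T k) id (\<delta> (e j))"
        using T[OF k] eV by (simp_all add: Mor_def)
      have lin_t': "clinear (tmap (T k) id :: _ \<Rightarrow> ('p, 'h) tensor)"
        unfolding tmap_def by (intro tlift_linear linear_intros clinear_compose[OF lin_T])
      have T_star: "\<Delta>\<Omega> (iP (star (T k (e j)))) = (\<Sum>i<n. iP (star (T k (e i))) \<otimes> iH (star (u i j)))"
        if "j < n" for j
        by (simp add: coact_extends coact_star T_e[OF that] \<delta>e[OF that] clinear_sum[OF lin_t']
            tmap_tens lin_T clinear_id tstar_sum tstar_tens clinear_sum[OF lin_t(2)] iP_linear iH_linear)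
      have "\<Delta>\<Omega> (left_coeff \<tau> (ws k)) =
          (\<Sum>i<n. gtmult (\<Sum>l<n. \<tau> (e l) \<otimes> iH (u l i)) (\<Sum>r<n. iP (star (T k (e r))) \<otimes> iH (star (u r i))))"
        by (simp add: coeff clinear_sum[OF coact_forms_linear] coact_forms_mult \<tau>e T_star)
      also have "\<dots> = (\<Sum>i<n. \<Sum>l<n. \<Sum>r<n. (\<tau> (e l) * iP (star (T k (e r)))) \<otimes> iH (u l i * star (u r i)))"
      proof -
        have lin_g: "clinear (\<lambda>s. gtmult s t)" for t :: "('w, 'g) tensor"
          by (rule clinear_gtmult_left[OF clinear_ident])
        have lin_m: "clinear (\<lambda>s. tmap (\<lambda>c. x * c) (\<lambda>e. y * e) s)" for x :: 'w and y :: 'g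
          by (intro linear_intros)
        show ?thesis
          by (simp add: clinear_sum[OF lin_g] gtmult_homogeneous_0[OF iH_degree] clinear_sum[OF lin_m]
              tmap_tens linear_intros iH_mult)
      qed
      also have "\<dots> = (\<Sum>l<n. \<Sum>r<n. \<Sum>i<n. (\<tau> (e l) * iP (star (T k (e r)))) \<otimes> iH (u l i * star (u r i)))"
        by (subst sum.swap, rule sum.cong[OF refl], rule sum.swap)
      also have "\<dots> = (\<Sum>l<n. \<Sum>r<n. (\<tau> (e l) * iP (star (T k (e r)))) \<otimes> iH (\<Sum>i<n. u l i * star (u r i)))"
        by (simp add: tens_sum_right clinear_sum[OF iH_linear])
      also have "\<dots> = (\<Sum>l<n. \<Sum>r<n. if r = l then (\<tau> (e l) * iP (star (T k (e l)))) \<otimes> 1 else 0)"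
        by (intro sum.cong) (auto simp: unitary iH_one clinear_zero[OF iH_linear])
      also have "\<dots> = left_coeff \<tau> (ws k) \<otimes> 1"
        by (simp add: coeff tens_sum_left)
      finally show ?thesis by (simp add: base_forms_def)
    qed
    then show "case x of (T, ws) \<Rightarrow> left_coeff \<tau> ws \<in> \<Omega>B" if "x \<in> set (map (\<lambda>k. (T k, ws k)) [0..<m])" for x
      using that by auto
    have lin_T: "clinear (T k)" if "k < m" for k using T[OF that] by (simp add: Mor_def)
    have "\<tau> v = (\<Sum>k<m. left_coeff \<tau> (ws k) * iP (T k v))" if "v \<in> V" for v
    proof (rule clinear_eq_on_span[OF lin _ _ that[unfolded span[symmetric]]])
      show "clinear (\<lambda>v. \<Sum>k<m. left_coeff \<tau> (ws k) * iP (T k v))"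
        by (rule clinear_sum_fun) (intro bundle_linear lin_T; simp)
      fix v
      assume "v \<in> e ` {..<n}"
      then obtain j where j: "j < n" "v = e j" by blast
      have "(\<Sum>k<m. left_coeff \<tau> (ws k) * iP (T k v)) =
          (\<Sum>k<m. \<Sum>i<n. \<tau> (e i) * iP (star (T k (e i)) * T k (e j)))"
        by (simp add: coeff j sum_distrib_right mult.assoc iP_mult)
      also have "\<dots> = (\<Sum>i<n. \<tau> (e i) * iP (\<Sum>k<m. star (T k (e i)) * T k (e j)))"
        by (subst sum.swap) (simp add: sum_distrib_left clinear_sum[OF iP_linear])
      also have "\<dots> = (\<Sum>i<n. if i = j then \<tau> (e j) else 0)"
        by (rule sum.cong) (auto simp: TT j iP_one clinear_zero[OF iP_linear])
      finally show "\<tau> v = (\<Sum>k<m. left_coeff \<tau> (ws k) * iP (T k v))"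
        using j by simp
    qed
    then show "\<tau> v = (\<Sum>(T, ws)\<leftarrow>map (\<lambda>k. (T k, ws k)) [0..<m]. left_coeff \<tau> ws * iP (T v))" if "v \<in> V" for v
      using that by (simp add: comp_def interv_sum_list_conv_sum_set_nat atLeast0LessThan)
  qed (use T in auto)
  then show ?thesis ..
qed

text \<open>Composition with the complementary equivariant projections \<open>p\<close> and
  \<open>id - p\<close> makes morphisms on the summands into morphisms on \<open>V\<close>. The
  coefficients are kept, because a map covariant on \<open>V\<close> is covariant on each
  summand.\<close>

lemma left_frame_direct_sum:
  assumes lin_\<delta>: "clinear \<delta>" and W: "left_frame W \<delta> L" "W \<subseteq> V" and W': "left_frame W' \<delta> L'" "W' \<subseteq> V"
    and p: "clinear p" "\<And>v. v \<in> V \<Longrightarrow> p v \<in> W" "\<And>v. v \<in> V \<Longrightarrow> v - p v \<in> W'"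
      "\<And>v. v \<in> V \<Longrightarrow> tmap p id (\<delta> v) = \<delta> (p v)"
  shows "\<exists>L. left_frame V \<delta> L"
proof -
  define q where "q v = v - p v" for v
  have lin_q: "clinear q" unfolding q_def[abs_def] by (intro linear_intros clinear_compose[OF p(1)])
  have qW': "q v \<in> W'" if "v \<in> V" for v using p(3)[OF that] by (simp add: q_def)
  have q: "tmap q id (\<delta> v) = \<delta> (q v)" if "v \<in> V" for v
  proof -
    have "tmap q id (\<delta> v) = \<delta> v - tmap p id (\<delta> v)"
      unfolding tmap_def q_def clinear_diff[OF clinear_tens_left[OF clinear_ident]] tlift_diff_fun
      by (simp add: tlift_tens_id)
    then show ?thesis by (simp add: p(4) that q_def clinear_diff[OF lin_\<delta>])
  qed
  have Mor: "(\<lambda>v. T (r v)) \<in> Mor V \<delta> UNIV \<Delta>P"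
    if "T \<in> Mor U \<delta> UNIV \<Delta>P" "clinear r" "\<And>v. v \<in> V \<Longrightarrow> r v \<in> U" "\<And>v. v \<in> V \<Longrightarrow> tmap r id (\<delta> v) = \<delta> (r v)"
    for T r U
  proof -
    have lin_T: "clinear T" using that(1) by (simp add: Mor_def)
    have "tmap (\<lambda>v. T (r v)) id t = tmap T id (tmap r id t)" for t :: "('a, 'h) tensor"
      by (simp add: tmap_tmap lin_T that(2) clinear_id) (simp add: id_def)
    then show ?thesis
      using that by (simp add: Mor_def clinear_compose)
  qed
  have cov: "covariant U \<delta> \<tau>" if "covariant V \<delta> \<tau>" "U \<subseteq> V" for U and \<tau> :: "_ \<Rightarrow> 'w"
    using that by (auto simp: covariant_def)
  let ?L = "map (\<lambda>(T, ws). (\<lambda>v. T (p v), ws)) L @ map (\<lambda>(T, ws). (\<lambda>v. T (q v), ws)) L'"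
  have "left_frame V \<delta> ?L"
    unfolding left_frame_def
  proof (intro conjI allI impI)
    show "\<forall>(T, ws)\<in>set ?L. T \<in> Mor V \<delta> UNIV \<Delta>P"
      using W(1) W'(1) by (auto simp: left_frame_def intro!: Mor p q lin_q qW')
    fix \<tau>
    assume \<tau>: "covariant V \<delta> \<tau>"
    then have lin: "clinear \<tau>" by (simp add: covariant_def)
    show "\<forall>(T, ws)\<in>set ?L. left_coeff \<tau> ws \<in> \<Omega>B"
      using W(1) W'(1) cov[OF \<tau> W(2)] cov[OF \<tau> W'(2)] by (fastforce simp: left_frame_def)
    show "\<forall>v\<in>V. \<tau> v = (\<Sum>(T, ws)\<leftarrow>?L. left_coeff \<tau> ws * iP (T v))"
    proof
      fix v
      assume v: "v \<in> V"
      have "\<tau> v = \<tau> (p v) + \<tau> (q v)" by (simp add: q_def clinear_diff[OF lin])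
      also have "\<tau> (p v) = (\<Sum>(T, ws)\<leftarrow>L. left_coeff \<tau> ws * iP (T (p v)))"
        using W cov[OF \<tau> W(2)] p(2)[OF v] by (auto simp: left_frame_def)
      also have "\<tau> (q v) = (\<Sum>(T, ws)\<leftarrow>L'. left_coeff \<tau> ws * iP (T (q v)))"
        using W' cov[OF \<tau> W'(2)] p(3)[OF v] by (auto simp: left_frame_def q_def)
      finally show "\<tau> v = (\<Sum>(T, ws)\<leftarrow>?L. left_coeff \<tau> ws * iP (T v))"
        by (simp add: comp_def case_prod_unfold)
    qed
  qed
  then show ?thesis ..
qed

text \<open>A nonzero proper invariant subspace \<open>W\<close> splits off by the equivariant
  projection, whose kernel is the complementary summand. Both have smaller spanning sets, and the
  process ends with irreducible constituents.\<close>

lemma left_frame_exists: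
  fixes V :: "(nat \<Rightarrow>\<^sub>0 complex) set"
  assumes "corepresentation \<Delta> \<epsilon> V \<delta>" "finite F" "cspan F = V"
  shows "\<exists>L. left_frame V \<delta> L"
  using assms
proof (induction "card F" arbitrary: V F rule: less_induct)
  case less
  note \<delta> = less.prems(1)
  have lin_\<delta>: "clinear \<delta>" and V: "csubspace V" using \<delta> by (simp_all add: corepresentation_def)
  have fin: "finite_dim V" using less.prems by (auto simp: finite_dim_def)
  show ?case
  proof (cases "V = {0}")
    case True
    \<comment> \<open>The zero space is not irreducible by definition, but every covariant map
      vanishes on it, so the empty frame suffices.\<close>
    have "left_frame V \<delta> []"
      by (auto simp: left_frame_def True covariant_def clinear_zero)
    then show ?thesis ..
  next
    case nonzero: False
    show ?thesis
    proof (cases "irreducible_corep V \<delta>")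
      case True
      then show ?thesis by (rule left_frame_irreducible[OF \<delta> fin])
    next
      case False
      then obtain W where W: "csubspace W" "W \<subseteq> V" "\<delta> ` W \<subseteq> tensor_sub W UNIV" "W \<noteq> {0}" "W \<noteq> V"
        using nonzero unfolding irreducible_corep_def by blast
      obtain p where p: "clinear p" "\<And>v. p v \<in> W" "\<And>w. w \<in> W \<Longrightarrow> p w = w"
        "\<And>v. v \<in> V \<Longrightarrow> tmap p id (\<delta> v) = \<delta> (p v)"
        using equivariant_projection[OF \<delta> fin W(1-3)] by metis
      define W' where "W' = {v \<in> V. p v = 0}"
      have W'V: "W' \<subseteq> V" by (auto simp: W'_def)
      have sub_W': "csubspace W'"
        by (rule complex_vector.subspaceI)
          (auto simp: W'_def clinear_zero[OF p(1)] clinear_add[OF p(1)] clinear_scale[OF p(1)]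
            complex_vector.subspace_0[OF V] complex_vector.subspace_add[OF V] complex_vector.subspace_scale[OF V])
      have q: "v - p v \<in> W'" if "v \<in> V" for v
        using that p(2)[of v] W(2) complex_vector.subspace_diff[OF V]
        by (auto simp: W'_def clinear_diff[OF p(1)] p(3))
      \<comment> \<open>As \<open>(p \<otimes> id) \<delta>(w) = 0\<close>, the map
        \<open>(id - p) \<otimes> id\<close> leaves \<open>\<delta>(w)\<close> unchanged, and it
        sends \<open>V \<otimes> H\<close> into \<open>W' \<otimes> H\<close>.\<close>
      have "\<delta> w \<in> tensor_sub W' UNIV" if "w \<in> W'" for w
      proof -
        have w: "w \<in> V" "p w = 0" using that by (simp_all add: W'_def)
        have "\<delta> w = tlift (\<lambda>v h. (v - p v) \<otimes> h) (\<delta> w)"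
        proof -
          have "tmap p id (\<delta> w) = 0" using p(4)[OF w(1)] w(2) by (simp add: clinear_zero[OF lin_\<delta>])
          then show ?thesis
            unfolding clinear_diff[OF clinear_tens_left[OF clinear_ident]] tlift_diff_fun
            by (simp add: tlift_tens_id tmap_def)
        qed
        moreover have "tlift (\<lambda>v h. (v - p v) \<otimes> h) t \<in> tensor_sub W' UNIV" if "t \<in> tensor_sub V UNIV"
          for t :: "(nat \<Rightarrow>\<^sub>0 complex, 'h) tensor"
        proof -
          have bil: "cbilinear (\<lambda>v (h::'h). (v - p v) \<otimes> h)"
            by (intro linear_intros clinear_compose[OF p(1)])
          show ?thesis
            using that unfolding tensor_sub_def
          proof (induction t rule: complex_vector.span_induct_alt)
            case base
            show ?case by (simp add: clinear_zero[OF tlift_linear[OF bil]] complex_vector.span_zero)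
          next
            case (step c x y)
            from step(1) obtain v h where "x = v \<otimes> h" "v \<in> V" by blast
            then have "tlift (\<lambda>v h. (v - p v) \<otimes> h) x \<in> cspan {a \<otimes> b | a b. a \<in> W' \<and> b \<in> UNIV}"
              using q by (intro complex_vector.span_base) (force simp: tlift_tens[OF bil])
            then show ?case
              using step(2)
              by (simp add: clinear_add[OF tlift_linear[OF bil]] clinear_scale[OF tlift_linear[OF bil]]
                  complex_vector.span_add complex_vector.span_scale)
          qed
        qed
        moreover have "\<delta> w \<in> tensor_sub V UNIV"
          using \<delta> w(1) by (auto simp: corepresentation_def)
        ultimately show ?thesis by metis
      qed
      then have \<delta>': "corepresentation \<Delta> \<epsilon> W \<delta>" "corepresentation \<Delta> \<epsilon> W' \<delta>"
        using \<delta> W W'V sub_W' by (auto simp: corepresentation_def)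
      have W'_proper: "W' \<noteq> V"
      proof
        assume "W' = V"
        then have "w = 0" if "w \<in> W" for w
        proof -
          have "w \<in> W'" using that W(2) \<open>W' = V\<close> by blast
          then show "w = 0" using p(3)[OF that] by (simp add: W'_def)
        qed
        then show False using W(4) complex_vector.subspace_0[OF W(1)] by blast
      qed
      have IH: "\<exists>L. left_frame U \<delta> L"
        if U: "csubspace U" "U \<subseteq> V" "U \<noteq> V" "corepresentation \<Delta> \<epsilon> U \<delta>" for U
      proof -
        obtain x where x: "x \<in> cspan F" "x \<notin> U" using U less.prems(3) by blast
        obtain G where "finite G" "cspan G = U" "card G < card F"
          using subspace_spanned_finite[OF less.prems(2) U(1)] U(2) x less.prems(3) by metis
        then show ?thesis using less.hyps U(4) by blast
      qed
      obtain L L' where "left_frame W \<delta> L" "left_frame W' \<delta> L'"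
        using IH[OF W(1,2,5) \<delta>'(1)] IH[OF sub_W' W'V W'_proper \<delta>'(2)] by blast
      then show ?thesis
        by (rule left_frame_direct_sum[OF lin_\<delta> _ W(2) _ W'V p(1) _ _ p(4)]) (simp_all add: p q)
    qed
  qed
qed

section \<open>Frames with the base form on the right\<close>

definition right_coeff :: "('v::complex_vector \<Rightarrow> 'w) \<Rightarrow> ('v \<times> 'p) list \<Rightarrow> 'w"
  where "right_coeff \<tau> ws = (\<Sum>(w, c)\<leftarrow>ws. iP c * \<tau> w)"

definition right_frame :: "('v::complex_vector \<Rightarrow> ('v, 'h) tensor) \<Rightarrow>
    (('v \<Rightarrow> 'p) \<times> ('v \<times> 'p) list) list \<Rightarrow> bool"
  where "right_frame \<delta> L \<longleftrightarrow> (\<forall>(T, ws)\<in>set L. T \<in> Mor UNIV \<delta> UNIV \<Delta>P) \<and>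
    (\<forall>\<tau>. covariant UNIV \<delta> \<tau> \<longrightarrow> (\<forall>(T, ws)\<in>set L. right_coeff \<tau> ws \<in> \<Omega>B) \<and>
      (\<forall>v. \<tau> v = (\<Sum>(T, ws)\<leftarrow>L. iP (T v) * right_coeff \<tau> ws)))"

end

lemma tmap_linear: "clinear f \<Longrightarrow> clinear g \<Longrightarrow> clinear (tmap f g)"
  by (rule clinear_tmap[OF _ _ clinear_ident])

lemma csubspace_tensor_sub: "csubspace (tensor_sub E M)"
  unfolding tensor_sub_def by (rule complex_vector.subspace_span)

lemma tens_in_tensor_sub: "a \<in> E \<Longrightarrow> b \<in> M \<Longrightarrow> a \<otimes> b \<in> tensor_sub E M"
  unfolding tensor_sub_def by (rule complex_vector.span_base) blast

context qpb_calculus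
begin

text \<open>Left frames of the conjugate corepresentation \<open>star (u i j)\<close>, which is unitarizable like every
  other one, become right frames under the involution.\<close>

lemma right_frame_exists:
  fixes \<delta> :: "'v::complex_vector \<Rightarrow> ('v, 'h) tensor"
  assumes \<delta>: "corepresentation \<Delta> \<epsilon> UNIV \<delta>" and fin: "finite_dim (UNIV :: 'v set)"
  shows "\<exists>L. right_frame \<delta> L"
proof -
  have lin_\<delta>: "clinear \<delta>" using \<delta> by (simp add: corepresentation_def)
  obtain A :: "'v set" where A: "complex_vector.independent A" "cspan A = UNIV" "finite A"
  proof -
    obtain F :: "'v set" where F: "finite F" "cspan F = UNIV" using fin by (auto simp: finite_dim_def)
    obtain A :: "'v set" where "complex_vector.independent A" "UNIV \<subseteq> cspan A"
      by (rule complex_vector.maximal_independent_subset)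
    then show thesis
      using that[of A] complex_vector.independent_span_bound[OF F(1), of A] F(2) by auto
  qed
  define n where "n = card A"
  obtain e where e: "bij_betw e {..<n} A"
    using ex_bij_betw_nat_finite[OF A(3)] by (auto simp: n_def atLeast0LessThan)
  then have eA: "e ` {..<n} = A" "inj_on e {..<n}" by (auto simp: bij_betw_def)
  obtain \<xi> :: "nat \<Rightarrow> 'v \<Rightarrow> complex" where \<xi>: "\<And>i. clinear (\<xi> i)"
    "\<And>i j. j < n \<Longrightarrow> \<xi> i (e j) = (if i = j then 1 else 0)" "\<And>x. (\<Sum>i<n. \<xi> i x *\<^sub>C e i) = x"
  proof (rule coordinates_exist[of e n])
    fix \<xi> :: "nat \<Rightarrow> 'v \<Rightarrow> complex"
    assume \<xi>: "\<And>i. clinear (\<xi> i)" "\<And>i j. j < n \<Longrightarrow> \<xi> i (e j) = (if i = j then 1 else 0)"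
      "\<And>x. x \<in> cspan (e ` {..<n}) \<Longrightarrow> (\<Sum>i<n. \<xi> i x *\<^sub>C e i) = x"
    show thesis
      by (rule that, rule \<xi>(1), erule \<xi>(2), rule \<xi>(3)) (simp add: eA A)
  qed (simp_all add: eA A)
  define u where "u i j = tlift (\<lambda>v h. \<xi> i v *\<^sub>C h) (\<delta> (e j))" for i j
  have in_sub: "t \<in> tensor_sub UNIV UNIV" for t :: "('v, 'h) tensor"
    unfolding tensor_sub_def
  proof (induction t rule: tensor_induct)
    case (tens a b)
    then show ?case by (intro complex_vector.span_base) blast
  qed (rule complex_vector.span_add)
  have \<delta>e: "\<delta> (e j) = (\<Sum>i<n. e i \<otimes> u i j)" for j
    unfolding u_def by (rule tensor_coordinates[OF \<xi>(1) \<xi>(3) in_sub, symmetric])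
  have u: "\<Delta> (u i j) = (\<Sum>k<n. u i k \<otimes> u k j)" "\<epsilon> (u i j) = (if i = j then 1 else 0)"
    if "i < n" "j < n" for i j
    using corep_matrix_coefficients[OF \<delta> \<xi>(1,2) _ \<delta>e] that by (simp_all add: corep_matrix_def)
  \<comment> \<open>The hypotheses on unitary structures and generators concern subspaces of
    \<open>nat \<Rightarrow>\<^sub>0 complex\<close>; the span of \<open>s 0, ..., s (n - 1)\<close>
    is the copy of \<open>'v\<close> that carries the conjugate corepresentation.\<close>
  define s :: "nat \<Rightarrow> nat \<Rightarrow>\<^sub>0 complex" where "s i = Poly_Mapping.single i 1" for i
  define V where "V = cspan (s ` {..<n})"
  define \<delta>' where "\<delta>' x = (\<Sum>j<n. Poly_Mapping.lookup x j *\<^sub>C (\<Sum>i<n. s i \<otimes> star (u i j)))"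
    for x :: "nat \<Rightarrow>\<^sub>0 complex"
  have lin_lookup: "clinear (\<lambda>x. Poly_Mapping.lookup (x :: nat \<Rightarrow>\<^sub>0 complex) j)" for j
    by (rule clinearI) (simp_all add: lookup_add lookup_scaleC)
  have lookup_s: "Poly_Mapping.lookup (s i) j = (if i = j then 1 else 0)" for i j
    by (simp add: s_def lookup_single when_def)
  have pick: "(\<Sum>j<n. Poly_Mapping.lookup (s i) j *\<^sub>C x j) = x i" if "i < n"
    for i and x :: "nat \<Rightarrow> 'z::complex_vector"
  proof -
    have "(\<Sum>j<n. Poly_Mapping.lookup (s i) j *\<^sub>C x j) = (\<Sum>j<n. if j = i then x i else 0)"
      by (rule sum.cong) (auto simp: lookup_s scaleC_one)
    then show ?thesis using that by simp
  qed
  have lin_\<delta>': "clinear \<delta>'"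
    unfolding \<delta>'_def[abs_def] by (intro clinear_sum_fun clinear_scaled_left lin_lookup)
  have \<delta>'s: "\<delta>' (s j) = (\<Sum>i<n. s i \<otimes> star (u i j))" if "j < n" for j
    unfolding \<delta>'_def by (rule pick[OF that])
  have sV: "s i \<in> V" if "i < n" for i
    unfolding V_def using that by (intro complex_vector.span_base) blast
  have \<delta>': "corepresentation \<Delta> \<epsilon> V \<delta>'"
    unfolding corepresentation_def
  proof (intro conjI ballI)
    show "csubspace V" unfolding V_def by (rule complex_vector.subspace_span)
    show "clinear \<delta>'" by (rule lin_\<delta>')
    show "\<delta>' ` V \<subseteq> tensor_sub V UNIV"
      by (auto simp: \<delta>'_def intro!: complex_vector.subspace_sum[OF csubspace_tensor_sub]
          complex_vector.subspace_scale[OF csubspace_tensor_sub] tens_in_tensor_sub sV)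
    fix v
    assume v: "v \<in> V"
    have bil: "cbilinear (\<lambda>(w :: nat \<Rightarrow>\<^sub>0 complex) h. \<epsilon> h *\<^sub>C w)"
      by (intro linear_intros counit_linear)
    show "tlift (\<lambda>w h. \<epsilon> h *\<^sub>C w) (\<delta>' v) = v"
    proof (rule clinear_eq_on_span[OF clinear_compose[OF tlift_linear[OF bil] lin_\<delta>'] clinear_ident _
          v[unfolded V_def]])
      fix x
      assume "x \<in> s ` {..<n}"
      then obtain j where j: "j < n" "x = s j" by blast
      have "tlift (\<lambda>w h. \<epsilon> h *\<^sub>C w) (\<delta>' x) = (\<Sum>i<n. cnj (\<epsilon> (u i j)) *\<^sub>C s i)"
        by (simp add: j \<delta>'s clinear_sum[OF tlift_linear[OF bil]] tlift_tens[OF bil] counit_star)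
      also have "\<dots> = (\<Sum>i<n. if i = j then s j else 0)"
        by (rule sum.cong) (auto simp: u j scaleC_one)
      finally show "tlift (\<lambda>w h. \<epsilon> h *\<^sub>C w) (\<delta>' x) = x" using j by simp
    qed
    have lin_assoc: "clinear tassoc"
      unfolding tassoc_def by (intro tlift_linear linear_intros)
    have lin_r: "clinear (\<lambda>t. tmap \<delta>' id t)" "clinear (\<lambda>t. tmap id \<Delta> t)"
      "clinear (\<lambda>t. tmap (\<lambda>a. a) (\<lambda>b. b \<otimes> c) t)" for c
      unfolding tmap_def
      by (intro tlift_linear linear_intros clinear_compose[OF lin_\<delta>'] clinear_compose[OF comult_linear])+
    show "tassoc (tmap \<delta>' id (\<delta>' v)) = tmap id \<Delta> (\<delta>' v)"
    proof (rule clinear_eq_on_span[where f = "\<lambda>v. tassoc (tmap \<delta>' id (\<delta>' v))", OF _ _ _ v[unfolded V_def]])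
      show "clinear (\<lambda>v. tassoc (tmap \<delta>' id (\<delta>' v)))" "clinear (\<lambda>v. tmap id \<Delta> (\<delta>' v))"
        by (intro clinear_compose[OF lin_assoc] clinear_compose[OF lin_r(1)] clinear_compose[OF lin_r(2)]
            lin_\<delta>')+
      fix x
      assume "x \<in> s ` {..<n}"
      then obtain j where j: "j < n" "x = s j" by blast
      have "tassoc (tmap \<delta>' id (\<delta>' x)) = (\<Sum>i<n. \<Sum>k<n. s k \<otimes> (star (u k i) \<otimes> star (u i j)))"
        by (simp add: j \<delta>'s clinear_sum[OF lin_r(1)] tmap_tens lin_\<delta>' clinear_id
            clinear_sum[OF lin_assoc] tassoc_tens clinear_sum[OF lin_r(3)] linear_intros)
      also have "\<dots> = (\<Sum>k<n. s k \<otimes> (\<Sum>i<n. star (u k i) \<otimes> star (u i j)))"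
        by (subst sum.swap) (simp add: tens_sum_right)
      also have "\<dots> = (\<Sum>k<n. s k \<otimes> \<Delta> (star (u k j)))"
        by (simp add: comult_star u j tstar_sum tstar_tens)
      also have "\<dots> = tmap id \<Delta> (\<delta>' x)"
        by (simp add: j \<delta>'s clinear_sum[OF lin_r(2)] tmap_tens comult_linear clinear_id)
      finally show "tassoc (tmap \<delta>' id (\<delta>' x)) = tmap id \<Delta> (\<delta>' x)" .
    qed
  qed
  obtain L where L: "left_frame V \<delta>' L"
    using left_frame_exists[OF \<delta>' _ V_def[symmetric]] by auto
  \<comment> \<open>Antilinear maps between the conjugate copy and \<open>'v\<close>, matching
    \<open>s j\<close> with \<open>e j\<close>. Placed before a linear map with \<open>star\<close>
    after it they give linear maps again, namely \<open>star \<circ> T \<circ> K\<close> and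
    \<open>star \<circ> \<tau> \<circ> J\<close>.\<close>
  define J where "J x = (\<Sum>j<n. cnj (Poly_Mapping.lookup x j) *\<^sub>C e j)" for x :: "nat \<Rightarrow>\<^sub>0 complex"
  define K where "K v = (\<Sum>j<n. cnj (\<xi> j v) *\<^sub>C s j)" for v
  have J: "J (x + y) = J x + J y" "J (c *\<^sub>C x) = cnj c *\<^sub>C J x" for x y c
    by (simp_all add: J_def lookup_add lookup_scaleC scaleC_add_left sum.distrib
        complex_vector.scale_sum_right scaleC_scaleC scaleC_complex_def)
  have K: "K (x + y) = K x + K y" "K (c *\<^sub>C x) = cnj c *\<^sub>C K x" for x y c
    by (simp_all add: K_def clinear_add[OF \<xi>(1)] clinear_scale[OF \<xi>(1)] scaleC_add_left sum.distrib
        complex_vector.scale_sum_right scaleC_scaleC scaleC_complex_def)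
  have K_V: "K v \<in> V" for v
    unfolding K_def V_def
    by (intro complex_vector.span_sum complex_vector.span_scale complex_vector.span_base) blast
  have Js: "J (s j) = e j" if "j < n" for j
  proof -
    have "J (s j) = (\<Sum>i<n. if i = j then e j else 0)"
      unfolding J_def by (rule sum.cong) (auto simp: lookup_s scaleC_one)
    then show ?thesis using that by simp
  qed
  have Ke: "K (e j) = s j" if "j < n" for j
  proof -
    have "K (e j) = (\<Sum>i<n. if i = j then s j else 0)"
      unfolding K_def by (rule sum.cong) (auto simp: \<xi>(2) that scaleC_one)
    then show ?thesis using that by simp
  qed
  have JK: "J (K v) = v" for v
  proof (rule clinear_eq_on_span[OF _ clinear_ident])
    show "clinear (\<lambda>v. J (K v))" by (rule clinearI) (simp_all add: J K)
    show "v \<in> cspan (e ` {..<n})" by (simp add: eA A)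
  qed (auto simp: Js Ke)
  define conj_map where "conj_map T v = star (T (K v))" for T :: "(nat \<Rightarrow>\<^sub>0 complex) \<Rightarrow> 'p" and v
  define L' where "L' = map (\<lambda>(T, ws). (conj_map T, map (\<lambda>(w, c). (J w, star c)) ws)) L"
  have Mor: "conj_map T \<in> Mor UNIV \<delta> UNIV \<Delta>P" if T: "T \<in> Mor V \<delta>' UNIV \<Delta>P" for T
  proof -
    have lin_T: "clinear T" and T: "\<And>v. v \<in> V \<Longrightarrow> \<Delta>P (T v) = tmap T id (\<delta>' v)"
      using T by (simp_all add: Mor_def)
    have lin: "clinear (conj_map T)"
      by (rule clinearI) (simp_all add: conj_map_def K clinear_add[OF lin_T] clinear_scale[OF lin_T]
          star_add star_scaleC)
    have "tmap (conj_map T) id (\<delta> v) = \<Delta>P (conj_map T v)" for v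
    proof (rule clinear_eq_on_span[where f = "\<lambda>v. tmap (conj_map T) id (\<delta> v)"
          and g = "\<lambda>v. \<Delta>P (conj_map T v)"])
      show "clinear (\<lambda>v. tmap (conj_map T) id (\<delta> v))" "clinear (\<lambda>v. \<Delta>P (conj_map T v))"
        by (intro clinear_compose[OF tmap_linear] lin clinear_id lin_\<delta> clinear_compose[OF coact_linear])+
      show "v \<in> cspan (e ` {..<n})" by (simp add: eA A)
      fix x
      assume "x \<in> e ` {..<n}"
      then obtain j where j: "j < n" "x = e j" by blast
      show "tmap (conj_map T) id (\<delta> x) = \<Delta>P (conj_map T x)"
        by (simp add: j \<delta>e clinear_sum[OF tmap_linear] lin lin_T clinear_id tmap_tens conj_map_def Ke coact_star T sV
            \<delta>'s tstar_sum tstar_tens star_star)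
    qed
    with lin show ?thesis by (simp add: Mor_def)
  qed
  have "right_frame \<delta> L'"
    unfolding right_frame_def
  proof (intro conjI allI impI)
    show "\<forall>(T, ws)\<in>set L'. T \<in> Mor UNIV \<delta> UNIV \<Delta>P"
      using L Mor by (auto simp: left_frame_def L'_def)
    fix \<tau>
    assume \<tau>: "covariant UNIV \<delta> \<tau>"
    then have lin_\<tau>: "clinear \<tau>" and \<tau>_coact: "\<And>v. \<Delta>\<Omega> (\<tau> v) = tmap \<tau> iH (\<delta> v)"
      by (simp_all add: covariant_def)
    define \<tau>' where "\<tau>' x = star (\<tau> (J x))" for x
    have lin: "clinear \<tau>'"
      by (rule clinearI) (simp_all add: \<tau>'_def J clinear_add[OF lin_\<tau>] clinear_scale[OF lin_\<tau>]
          star_add star_scaleC)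
    have cov: "covariant V \<delta>' \<tau>'"
      unfolding covariant_def
    proof (intro conjI ballI lin)
      fix v
      assume v: "v \<in> V"
      show "\<Delta>\<Omega> (\<tau>' v) = tmap \<tau>' iH (\<delta>' v)"
      proof (rule clinear_eq_on_span[OF _ _ _ v[unfolded V_def]])
        show "clinear (\<lambda>v. \<Delta>\<Omega> (\<tau>' v))" "clinear (\<lambda>v. tmap \<tau>' iH (\<delta>' v))"
          by (intro clinear_compose[OF tmap_linear] lin iH_linear lin_\<delta>' clinear_compose[OF coact_forms_linear])+
        fix x
        assume "x \<in> s ` {..<n}"
        then obtain j where j: "j < n" "x = s j" by blast
        show "\<Delta>\<Omega> (\<tau>' x) = tmap \<tau>' iH (\<delta>' x)"
          by (simp add: j \<delta>'s \<delta>e clinear_sum[OF tmap_linear] lin lin_\<tau> iH_linear tmap_tens \<tau>'_def Js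
              coact_forms_star \<tau>_coact tstar_sum tstar_tens iH_star)
      qed
    qed
    have coeff: "right_coeff \<tau> (map (\<lambda>(w, c). (J w, star c)) ws) = star (left_coeff \<tau>' ws)" for ws
      by (simp add: right_coeff_def left_coeff_def star_sum_list comp_def case_prod_unfold \<tau>'_def
          star_mult_0_right iP_degree iP_star star_star)
    have "\<forall>(T, ws)\<in>set L. left_coeff \<tau>' ws \<in> \<Omega>B"
      using L cov unfolding left_frame_def by blast
    then show "\<forall>(T, ws)\<in>set L'. right_coeff \<tau> ws \<in> \<Omega>B"
      by (auto simp: L'_def coeff intro!: base_forms_star)
    show "\<tau> v = (\<Sum>(T, ws)\<leftarrow>L'. iP (T v) * right_coeff \<tau> ws)" for v
    proof -
      have "\<tau> v = star (\<tau>' (K v))" by (simp add: \<tau>'_def JK star_star)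
      also have "\<tau>' (K v) = (\<Sum>(T, ws)\<leftarrow>L. left_coeff \<tau>' ws * iP (T (K v)))"
        using L cov K_V unfolding left_frame_def by blast
      also have "star \<dots> = (\<Sum>(T, ws)\<leftarrow>L'. iP (T v) * right_coeff \<tau> ws)"
        by (simp add: L'_def comp_def case_prod_unfold star_sum_list coeff[unfolded case_prod_unfold]
            star_mult_0_right iP_degree iP_star conj_map_def)
      finally show "\<tau> v = (\<Sum>(T, ws)\<leftarrow>L'. iP (T v) * right_coeff \<tau> ws)" .
    qed
  qed
  then show ?thesis ..
qed

end


section \<open>The associated bundle\<close>

lemma coset_eqI: "csubspace N \<Longrightarrow> x - y \<in> N \<Longrightarrow> coset N x = coset N y"
proof -
  have *: "coset N x \<subseteq> coset N y" if "csubspace N" "x - y \<in> N" for x y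
  proof
    fix z
    assume "z \<in> coset N x"
    then obtain r where r: "r \<in> N" "z = x + r" by (auto simp: coset_def)
    then have "z = y + ((x - y) + r)" by simp
    with r(1) that show "z \<in> coset N y"
      unfolding coset_def using complex_vector.subspace_add[of N "x - y" r] by blast
  qed
  assume "csubspace N" "x - y \<in> N"
  moreover from this have "y - x \<in> N"
    using complex_vector.subspace_neg[of N "x - y"] by simp
  ultimately show ?thesis using * by blast
qed

lemma representative_coset:
  assumes "csubspace N"
  obtains r where "r \<in> N" "representative (coset N x) = x + r"
proof -
  have "x + 0 \<in> coset N x"
    unfolding coset_def using complex_vector.subspace_0[OF assms] by blast
  then have "representative (coset N x) \<in> coset N x"
    unfolding representative_def by (rule someI)
  then show thesis using that by (auto simp: coset_def)
qed

text \<open>Scalars go into the second factor. The list is the witness for the choice made in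
  \<open>decomposition\<close>.\<close>

lemma tensor_sub_sum_list:
  assumes "csubspace M" "x \<in> tensor_sub E M"
  shows "\<exists>ps. set ps \<subseteq> E \<times> M \<and> x = (\<Sum>(T, \<mu>)\<leftarrow>ps. T \<otimes> \<mu>)"
  using assms(2) unfolding tensor_sub_def
proof (induction x rule: complex_vector.span_induct_alt)
  case base
  show ?case by (intro exI[of _ "[]"]) simp
next
  case (step c x y)
  obtain T \<mu> where x: "x = T \<otimes> \<mu>" "T \<in> E" "\<mu> \<in> M" using step(1) by blast
  obtain ps where ps: "set ps \<subseteq> E \<times> M" "y = (\<Sum>(T, \<mu>)\<leftarrow>ps. T \<otimes> \<mu>)" using step(2) by blast
  have "set ((T, c *\<^sub>C \<mu>) # ps) \<subseteq> E \<times> M"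
    using x ps complex_vector.subspace_scale[OF assms(1)] by simp
  moreover have "c *\<^sub>C x + y = (\<Sum>(T, \<mu>)\<leftarrow>(T, c *\<^sub>C \<mu>) # ps. T \<otimes> \<mu>)"
    by (simp add: x(1) ps(2) tens_scale_right)
  ultimately show ?case by blast
qed

lemma sum_list_in_subspace: "csubspace N \<Longrightarrow> (\<And>x. x \<in> set xs \<Longrightarrow> f x \<in> N) \<Longrightarrow> sum_list (map f xs) \<in> N"
  by (induction xs) (simp_all add: complex_vector.subspace_0 complex_vector.subspace_add)

lemma sum_list_apply: "(\<Sum>x\<leftarrow>xs. h x) v = (\<Sum>x\<leftarrow>xs. h x v)"
  for h :: "'x \<Rightarrow> 'v \<Rightarrow> 'w::monoid_add"
  by (induction xs) simp_all

locale associated_bundle = qpb_connection \<Delta> \<epsilon> S B \<Delta>P lact ract d \<Delta>L \<Delta>R ad iH i\<Gamma> \<Delta>W iP \<Delta>\<Omega> \<omega>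
  for \<Delta> :: "'h::star_algebra \<Rightarrow> ('h, 'h) tensor" and \<epsilon> S
    and B :: "'p::star_algebra set" and \<Delta>P
    and lact :: "'h \<Rightarrow> 'c::star_vector \<Rightarrow> 'c" and ract d \<Delta>L \<Delta>R ad
    and iH :: "'h \<Rightarrow> 'g::graded_diff_star_algebra" and i\<Gamma> \<Delta>W
    and iP :: "'p \<Rightarrow> 'w::graded_diff_star_algebra" and \<Delta>\<Omega> and \<omega> :: "'c \<Rightarrow> 'w" +
  fixes \<delta>V :: "'v::complex_vector \<Rightarrow> ('v, 'h) tensor"
  assumes corep: "corepresentation \<Delta> \<epsilon> UNIV \<delta>V" and finite_V: "finite_dim (UNIV :: 'v set)"
begin

abbreviation "E \<equiv> assoc_bundle \<delta>V \<Delta>P"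
abbreviation "N \<equiv> balanced_null iP B E \<Omega>B"
abbreviation "EB \<equiv> balanced_tensor iP B E \<Omega>B"
abbreviation "\<Upsilon> \<equiv> Upsilon iP B E \<Omega>B"

text \<open>\<open>Upsilon_inv\<close> before passing to cosets: on plain tensors linearity is
  available, and since \<open>N\<close> is killed the two agree on every coset.\<close>

definition eval :: "('v \<Rightarrow> 'p, 'w) tensor \<Rightarrow> 'v \<Rightarrow> 'w"
  where "eval = tlift (\<lambda>T \<mu>. (\<lambda>v. iP (T v) * \<mu>))"

lemma eval_bilinear: "cbilinear (\<lambda>(T :: 'v \<Rightarrow> 'p) \<mu>. (\<lambda>v. iP (T v) * \<mu>))"
  by (intro cbilinearI; rule clinearI)
    (simp_all add: fun_eq_iff scaleC_fun_def clinear_add[OF iP_linear] clinear_scale[OF iP_linear]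
      distrib_left distrib_right gmult_scaleC_left gmult_scaleC_right)

lemma eval_linear: "clinear eval"
  unfolding eval_def by (rule tlift_linear[OF eval_bilinear])

lemma eval_tens: "eval (T \<otimes> \<mu>) = (\<lambda>v. iP (T v) * \<mu>)"
  unfolding eval_def by (rule tlift_tens[OF eval_bilinear])

lemma csubspace_N: "csubspace N"
  unfolding balanced_null_def by (rule complex_vector.subspace_span)

lemma eval_N: "x \<in> N \<Longrightarrow> eval x = 0"
  unfolding balanced_null_def
  by (rule clinear_eq_on_span[OF eval_linear clinear_const_zero])
    (auto simp: clinear_diff[OF eval_linear] eval_tens iP_mult mult.assoc fun_eq_iff)

lemma bundle_right_action:
  assumes "T \<in> E" "b \<in> B"
  shows "(\<lambda>v. T v * b) \<in> E"
proof -
  have T: "clinear T" "\<And>v. tmap T id (\<delta>V v) = \<Delta>P (T v)"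
    using assms(1) by (simp_all add: assoc_bundle_def Mor_def)
  have b: "\<Delta>P b = b \<otimes> 1" using assms(2) by (simp add: base_iff)
  have "tmult t (b \<otimes> 1) = tmap (\<lambda>x. x * b) id t" for t :: "('p, 'h) tensor"
    by (rule clinear_tensor_eqI[where f = "\<lambda>t. tmult t (b \<otimes> 1)"])
      (auto simp: tmult_tens tmap_tens linear_intros clinear_tmap[OF _ _ clinear_ident]
        cbilinearD[OF tmult_bilinear])
  then have "\<Delta>P (T v * b) = tmap (\<lambda>v. T v * b) id (\<delta>V v)" for v
    by (simp add: coact_mult b T(2)[symmetric] tmap_tmap T(1) clinear_id linear_intros)
      (simp add: id_def)
  then show ?thesis
    by (simp add: assoc_bundle_def Mor_def linear_intros T(1))
qed

text \<open>A chosen representative of a coset differs from a tensor in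
  \<open>E \<otimes> \<Omega>(B)\<close> by an element of \<open>N\<close>, and has to stay in that
  subspace for sums built from representatives to define elements of \<open>EB\<close>.\<close>

lemma N_tensor_sub: "N \<subseteq> tensor_sub E \<Omega>B"
  unfolding balanced_null_def
proof (rule complex_vector.span_minimal[OF _ csubspace_tensor_sub], safe)
  fix T b \<mu>
  assume "T \<in> E" "b \<in> B" "\<mu> \<in> \<Omega>B"
  then show "(\<lambda>v. T v * b) \<otimes> \<mu> - T \<otimes> (iP b * \<mu>) \<in> tensor_sub E \<Omega>B"
    by (intro complex_vector.subspace_diff[OF csubspace_tensor_sub] tens_in_tensor_sub
        bundle_right_action base_forms_mult) (simp_all add: base_forms_iP)
qed

lemma Upsilon_inv_coset: "Upsilon_inv iP (coset N x) = eval x"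
proof -
  obtain r where "r \<in> N" "representative (coset N x) = x + r"
    by (rule representative_coset[OF csubspace_N])
  then show ?thesis
    by (simp add: Upsilon_inv_def eval_def[symmetric] clinear_add[OF eval_linear] eval_N)
qed

lemma right_coeff_linear: "clinear (\<lambda>\<tau>. right_coeff \<tau> ws :: 'w)"
  by (rule clinearI; induction ws)
    (auto simp: right_coeff_def distrib_left gmult_scaleC_right scaleC_fun_def scaleC_add_right)

text \<open>The frame expands the morphism itself as
  \<open>T = \<Sum>\<^sub>k R\<^sub>k b\<^sub>k\<close> with \<open>b\<^sub>k\<close> in
  \<open>B\<close>. Balancing moves \<open>b\<^sub>k\<close> across the tensor sign, and
  \<open>b\<^sub>k \<mu>\<close> is the frame coefficient of \<open>T\<mu>\<close>.\<close>

lemma Mor_expansion: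
  assumes L: "right_frame \<delta>V L" and T: "T \<in> E" and \<mu>: "\<mu> \<in> \<Omega>B"
  shows "T \<otimes> \<mu> - (\<Sum>(R, ws)\<leftarrow>L. R \<otimes> right_coeff (eval (T \<otimes> \<mu>)) ws) \<in> N"
proof -
  define b where "b ws = (\<Sum>(w, c)\<leftarrow>ws. c * T w)" for ws
  have coeff: "right_coeff (\<lambda>v. iP (T v)) ws = iP (b ws)" for ws
    by (simp add: right_coeff_def b_def clinear_sum_list[OF iP_linear] comp_def case_prod_unfold iP_mult)
  have cov: "covariant UNIV \<delta>V (\<lambda>v. iP (T v))"
    using T unfolding assoc_bundle_def by (rule covariant_Mor)
  have "\<forall>(R, ws)\<in>set L. R \<in> E" "\<forall>(R, ws)\<in>set L. right_coeff (\<lambda>v. iP (T v)) ws \<in> \<Omega>B"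
    using L cov unfolding right_frame_def assoc_bundle_def by blast+
  then have b: "b ws \<in> B" and R: "R \<in> E" if "(R, ws) \<in> set L" for R ws
    using that unfolding coeff base_forms_iP by blast+
  have "T v = (\<Sum>(R, ws)\<leftarrow>L. R v * b ws)" for v
  proof -
    have "iP (T v) = (\<Sum>(R, ws)\<leftarrow>L. iP (R v) * right_coeff (\<lambda>v. iP (T v)) ws)"
      using L cov unfolding right_frame_def by blast
    then have "iP (T v) = iP (\<Sum>(R, ws)\<leftarrow>L. R v * b ws)"
      by (simp add: coeff clinear_sum_list[OF iP_linear] comp_def case_prod_unfold iP_mult)
    then show ?thesis by (rule injD[OF iP_inj])
  qed
  then have "T = (\<Sum>(R, ws)\<leftarrow>L. (\<lambda>v. R v * b ws))"
    by (simp add: fun_eq_iff case_prod_unfold sum_list_apply)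
  then have "T \<otimes> \<mu> = (\<Sum>(R, ws)\<leftarrow>L. (\<lambda>v. R v * b ws) \<otimes> \<mu>)"
    by (simp add: clinear_sum_list[OF clinear_tens_left[OF clinear_ident, where b = \<mu>]] comp_def
        case_prod_unfold)
  moreover have "right_coeff (eval (T \<otimes> \<mu>)) ws = iP (b ws) * \<mu>" for ws
    unfolding coeff[symmetric] eval_tens
    by (simp add: right_coeff_def sum_list_mult_const[symmetric] comp_def case_prod_unfold mult.assoc)
  ultimately have "T \<otimes> \<mu> - (\<Sum>(R, ws)\<leftarrow>L. R \<otimes> right_coeff (eval (T \<otimes> \<mu>)) ws) =
      (\<Sum>x\<leftarrow>L. (\<lambda>v. fst x v * b (snd x)) \<otimes> \<mu> - fst x \<otimes> (iP (b (snd x)) * \<mu>))"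
    by (simp add: sum_list_subtractf case_prod_unfold)
  also have "\<dots> \<in> N"
  proof (rule sum_list_in_subspace[OF csubspace_N])
    fix x
    assume "x \<in> set L"
    then have "fst x \<in> E" "b (snd x) \<in> B"
      using R[of "fst x" "snd x"] b[of "fst x" "snd x"] by simp_all
    then show "(\<lambda>v. fst x v * b (snd x)) \<otimes> \<mu> - fst x \<otimes> (iP (b (snd x)) * \<mu>) \<in> N"
      unfolding balanced_null_def using \<mu> by (intro complex_vector.span_base) blast
  qed
  finally show ?thesis .
qed

text \<open>Modulo \<open>N\<close> the frame reconstructs \<open>x\<close> from
  \<open>eval x\<close> alone, so an element evaluating to zero is congruent to zero.\<close>

lemma eval_kernel:
  assumes "x \<in> tensor_sub E \<Omega>B" "eval x = 0"
  shows "x \<in> N"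
proof -
  obtain L where L: "right_frame \<delta>V L"
    using right_frame_exists[OF corep finite_V] by blast
  define Q where "Q x = x - (\<Sum>(R, ws)\<leftarrow>L. R \<otimes> right_coeff (eval x) ws)" for x
  have lin: "clinear (\<lambda>x. R \<otimes> right_coeff (eval x) ws)" for R :: "'v \<Rightarrow> 'p" and ws
    by (intro clinear_tens_right clinear_compose[OF right_coeff_linear] eval_linear)
  have "clinear (\<lambda>x. \<Sum>(R, ws)\<leftarrow>L. R \<otimes> right_coeff (eval x) ws)"
    by (induction L) (auto simp: clinear_const_zero intro!: clinear_plus lin)
  then have lin_Q: "clinear Q" unfolding Q_def[abs_def] by (intro linear_intros)
  have "Q x \<in> N"
    using assms(1) unfolding tensor_sub_def
  proof (induction x rule: complex_vector.span_induct_alt)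
    case base
    show ?case by (simp add: clinear_zero[OF lin_Q] complex_vector.subspace_0[OF csubspace_N])
  next
    case (step c x y)
    then have "Q x \<in> N" unfolding Q_def using Mor_expansion[OF L] by blast
    with step(2) show ?case
      by (simp add: clinear_add[OF lin_Q] clinear_scale[OF lin_Q]
          complex_vector.subspace_add[OF csubspace_N] complex_vector.subspace_scale[OF csubspace_N])
  qed
  moreover have "(\<Sum>(R, ws)\<leftarrow>L. R \<otimes> right_coeff (eval x) ws) = 0"
    unfolding assms(2) by (induction L) (auto simp: clinear_zero[OF right_coeff_linear, unfolded zero_fun_def] zero_fun_def)
  ultimately show ?thesis by (simp add: Q_def)
qed

lemma Upsilon_inv_inj: "inj_on (Upsilon_inv iP) EB"
proof (rule inj_onI)
  fix X Y
  assume "X \<in> EB" "Y \<in> EB" and eq: "Upsilon_inv iP X = Upsilon_inv iP Y"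
  then obtain x y where x: "X = coset N x" "x \<in> tensor_sub E \<Omega>B" and y: "Y = coset N y" "y \<in> tensor_sub E \<Omega>B"
    by (auto simp: balanced_tensor_def)
  have "x - y \<in> N"
    using eq x y by (intro eval_kernel complex_vector.subspace_diff[OF csubspace_tensor_sub])
      (simp_all add: Upsilon_inv_coset clinear_diff[OF eval_linear])
  then show "X = Y" unfolding x y by (rule coset_eqI[OF csubspace_N])
qed

text \<open>Covariant maps lie in the range of \<open>Upsilon_inv\<close>, the frame expansion being
  a preimage, so \<open>inv_into\<close> has a genuine value there.\<close>

lemma Upsilon_covariant:
  assumes "covariant UNIV \<delta>V \<tau>"
  shows "\<Upsilon> \<tau> \<in> EB" "Upsilon_inv iP (\<Upsilon> \<tau>) = \<tau>"
proof -
  obtain L where L: "right_frame \<delta>V L"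
    using right_frame_exists[OF corep finite_V] by blast
  define y where "y = (\<Sum>(R, ws)\<leftarrow>L. R \<otimes> right_coeff \<tau> ws)"
  have "\<forall>(R, ws)\<in>set L. R \<in> E" "\<forall>(R, ws)\<in>set L. right_coeff \<tau> ws \<in> \<Omega>B"
    using L assms unfolding right_frame_def assoc_bundle_def by blast+
  then have "y \<in> tensor_sub E \<Omega>B"
    unfolding y_def case_prod_unfold
    by (intro sum_list_in_subspace[OF csubspace_tensor_sub] tens_in_tensor_sub) auto
  then have "coset N y \<in> EB" by (simp add: balanced_tensor_def)
  moreover have "Upsilon_inv iP (coset N y) = \<tau>"
  proof
    fix v
    have "eval y v = (\<Sum>(R, ws)\<leftarrow>L. iP (R v) * right_coeff \<tau> ws)"
      by (simp add: y_def clinear_sum_list[OF eval_linear] comp_def case_prod_unfold eval_tens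
          sum_list_apply)
    also have "\<dots> = \<tau> v" using L assms unfolding right_frame_def by metis
    finally show "Upsilon_inv iP (coset N y) v = \<tau> v" by (simp add: Upsilon_inv_coset)
  qed
  ultimately have "\<tau> \<in> Upsilon_inv iP ` EB" by blast
  then show "\<Upsilon> \<tau> \<in> EB" "Upsilon_inv iP (\<Upsilon> \<tau>) = \<tau>"
    unfolding Upsilon_def by (rule inv_into_into, rule f_inv_into_f)
qed

section \<open>The induced connection and its exterior covariant derivative\<close>

lemma connection_representative:
  assumes "T \<in> E"
  defines "\<rho> \<equiv> representative (induced_connection iP B E \<Omega>B dual T)"
  shows "\<rho> \<in> tensor_sub E \<Omega>B" "eval \<rho> = (\<lambda>v. dual (iP (T v)))"
proof -
  have "covariant UNIV \<delta>V (\<lambda>v. dual (iP (T v)))"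
    using assms(1) unfolding assoc_bundle_def by (rule dual_covariant)
  then have *: "induced_connection iP B E \<Omega>B dual T \<in> EB"
    "Upsilon_inv iP (induced_connection iP B E \<Omega>B dual T) = (\<lambda>v. dual (iP (T v)))"
    using Upsilon_covariant[of "\<lambda>v. dual (iP (T v))"] by (simp_all add: induced_connection_def comp_def)
  then obtain x where x: "induced_connection iP B E \<Omega>B dual T = coset N x" "x \<in> tensor_sub E \<Omega>B"
    by (auto simp: balanced_tensor_def)
  obtain r where r: "r \<in> N" "\<rho> = x + r"
    unfolding \<rho>_def x(1) by (rule representative_coset[OF csubspace_N])
  show "\<rho> \<in> tensor_sub E \<Omega>B"
    using r x(2) N_tensor_sub complex_vector.subspace_add[OF csubspace_tensor_sub] by blast
  show "eval \<rho> = (\<lambda>v. dual (iP (T v)))"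
    using *(2) by (simp add: \<rho>_def Upsilon_inv_def eval_def)
qed

definition right_mult :: "'w \<Rightarrow> ('v \<Rightarrow> 'p, 'w) tensor \<Rightarrow> ('v \<Rightarrow> 'p, 'w) tensor"
  where "right_mult \<mu> = tmap id (\<lambda>\<nu>. \<nu> * \<mu>)"

lemma right_mult_linear: "clinear (right_mult \<mu>)"
  unfolding right_mult_def tmap_def by (intro tlift_linear linear_intros)

lemma right_mult_tens: "right_mult \<mu> (T \<otimes> \<nu>) = T \<otimes> (\<nu> * \<mu>)"
  unfolding right_mult_def by (simp add: tmap_tens[OF clinear_id] linear_intros)

lemma right_mult_tensor_sub:
  assumes "x \<in> tensor_sub E \<Omega>B" "\<mu> \<in> \<Omega>B"
  shows "right_mult \<mu> x \<in> tensor_sub E \<Omega>B"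
proof -
  have "csubspace {x. right_mult \<mu> x \<in> tensor_sub E \<Omega>B}"
    by (rule complex_vector.subspaceI)
      (simp_all add: clinear_zero[OF right_mult_linear] clinear_add[OF right_mult_linear]
        clinear_scale[OF right_mult_linear] complex_vector.subspace_0[OF csubspace_tensor_sub]
        complex_vector.subspace_add[OF csubspace_tensor_sub]
        complex_vector.subspace_scale[OF csubspace_tensor_sub])
  then have "tensor_sub E \<Omega>B \<subseteq> {x. right_mult \<mu> x \<in> tensor_sub E \<Omega>B}"
    using assms(2) by (subst tensor_sub_def, intro complex_vector.span_minimal)
      (auto simp: right_mult_tens intro!: tens_in_tensor_sub base_forms_mult)
  then show ?thesis using assms(1) by blast
qed

lemma eval_right_mult: "eval (right_mult \<mu> x) v = eval x v * \<mu>"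
  by (induction x rule: tensor_induct)
    (simp_all add: right_mult_tens eval_tens mult.assoc clinear_add[OF right_mult_linear]
      clinear_add[OF eval_linear] distrib_right)

text \<open>Whatever decomposition and representatives are chosen, evaluating the defining sum at
  \<open>v\<close> gives the sum of \<open>dual (iP (T v)) * \<mu> + iP (T v) * diff \<mu>\<close>.
  The Leibniz rule and additivity of \<open>dual\<close> recombine it, and injectivity identifies
  the coset.\<close>

lemma ext_cov_deriv_eq:
  assumes "X \<in> EB"
  shows "ext_cov_deriv iP B E \<Omega>B (induced_connection iP B E \<Omega>B dual) X = \<Upsilon> (dual \<circ> Upsilon_inv iP X)"
proof -
  let ?ps = "decomposition iP B E \<Omega>B X"
  let ?rep = "\<lambda>T. representative (induced_connection iP B E \<Omega>B dual T)"
  have "\<exists>ps. set ps \<subseteq> E \<times> \<Omega>B \<and> X = coset N (\<Sum>(T, \<mu>)\<leftarrow>ps. T \<otimes> \<mu>)"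
    using assms tensor_sub_sum_list[OF csubspace_base_forms] unfolding balanced_tensor_def by blast
  then have ps: "set ?ps \<subseteq> E \<times> \<Omega>B" and X: "X = coset N (\<Sum>(T, \<mu>)\<leftarrow>?ps. T \<otimes> \<mu>)"
    unfolding decomposition_def by (metis (mono_tags, lifting) someI_ex)+
  define y where "y = (\<Sum>(T, \<mu>)\<leftarrow>?ps. right_mult \<mu> (?rep T) + T \<otimes> diff \<mu>)"
  have "y \<in> tensor_sub E \<Omega>B"
    unfolding y_def case_prod_unfold
    using ps by (intro sum_list_in_subspace[OF csubspace_tensor_sub]
        complex_vector.subspace_add[OF csubspace_tensor_sub] right_mult_tensor_sub
        tens_in_tensor_sub connection_representative(1) base_forms_diff) auto
  then have "coset N y \<in> EB" by (simp add: balanced_tensor_def)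
  moreover have "Upsilon_inv iP (coset N y) = dual \<circ> Upsilon_inv iP X"
  proof
    fix v
    have "eval y v = (\<Sum>x\<leftarrow>?ps. eval (right_mult (snd x) (?rep (fst x)) + fst x \<otimes> diff (snd x)) v)"
      by (simp add: y_def clinear_sum_list[OF eval_linear] comp_def case_prod_unfold sum_list_apply)
    also have "\<dots> = (\<Sum>x\<leftarrow>?ps. dual (iP (fst x v) * snd x))"
    proof (rule arg_cong[where f = sum_list], rule map_cong[OF refl])
      fix x
      assume "x \<in> set ?ps"
      then have x: "fst x \<in> E" "snd x \<in> \<Omega>B" using ps by auto
      show "eval (right_mult (snd x) (?rep (fst x)) + fst x \<otimes> diff (snd x)) v =
          dual (iP (fst x v) * snd x)"
        by (simp add: clinear_add[OF eval_linear] eval_right_mult connection_representative(2)[OF x(1)]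
            eval_tens dual_Leibniz[OF x(2)])
    qed
    also have "\<dots> = dual (\<Sum>x\<leftarrow>?ps. iP (fst x v) * snd x)"
    proof -
      have "set (map (\<lambda>x. (fst x v, snd x)) ?ps) \<subseteq> UNIV \<times> \<Omega>B" using ps by auto
      from dual_sum_list[OF this] show ?thesis by (simp add: comp_def)
    qed
    also have "(\<Sum>x\<leftarrow>?ps. iP (fst x v) * snd x) = Upsilon_inv iP X v"
      by (subst X) (simp add: Upsilon_inv_coset clinear_sum_list[OF eval_linear] comp_def
          case_prod_unfold sum_list_apply eval_tens)
    finally show "Upsilon_inv iP (coset N y) v = (dual \<circ> Upsilon_inv iP X) v"
      by (simp add: Upsilon_inv_coset)
  qed
  ultimately have "\<Upsilon> (dual \<circ> Upsilon_inv iP X) = coset N y"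
    unfolding Upsilon_def using inv_into_f_f[OF Upsilon_inv_inj] by metis
  then show ?thesis by (simp add: ext_cov_deriv_def y_def right_mult_def)
qed

end

theorem proposition3p6:
  fixes \<Delta> :: "'h::star_algebra \<Rightarrow> ('h, 'h) tensor"
    and \<epsilon> :: "'h \<Rightarrow> complex"
    and S :: "'h \<Rightarrow> 'h"
    and B :: "'p::star_algebra set"
    and \<Delta>P :: "'p \<Rightarrow> ('p, 'h) tensor"
    and lact :: "'h \<Rightarrow> 'c::star_vector \<Rightarrow> 'c"
    and ract :: "'c \<Rightarrow> 'h \<Rightarrow> 'c"
    and d :: "'h \<Rightarrow> 'c"
    and \<Delta>L :: "'c \<Rightarrow> ('h, 'c) tensor"
    and \<Delta>R :: "'c \<Rightarrow> ('c, 'h) tensor"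
    and ad :: "'c \<Rightarrow> ('c, 'h) tensor"
    and iH :: "'h \<Rightarrow> 'g::graded_diff_star_algebra"
    and i\<Gamma> :: "'c \<Rightarrow> 'g"
    and \<Delta>W :: "'g \<Rightarrow> ('g, 'g) tensor"
    and iP :: "'p \<Rightarrow> 'w::graded_diff_star_algebra"
    and \<Delta>\<Omega> :: "'w \<Rightarrow> ('w, 'g) tensor"
    and \<omega> :: "'c \<Rightarrow> 'w"
    and \<delta>V :: "'v::complex_vector \<Rightarrow> ('v, 'h) tensor"
  assumes "qpb_calculus \<Delta> \<epsilon> S B \<Delta>P lact ract d \<Delta>L \<Delta>R ad iH i\<Gamma> \<Delta>W iP \<Delta>\<Omega>"
    and "quantum_principal_connection \<Delta>L ad iH i\<Gamma> \<Delta>\<Omega> \<omega>"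
    and "corepresentation \<Delta> \<epsilon> (UNIV :: 'v set) \<delta>V"
    and "finite_dim (UNIV :: 'v set)"
  shows "let E = assoc_bundle \<delta>V \<Delta>P;
             \<Omega>B = base_forms \<Delta>\<Omega>;
             D = dual_cov_deriv iH \<Delta>\<Omega> (germ_map \<Delta> S lact d) \<omega>
         in \<forall>X \<in> balanced_tensor iP B E \<Omega>B.
              ext_cov_deriv iP B E \<Omega>B (induced_connection iP B E \<Omega>B D) X =
                Upsilon iP B E \<Omega>B (D \<circ> Upsilon_inv iP X)"
proof -
  interpret associated_bundle \<Delta> \<epsilon> S B \<Delta>P lact ract d \<Delta>L \<Delta>R ad iH i\<Gamma> \<Delta>W iP \<Delta>\<Omega> \<omega> \<delta>V
    using assms by (intro associated_bundle.intro qpb_connection.intro associated_bundle_axioms.intro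
        qpb_connection_axioms.intro)
  show ?thesis
    unfolding Let_def using ext_cov_deriv_eq by blast
qed

end
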